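(* Let $0<\lambda\le\frac{1}{23.46}$. Consider asynchronous tatonnement with update rule $p_j^{t+}=p_j^t\big(1+\lambda\min\{\tilde z_j,1\}(t-\tau_j)\big)$ starting from strictly positive prices. (i) If every buyer has a complementary-CES utility function, then the prices converge to the market equilibrium. (ii) If every buyer has a Leontief utility function, then the prices converge toward the set of market equilibria: every limit point of the price trajectory $(p^t)_{t\ge0}$ is a market equilibrium.
   Context: A Fisher market has $n$ goods, each with supply $1$, and buyers $i$ with budgets $e_i>0$ and utility functions $u_i$. At prices $p\ge0$, buyer $i$ demands a utility-maximizing bundle $(x_{ij}(p))_j$ of cost at most $e_i$; the demand for good $j$ is $x_j(p)=\sum_ix_{ij}(p)$ and the excess demand is $z_j(p)=x_j(p)-1$. Prices $p^*$ form a market equilibrium if $z_j(p^* )=0$ whenever $p^*_j>0$ and $z_j(p^* )\le0$ whenever $p^*_j=0$. A complementary-CES utility is $u_i(x)=(\sum_ja_{ij}x_{ij}^{\rho_i})^{1/\rho_i}$ with $\rho_i\le 0$ and $a_{ij}\ge0$. A Leontief utility is $u_i(x)=\min_{j\in S_i}b_{ij}x_{ij}$ for a nonempty set $S_i$ of goods and $b_{ij}>0$. Asynchronous tatonnement: time $t\ge0$ is continuous; each price $p_j$ is changed only at discrete update times, no two updates occur simultaneously, and consecutive updates to the same price are at most one time unit apart; $p^t$ denotes current prices just before any update at time $t$ and $p_j^{t+}$ the value just after. At an update to $p_j$ at time $t$, $\tau_j$ is the time of the previous update to $p_j$ ($0$ if none), and $\tilde z_j$ is any value between the minimum and maximum of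 the excess demands $z_j(p^{t'})$ over $t'\in(\tau_j,t]$. *)

theory Defs
  imports "HOL-Analysis.Analysis"
begin

text \<open>Fisher market with goods of type 'g (finite, supply 1 each) and buyers of type 'b.
  A bundle / price vector is a function 'g \<Rightarrow> real.\<close>

text \<open>Complementary-CES utility with weights a and exponent rho \<le> 0.
  For rho < 0 we use the standard convention that x^rho = +infinity at x = 0 for a
  valued good (a_j > 0), so the utility is 0 then; goods with a_j = 0 are ignored.
  For rho = 0 the formula is read as its limit, the Cobb-Douglas utility
  (weighted geometric mean with weights a_j / sum a).\<close>
definition ces_utility :: "('g::finite \<Rightarrow> real) \<Rightarrow> real \<Rightarrow> ('g \<Rightarrow> real) \<Rightarrow> real" where
  "ces_utility a \<rho> x =
     (if \<rho> = 0 then (\<Prod>j\<in>{j. a j > 0}. x j powr (a j / (\<Sum>k\<in>UNIV. a k)))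
      else if (\<exists>j. a j > 0 \<and> x j = 0) then 0
      else (\<Sum>j\<in>{j. a j > 0}. a j * x j powr \<rho>) powr (1 / \<rho>))"

definition leontief_utility :: "'g set \<Rightarrow> ('g \<Rightarrow> real) \<Rightarrow> ('g \<Rightarrow> real) \<Rightarrow> real" where
  "leontief_utility S b x = Min ((\<lambda>j. b j * x j) ` S)"

definition demand_set :: "(('g::finite \<Rightarrow> real) \<Rightarrow> real) \<Rightarrow> real \<Rightarrow> ('g \<Rightarrow> real) \<Rightarrow> ('g \<Rightarrow> real) set" where
  "demand_set u e p =
     {x. (\<forall>j. x j \<ge> 0) \<and> (\<Sum>j\<in>UNIV. p j * x j) \<le> e \<and>
         (\<forall>y. (\<forall>j. y j \<ge> 0) \<and> (\<Sum>j\<in>UNIV. p j * y j) \<le> e \<longrightarrow> u y \<le> u x)}"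

definition market_equilibrium ::
  "('b::finite \<Rightarrow> ('g::finite \<Rightarrow> real) \<Rightarrow> real) \<Rightarrow> ('b \<Rightarrow> real) \<Rightarrow> ('g \<Rightarrow> real) \<Rightarrow> bool" where
  "market_equilibrium u e p \<longleftrightarrow>
     (\<forall>j. p j \<ge> 0) \<and>
     (\<exists>X. (\<forall>i. X i \<in> demand_set (u i) (e i) p) \<and>
          (\<forall>j. (p j > 0 \<longrightarrow> (\<Sum>i\<in>UNIV. X i j) - 1 = 0) \<and>
               (p j = 0 \<longrightarrow> (\<Sum>i\<in>UNIV. X i j) - 1 \<le> 0)))"

definition excess_demand :: "('b::finite \<Rightarrow> ('g \<Rightarrow> real) \<Rightarrow> 'g \<Rightarrow> real) \<Rightarrow> ('g \<Rightarrow> real) \<Rightarrow> 'g \<Rightarrow> real" where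
  "excess_demand x p j = (\<Sum>i\<in>UNIV. x i p j) - 1"

text \<open>Asynchronous tatonnement run.
  T j k is the time of the k-th update of price j (T j 0 = 0 is the start, the
  updates are at T j k for k \<ge> 1); q j k is the value of p_j just after its k-th update
  (q j 0 the initial price); p t is the price vector just before any update at time t.
  z is the excess demand function.  The value z~ used at each update lies between the
  minimum and maximum of z_j(p^t') over t' in (tau_j, t] (expressed by two witnesses).\<close>
definition async_tatonnement ::
  "real \<Rightarrow> (('g::finite \<Rightarrow> real) \<Rightarrow> 'g \<Rightarrow> real) \<Rightarrow> ('g \<Rightarrow> nat \<Rightarrow> real) \<Rightarrow>
   ('g \<Rightarrow> nat \<Rightarrow> real) \<Rightarrow> (real \<Rightarrow> 'g \<Rightarrow> real) \<Rightarrow> bool" where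
  "async_tatonnement lam z T q p \<longleftrightarrow>
     (\<forall>j. T j 0 = 0) \<and>
     (\<forall>j k. T j k < T j (Suc k) \<and> T j (Suc k) - T j k \<le> 1) \<and>
     (\<forall>j. filterlim (T j) at_top sequentially) \<and>
     (\<forall>j j' k k'. k \<ge> 1 \<longrightarrow> k' \<ge> 1 \<longrightarrow> T j k = T j' k' \<longrightarrow> j = j') \<and>
     (\<forall>j. q j 0 > 0) \<and>
     (\<forall>j. p 0 j = q j 0) \<and>
     (\<forall>j k t. T j k < t \<longrightarrow> t \<le> T j (Suc k) \<longrightarrow> p t j = q j k) \<and>
     (\<forall>j k. \<exists>zt.
        (\<exists>t1 t2. T j k < t1 \<and> t1 \<le> T j (Suc k) \<and> T j k < t2 \<and> t2 \<le> T j (Suc k) \<and>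
                 z (p t1) j \<le> zt \<and> zt \<le> z (p t2) j) \<and>
        q j (Suc k) = q j k * (1 + lam * min zt 1 * (T j (Suc k) - T j k)))"

end

theory Submission
  imports Defs
begin

text \<open>
  CES buyers with substitution elasticity \<open>\<sigma> = 1 / (1 - \<rho>)\<close> and Leontief buyers are treated
  uniformly: buyer \<open>i\<close> spends on good \<open>j\<close> the share \<open>s\<^sub>i\<^sub>j = c\<^sub>i\<^sub>j p\<^sub>j\<^sup>\<theta> / Y\<^sub>i\<close> of the budget, where
  \<open>Y\<^sub>i = \<Sum>\<^sub>k c\<^sub>i\<^sub>k p\<^sub>k\<^sup>\<theta>\<close> and \<open>\<theta> = 1 - \<sigma>\<close> lies in \<open>[0, 1]\<close>; \<open>\<theta> = 0\<close> is Cobb-Douglas and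
  \<open>\<theta> = 1\<close> is Leontief.

  The convex potential \<open>\<Phi> = \<Sum>\<^sub>j p\<^sub>j - \<Sum>\<^sub>i e\<^sub>i ln Y\<^sub>i / \<theta>\<^sub>i\<close> has gradient \<open>-z\<close>.  An update of \<open>p\<^sub>j\<close> by
  the factor \<open>1 + \<delta>\<close> changes \<open>\<Phi>\<close> by at most \<open>p\<^sub>j (\<delta> - x\<^sub>j ln (1 + \<delta>))\<close>, and changes the spending on
  \<open>k \<noteq> j\<close> by about \<open>\<Sum>\<^sub>i e\<^sub>i s\<^sub>i\<^sub>j s\<^sub>i\<^sub>k \<bar>\<delta>\<bar>\<close>, an expression symmetric in \<open>j\<close> and \<open>k\<close>.  The loss caused
  by outdated demands is therefore split by AM-GM between the two updates involved: each update is
  charged for at most two units of update time per other good before it and one unit after it.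
  Hence, although \<open>\<Phi>\<close> need not decrease at every update, the sum of \<open>p\<^sub>j min(z, 1)\<^sup>2 \<Delta>t\<close> over all
  updates is finite, and the prices move ever more slowly.  At every limit point a good of positive
  price then has zero excess demand.

  For CES buyers the prices of all desired goods stay away from zero, and by the law of demand the
  equilibrium is unique, which gives convergence.  For Leontief buyers the demand at a limit point
  depends only on the set of goods with positive price, so it takes finitely many values; since the
  demand moves ever more slowly, it converges.  A positive limit of the excess demand of a good
  would make its price unbounded.
\<close>

section \<open>Markets of CES buyers\<close>

lemma abs_powr_minus_one_le:
  fixes y \<theta> :: real
  assumes "0 < y" "0 \<le> \<theta>" "\<theta> \<le> 1"
  shows "\<bar>y powr \<theta> - 1\<bar> \<le> \<bar>y - 1\<bar>"
proof (cases "1 \<le> y")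
  case True
  then have "1 \<le> y powr \<theta>" using assms by (simp add: ge_one_powr_ge_zero)
  moreover have "y powr \<theta> \<le> y powr 1" using True assms by (intro powr_mono) auto
  ultimately show ?thesis using True assms by simp
next
  case False
  then have "y powr \<theta> \<le> 1" using assms by (simp add: powr_le1)
  moreover have "y powr 1 \<le> y powr \<theta>" using False assms by (intro powr_mono') auto
  ultimately show ?thesis using False assms by simp
qed

lemma powr_le_exp_mult_powr:
  fixes x y \<delta> \<theta> :: real
  assumes "0 < x" "0 < y" "\<bar>ln x - ln y\<bar> \<le> \<delta>" "0 \<le> \<theta>" "\<theta> \<le> 1"
  shows "x powr \<theta> \<le> exp \<delta> * y powr \<theta>"
proof -
  have "\<theta> * (ln x - ln y) \<le> \<theta> * \<delta>" using assms by (intro mult_left_mono) auto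
  also have "\<dots> \<le> \<delta>" using assms by (intro mult_left_le_one_le) auto
  finally have "\<theta> * ln x \<le> \<delta> + \<theta> * ln y" by (simp add: right_diff_distrib)
  then show ?thesis using assms by (simp add: powr_def flip: exp_add)
qed

lemma mult_ln_le_ln_interpolation:
  fixes s y :: real
  assumes "0 \<le> s" "s \<le> 1" "0 < y"
  shows "s * ln y \<le> ln (1 + s * (y - 1))"
proof -
  have "(1 - s) * ln 1 + s * ln y \<le> ln ((1 - s) * 1 + s * y)"
    using concave_onD[OF ln_concave, of s 1 y] assms by simp
  then show ?thesis by (simp add: algebra_simps)
qed

lemma sum_fun_upd:
  fixes f :: "'a::finite \<Rightarrow> 'b \<Rightarrow> 'c::ab_group_add"
  shows "(\<Sum>j\<in>UNIV. f j ((p(k := v)) j)) = (\<Sum>j\<in>UNIV. f j (p j)) + (f k v - f k (p k))"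
proof -
  have "(\<Sum>j\<in>UNIV. f j ((p(k := v)) j)) = f k v + (\<Sum>j\<in>UNIV - {k}. f j (p j))"
    by (subst sum.remove[of _ k]) auto
  moreover have "(\<Sum>j\<in>UNIV. f j (p j)) = f k (p k) + (\<Sum>j\<in>UNIV - {k}. f j (p j))"
    by (rule sum.remove) auto
  ultimately show ?thesis by simp
qed

locale ces_market =
  fixes e :: "'b::finite \<Rightarrow> real" and \<theta> :: "'b \<Rightarrow> real" and c :: "'b \<Rightarrow> 'g::finite \<Rightarrow> real"
  assumes e_pos: "0 < e i" and theta_nonneg: "0 \<le> \<theta> i" and theta_le_1: "\<theta> i \<le> 1"
    and c_nonneg: "0 \<le> c i j" and c_ex_pos: "\<exists>j. 0 < c i j"
begin

definition aggregate :: "'b \<Rightarrow> ('g \<Rightarrow> real) \<Rightarrow> real" where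
  "aggregate i p = (\<Sum>j\<in>UNIV. c i j * p j powr \<theta> i)"

definition share :: "'b \<Rightarrow> ('g \<Rightarrow> real) \<Rightarrow> 'g \<Rightarrow> real" where
  "share i p j = c i j * p j powr \<theta> i / aggregate i p"

definition purchase :: "'b \<Rightarrow> ('g \<Rightarrow> real) \<Rightarrow> 'g \<Rightarrow> real" where
  "purchase i p j = e i * share i p j / p j"

definition spend :: "('g \<Rightarrow> real) \<Rightarrow> 'g \<Rightarrow> real" where
  "spend p j = (\<Sum>i\<in>UNIV. e i * share i p j)"

definition cross_spend :: "('g \<Rightarrow> real) \<Rightarrow> 'g \<Rightarrow> 'g \<Rightarrow> real" where
  "cross_spend p j k = (\<Sum>i\<in>UNIV. e i * share i p j * share i p k)"

text \<open>For \<open>\<theta> i = 0\<close> this is the limit of the other case as \<open>\<theta> i\<close> tends to \<open>0\<close> with \<open>\<Sum>\<^sub>j c\<^sub>i\<^sub>j = 1\<close>.\<close>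

definition price_index :: "'b \<Rightarrow> ('g \<Rightarrow> real) \<Rightarrow> real" where
  "price_index i p =
     (if \<theta> i = 0 then (\<Sum>j\<in>UNIV. share i p j * ln (p j)) else ln (aggregate i p) / \<theta> i)"

definition potential :: "('g \<Rightarrow> real) \<Rightarrow> real" where
  "potential p = (\<Sum>j\<in>UNIV. p j) - (\<Sum>i\<in>UNIV. e i * price_index i p)"

definition wanted :: "'g \<Rightarrow> bool" where
  "wanted j \<longleftrightarrow> (\<exists>i. 0 < c i j)"

lemma e_nonneg: "0 \<le> e i"
  using e_pos[of i] by simp

lemma aggregate_pos:
  assumes "\<And>j. 0 < c i j \<Longrightarrow> 0 < p j"
  shows "0 < aggregate i p"
proof -
  obtain j where "0 < c i j" using c_ex_pos by blast
  then show ?thesis unfolding aggregate_def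
    using assms[of j] by (intro sum_pos2[where i=j]) (auto simp: c_nonneg)
qed

lemma aggregate_nonneg: "0 \<le> aggregate i p"
  unfolding aggregate_def by (intro sum_nonneg) (simp add: c_nonneg)

lemma share_nonneg: "0 \<le> share i p j"
  unfolding share_def by (simp add: c_nonneg aggregate_nonneg)

lemma share_pos:
  assumes "\<And>j. 0 < c i j \<Longrightarrow> 0 < p j" "0 < c i j"
  shows "0 < share i p j"
  unfolding share_def using assms(1)[OF assms(2)] assms(2) aggregate_pos[of i p, OF assms(1)]
  by simp

lemma share_eq_0: "\<not> 0 < c i j \<Longrightarrow> share i p j = 0"
  using c_nonneg[of i j] by (simp add: share_def)

lemma sum_share:
  assumes "\<And>j. 0 < c i j \<Longrightarrow> 0 < p j"
  shows "(\<Sum>j\<in>UNIV. share i p j) = 1"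
proof -
  have "(\<Sum>j\<in>UNIV. share i p j) = aggregate i p / aggregate i p"
    unfolding share_def by (simp add: aggregate_def flip: sum_divide_distrib)
  then show ?thesis using aggregate_pos[of i p] assms by force
qed

lemma share_le_1:
  assumes "\<And>j. 0 < p j"
  shows "share i p j \<le> 1"
proof -
  have "share i p j \<le> (\<Sum>j\<in>UNIV. share i p j)"
    by (intro member_le_sum) (auto simp: share_nonneg)
  then show ?thesis using sum_share assms by simp
qed

lemma share_eq_if_theta_0:
  assumes "\<theta> i = 0" "\<And>j. 0 < c i j \<Longrightarrow> 0 < p j" "\<And>j. 0 < c i j \<Longrightarrow> 0 < p' j"
  shows "share i p' = share i p"
proof -
  have terms_eq: "c i j * p' j powr \<theta> i = c i j * p j powr \<theta> i" for j
    using assms(1) assms(2,3)[of j] c_nonneg[of i j] by (cases "c i j = 0") force+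
  show ?thesis by (rule ext) (simp only: share_def aggregate_def terms_eq)
qed

lemma spend_nonneg: "0 \<le> spend p j"
  unfolding spend_def by (intro sum_nonneg mult_nonneg_nonneg share_nonneg e_nonneg)

lemma spend_unwanted: "\<not> wanted j \<Longrightarrow> spend p j = 0"
  unfolding spend_def wanted_def by (simp add: share_eq_0)

lemma sum_purchase: "(\<Sum>i\<in>UNIV. purchase i p j) = spend p j / p j"
  by (simp add: purchase_def spend_def sum_divide_distrib)

lemma cross_spend_nonneg: "0 \<le> cross_spend p j k"
  unfolding cross_spend_def by (intro sum_nonneg mult_nonneg_nonneg share_nonneg e_nonneg)

lemma cross_spend_commute: "cross_spend p j k = cross_spend p k j"
  unfolding cross_spend_def by (simp add: mult.assoc mult.commute[of "share _ _ j"])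

lemma sum_cross_spend:
  assumes "\<And>j. 0 < p j"
  shows "(\<Sum>k\<in>UNIV. cross_spend p j k) = spend p j"
proof -
  have "(\<Sum>k\<in>UNIV. cross_spend p j k) = (\<Sum>i\<in>UNIV. e i * share i p j * (\<Sum>k\<in>UNIV. share i p k))"
    unfolding cross_spend_def by (subst sum.swap) (simp add: sum_distrib_left)
  then show ?thesis using assms by (simp add: sum_share spend_def)
qed

lemma spend_le_budgets:
  assumes "\<And>j. 0 < p j"
  shows "spend p j \<le> (\<Sum>i\<in>UNIV. e i)"
  unfolding spend_def using share_le_1[OF assms] e_nonneg
  by (intro sum_mono) (simp add: mult_left_le)

lemma share_le_exp_mult:
  assumes p: "\<And>j. 0 < p j" and p': "\<And>j. 0 < p' j" and close: "\<And>j. \<bar>ln (p j) - ln (p' j)\<bar> \<le> \<delta>"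
  shows "share i p j \<le> exp (2 * \<delta>) * share i p' j"
proof -
  have "aggregate i p' \<le> (\<Sum>j\<in>UNIV. c i j * (exp \<delta> * p j powr \<theta> i))"
    unfolding aggregate_def using p p' close theta_nonneg theta_le_1 c_nonneg
    by (intro sum_mono mult_left_mono powr_le_exp_mult_powr) (simp_all add: abs_minus_commute)
  also have "\<dots> = exp \<delta> * aggregate i p"
    unfolding aggregate_def by (simp add: sum_distrib_left mult_ac)
  finally have aggregate_le: "aggregate i p' / exp \<delta> \<le> aggregate i p"
    by (simp add: pos_divide_le_eq mult.commute)
  have pos: "0 < aggregate i p" "0 < aggregate i p'" using aggregate_pos p p' by auto
  have "share i p j \<le> c i j * (exp \<delta> * p' j powr \<theta> i) / aggregate i p"
    unfolding share_def using p p' close theta_nonneg theta_le_1 c_nonneg pos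
    by (intro divide_right_mono mult_left_mono powr_le_exp_mult_powr) auto
  also have "\<dots> \<le> c i j * (exp \<delta> * p' j powr \<theta> i) / (aggregate i p' / exp \<delta>)"
    using aggregate_le pos c_nonneg by (intro divide_left_mono) auto
  also have "\<dots> = exp (2 * \<delta>) * share i p' j"
    unfolding share_def by (simp flip: exp_add)
  finally show ?thesis .
qed

lemma cross_spend_le_exp_mult:
  assumes "\<And>j. 0 < p j" "\<And>j. 0 < p' j" "\<And>j. \<bar>ln (p j) - ln (p' j)\<bar> \<le> \<delta>"
  shows "cross_spend p j k \<le> exp (4 * \<delta>) * cross_spend p' j k"
  unfolding cross_spend_def sum_distrib_left
proof (intro sum_mono)
  fix i
  have "share i p j * share i p k \<le> (exp (2 * \<delta>) * share i p' j) * (exp (2 * \<delta>) * share i p' k)"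
    using share_nonneg by (intro mult_mono share_le_exp_mult[OF assms]) auto
  also have "\<dots> = exp (4 * \<delta>) * (share i p' j * share i p' k)"
    using exp_add[of "2 * \<delta>" "2 * \<delta>"] by simp
  finally have "e i * (share i p j * share i p k) \<le> e i * (exp (4 * \<delta>) * (share i p' j * share i p' k))"
    using e_nonneg by (intro mult_left_mono)
  then show "e i * share i p j * share i p k \<le> exp (4 * \<delta>) * (e i * share i p' j * share i p' k)"
    by (simp add: mult_ac)
qed

abbreviation scale_price :: "('g \<Rightarrow> real) \<Rightarrow> 'g \<Rightarrow> real \<Rightarrow> 'g \<Rightarrow> real" where
  "scale_price p k \<delta> \<equiv> p(k := p k * (1 + \<delta>))"

lemma aggregate_scale_price:
  assumes p: "\<And>j. 0 < p j" and \<delta>: "-1 < \<delta>"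
  shows "aggregate i (scale_price p k \<delta>) = aggregate i p * (1 + share i p k * ((1 + \<delta>) powr \<theta> i - 1))"
proof -
  have "aggregate i (scale_price p k \<delta>) =
      aggregate i p + (c i k * (p k * (1 + \<delta>)) powr \<theta> i - c i k * p k powr \<theta> i)"
    unfolding aggregate_def by (rule sum_fun_upd)
  also have "(p k * (1 + \<delta>)) powr \<theta> i = p k powr \<theta> i * (1 + \<delta>) powr \<theta> i"
    using p[of k] \<delta> by (simp add: powr_mult)
  also have "aggregate i p + (c i k * (p k powr \<theta> i * (1 + \<delta>) powr \<theta> i) - c i k * p k powr \<theta> i)
      = aggregate i p * (1 + share i p k * ((1 + \<delta>) powr \<theta> i - 1))"
    using aggregate_pos[of i p] p by (simp add: share_def field_simps)
  finally show ?thesis .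
qed

lemma abs_share_scale_price_diff_le:
  assumes p: "\<And>j. 0 < p j" and \<delta>: "\<bar>\<delta>\<bar> < 1" and "j \<noteq> k"
  shows "\<bar>share i (scale_price p k \<delta>) j - share i p j\<bar>
    \<le> share i p j * share i p k * (\<bar>\<delta>\<bar> / (1 - \<bar>\<delta>\<bar>))"
proof -
  define h where "h = share i p k * ((1 + \<delta>) powr \<theta> i - 1)"
  have share_k: "0 \<le> share i p k" "share i p k \<le> 1" using share_nonneg share_le_1[OF p] by auto
  have "\<bar>(1 + \<delta>) powr \<theta> i - 1\<bar> \<le> \<bar>\<delta>\<bar>"
    using abs_powr_minus_one_le[of "1 + \<delta>" "\<theta> i"] \<delta> theta_nonneg theta_le_1 by simp
  then have abs_h: "\<bar>h\<bar> \<le> share i p k * \<bar>\<delta>\<bar>"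
    unfolding h_def abs_mult using share_k by (simp add: mult_left_mono)
  also have "\<dots> \<le> \<bar>\<delta>\<bar>" using share_k by (simp add: mult_left_le_one_le)
  finally have denominator: "1 - \<bar>\<delta>\<bar> \<le> 1 + h" by linarith
  then have "0 < 1 + h" using \<delta> by linarith
  moreover have "share i (scale_price p k \<delta>) j = share i p j / (1 + h)"
    unfolding share_def using aggregate_scale_price[of p \<delta> i k] p \<delta> \<open>j \<noteq> k\<close>
    by (simp add: h_def share_def)
  ultimately have "share i (scale_price p k \<delta>) j - share i p j = - share i p j * (h / (1 + h))"
    by (simp add: field_simps)
  then have "\<bar>share i (scale_price p k \<delta>) j - share i p j\<bar> = share i p j * (\<bar>h\<bar> / (1 + h))"
    using \<open>0 < 1 + h\<close> share_nonneg[of i p j] by (simp add: abs_mult)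
  also have "\<dots> \<le> share i p j * (share i p k * \<bar>\<delta>\<bar> / (1 - \<bar>\<delta>\<bar>))"
    using abs_h denominator \<delta> share_k share_nonneg[of i p j] by (intro mult_left_mono frac_le) auto
  finally show ?thesis by simp
qed

lemma abs_spend_scale_price_diff_le:
  assumes "\<And>j. 0 < p j" "\<bar>\<delta>\<bar> < 1" "j \<noteq> k"
  shows "\<bar>spend (scale_price p k \<delta>) j - spend p j\<bar> \<le> cross_spend p j k * (\<bar>\<delta>\<bar> / (1 - \<bar>\<delta>\<bar>))"
proof -
  have "\<bar>spend (scale_price p k \<delta>) j - spend p j\<bar>
      = \<bar>\<Sum>i\<in>UNIV. e i * (share i (scale_price p k \<delta>) j - share i p j)\<bar>"
    unfolding spend_def by (simp add: sum_subtractf right_diff_distrib)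
  also have "\<dots> \<le> (\<Sum>i\<in>UNIV. e i * \<bar>share i (scale_price p k \<delta>) j - share i p j\<bar>)"
    by (rule order.trans[OF sum_abs]) (simp add: abs_mult e_nonneg)
  also have "\<dots> \<le> (\<Sum>i\<in>UNIV. e i * (share i p j * share i p k * (\<bar>\<delta>\<bar> / (1 - \<bar>\<delta>\<bar>))))"
    by (intro sum_mono mult_left_mono abs_share_scale_price_diff_le assms e_nonneg)
  also have "\<dots> = cross_spend p j k * (\<bar>\<delta>\<bar> / (1 - \<bar>\<delta>\<bar>))"
    unfolding cross_spend_def sum_distrib_right by (simp add: mult_ac)
  finally show ?thesis .
qed

lemma price_index_scale_price_ge:
  assumes p: "\<And>j. 0 < p j" and \<delta>: "-1 < \<delta>"
  shows "price_index i p + share i p k * ln (1 + \<delta>) \<le> price_index i (scale_price p k \<delta>)"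
proof (cases "\<theta> i = 0")
  case True
  have "share i (scale_price p k \<delta>) = share i p"
    using p \<delta> by (intro share_eq_if_theta_0 True) auto
  moreover have "(\<Sum>j\<in>UNIV. share i p j * ln (scale_price p k \<delta> j)) = (\<Sum>j\<in>UNIV. share i p j * ln (p j))
      + (share i p k * ln (p k * (1 + \<delta>)) - share i p k * ln (p k))"
    by (rule sum_fun_upd)
  moreover have "ln (p k * (1 + \<delta>)) = ln (p k) + ln (1 + \<delta>)"
    using p[of k] \<delta> by (simp add: ln_mult)
  ultimately show ?thesis unfolding price_index_def using True by (simp add: algebra_simps)
next
  case False
  define w where "w = 1 + share i p k * ((1 + \<delta>) powr \<theta> i - 1)"
  have theta_pos: "0 < \<theta> i" using False theta_nonneg[of i] by simp
  have aggregate: "aggregate i (scale_price p k \<delta>) = aggregate i p * w"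
    unfolding w_def by (rule aggregate_scale_price[OF assms])
  have pos: "0 < aggregate i p" "0 < aggregate i (scale_price p k \<delta>)"
    using p \<delta> by (auto intro!: aggregate_pos)
  then have "0 < w" unfolding aggregate by (simp add: zero_less_mult_iff)
  have "share i p k * (\<theta> i * ln (1 + \<delta>)) \<le> ln w"
    using mult_ln_le_ln_interpolation[of "share i p k" "(1 + \<delta>) powr \<theta> i"] share_nonneg share_le_1[OF p] \<delta>
    by (simp add: ln_powr w_def)
  then have "share i p k * ln (1 + \<delta>) \<le> ln w / \<theta> i"
    using theta_pos by (simp add: field_simps)
  moreover have "ln (aggregate i (scale_price p k \<delta>)) = ln (aggregate i p) + ln w"
    unfolding aggregate using pos \<open>0 < w\<close> by (simp add: ln_mult)
  ultimately show ?thesis unfolding price_index_def using False by (simp add: add_divide_distrib)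
qed

lemma potential_scale_price_le:
  assumes "\<And>j. 0 < p j" "-1 < \<delta>"
  shows "potential (scale_price p k \<delta>) \<le> potential p + p k * \<delta> - spend p k * ln (1 + \<delta>)"
proof -
  have "(\<Sum>j\<in>UNIV. scale_price p k \<delta> j) = (\<Sum>j\<in>UNIV. p j) + (p k * (1 + \<delta>) - p k)"
    by (rule sum_fun_upd)
  moreover have "(\<Sum>i\<in>UNIV. e i * (price_index i p + share i p k * ln (1 + \<delta>)))
      \<le> (\<Sum>i\<in>UNIV. e i * price_index i (scale_price p k \<delta>))"
    by (intro sum_mono mult_left_mono price_index_scale_price_ge assms e_nonneg)
  moreover have "(\<Sum>i\<in>UNIV. e i * (price_index i p + share i p k * ln (1 + \<delta>)))
      = (\<Sum>i\<in>UNIV. e i * price_index i p) + spend p k * ln (1 + \<delta>)"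
    unfolding spend_def by (simp add: sum.distrib distrib_left sum_distrib_right mult.assoc)
  ultimately show ?thesis unfolding potential_def by (simp add: distrib_left)
qed

lemma aggregate_mono:
  assumes "\<And>j. 0 \<le> p j" "\<And>j. p j \<le> p' j"
  shows "aggregate i p \<le> aggregate i p'"
  unfolding aggregate_def using assms theta_nonneg c_nonneg
  by (intro sum_mono mult_left_mono powr_mono2) auto

lemma price_index_mono:
  assumes p: "\<And>j. 0 < p j" and p_le: "\<And>j. p j \<le> p' j"
  shows "price_index i p \<le> price_index i p'"
proof -
  have p': "0 < p' j" for j using p p_le by (rule less_le_trans)
  show ?thesis
  proof (cases "\<theta> i = 0")
    case True
    have "share i p' = share i p" using p p' by (intro share_eq_if_theta_0 True)
    then show ?thesis unfolding price_index_def
      using True p p_le share_nonneg by (auto intro!: sum_mono mult_left_mono ln_mono)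
  next
    case False
    have "aggregate i p \<le> aggregate i p'"
      using p p_le by (intro aggregate_mono) (auto simp: less_imp_le)
    then show ?thesis unfolding price_index_def
      using False theta_nonneg[of i] aggregate_pos[of i p] p
      by (auto intro!: divide_right_mono ln_mono)
  qed
qed

lemma potential_ge_if_prices_le:
  assumes p: "\<And>j. 0 < p j" and "\<And>j. p j \<le> p' j"
  shows "- (\<Sum>i\<in>UNIV. e i * price_index i p') \<le> potential p"
proof -
  have "(\<Sum>i\<in>UNIV. e i * price_index i p) \<le> (\<Sum>i\<in>UNIV. e i * price_index i p')"
    by (intro sum_mono mult_left_mono price_index_mono assms e_nonneg)
  moreover have "0 \<le> (\<Sum>j\<in>UNIV. p j)" using p by (intro sum_nonneg) (simp add: less_imp_le)
  ultimately show ?thesis unfolding potential_def by simp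
qed

end

section \<open>Amortized decrease of the potential\<close>

lemma norm_diff_le_sum_increments:
  fixes f :: "nat \<Rightarrow> 'a::real_normed_vector"
  assumes "m \<le> n" "\<And>l. \<lbrakk>m \<le> l; l < n\<rbrakk> \<Longrightarrow> norm (f (Suc l) - f l) \<le> h l"
  shows "norm (f n - f m) \<le> (\<Sum>l\<in>{m..<n}. h l)"
proof -
  have "norm (f n - f m) = norm (\<Sum>l\<in>{m..<n}. f (Suc l) - f l)"
    using assms(1) by (simp add: sum_Suc_diff')
  also have "\<dots> \<le> (\<Sum>l\<in>{m..<n}. h l)" using assms(2) by (intro sum_norm_le) auto
  finally show ?thesis .
qed

lemma abs_ln_one_plus_le:
  fixes \<delta> :: real
  assumes "\<bar>\<delta>\<bar> < 1"
  shows "\<bar>ln (1 + \<delta>)\<bar> \<le> \<bar>\<delta>\<bar> / (1 - \<bar>\<delta>\<bar>)"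
proof -
  have "- ln (1 + \<delta>) \<le> inverse (1 + \<delta>) - 1"
    using ln_le_minus_one[of "inverse (1 + \<delta>)"] assms by (simp add: ln_inverse)
  also have "\<dots> = - \<delta> / (1 + \<delta>)" using assms by (simp add: field_simps)
  also have "\<dots> \<le> \<bar>\<delta>\<bar> / (1 - \<bar>\<delta>\<bar>)" using assms by (intro frac_le) auto
  finally have "- ln (1 + \<delta>) \<le> \<bar>\<delta>\<bar> / (1 - \<bar>\<delta>\<bar>)" .
  moreover have "ln (1 + \<delta>) \<le> \<bar>\<delta>\<bar> / (1 - \<bar>\<delta>\<bar>)"
  proof -
    have "ln (1 + \<delta>) \<le> \<bar>\<delta>\<bar> / 1" using assms ln_add_one_self_le_self2[of \<delta>] by linarith
    also have "\<dots> \<le> \<bar>\<delta>\<bar> / (1 - \<bar>\<delta>\<bar>)" using assms by (intro divide_left_mono) auto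
    finally show ?thesis .
  qed
  ultimately show ?thesis by simp
qed

text \<open>Here \<open>s\<close> is the current spending on a good of price \<open>p\<close>, and \<open>a\<close> and \<open>b\<close> are outdated
  values of it.  If \<open>s \<le> 2 * p\<close>, the cap at \<open>1\<close> is harmless, as still \<open>\<bar>p * m - (s - p)\<bar> \<le> V\<close>;
  otherwise \<open>V \<le> s / 5\<close> puts \<open>m\<close> into \<open>[0, 1]\<close>.\<close>

lemma capped_response_gain:
  fixes p s a b m V :: real
  assumes p: "0 < p" and V: "0 \<le> V" "V \<le> s / 5" and a: "\<bar>a - s\<bar> \<le> V" and b: "\<bar>b - s\<bar> \<le> V"
    and m: "min (a / p - 1) 1 \<le> m" "m \<le> min (b / p - 1) 1"
  shows "p * m\<^sup>2 / 2 + s * m\<^sup>2 / 4 - \<bar>m\<bar> * V \<le> m * (s - p)"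
proof -
  have pm: "min (a - p) p \<le> p * m" "p * m \<le> min (b - p) p"
    using m p by (auto simp: min_le_iff_disj field_simps)
  show ?thesis
  proof (cases "s \<le> 2 * p")
    case True
    then have "\<bar>p * m - (s - p)\<bar> \<le> V" using V a b pm by linarith
    then have "m * (p * m - (s - p)) \<le> \<bar>m\<bar> * V"
      by (metis abs_ge_self abs_ge_zero abs_mult mult_left_mono order.trans)
    moreover have "s * m\<^sup>2 \<le> 2 * p * m\<^sup>2" using True by (intro mult_right_mono) auto
    ultimately show ?thesis by (simp add: algebra_simps power2_eq_square)
  next
    case False
    have "0 \<le> p * m" "p * m \<le> p * 1" using False V a pm p by linarith+
    then have m01: "0 \<le> m" "m \<le> 1" using p by (simp_all add: zero_le_mult_iff)
    have "m\<^sup>2 * (p / 2 + s / 4) \<le> m * (p / 2 + s / 4)"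
      using m01 False p by (intro mult_right_mono) (auto simp: power2_eq_square mult_left_le)
    also have "\<dots> \<le> m * (s - p)" using m01 False by (intro mult_left_mono) auto
    finally have "p * m\<^sup>2 / 2 + s * m\<^sup>2 / 4 \<le> m * (s - p)" by (simp add: algebra_simps)
    moreover have "0 \<le> \<bar>m\<bar> * V" using V by simp
    ultimately show ?thesis by linarith
  qed
qed

text \<open>The updates in chronological order: update \<open>n\<close> changes good \<open>g n\<close>, \<open>d n\<close> is the time since the
  previous update of that good, \<open>m n\<close> the capped excess demand it uses, \<open>P n\<close> the prices just before
  it, and \<open>window n\<close> the updates (all of other goods) since that previous update.\<close>

locale update_sequence = ces_market e \<theta> c
  for e :: "'b::finite \<Rightarrow> real" and \<theta> :: "'b \<Rightarrow> real" and c :: "'b \<Rightarrow> 'g::finite \<Rightarrow> real" +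
  fixes lam :: real and g :: "nat \<Rightarrow> 'g" and d m :: "nat \<Rightarrow> real"
    and P :: "nat \<Rightarrow> 'g \<Rightarrow> real" and window :: "nat \<Rightarrow> nat set"
  assumes lam_pos: "0 < lam" and lam_le: "lam \<le> 1 / 20"
    and d_pos: "0 < d n" and d_le: "d n \<le> 1"
    and m_ge: "-1 \<le> m n" and m_le: "m n \<le> 1"
    and P_pos: "0 < P n j"
    and P_Suc: "P (Suc n) = scale_price (P n) (g n) (lam * m n * d n)"
    and window_less: "l \<in> window n \<Longrightarrow> l < n"
    and window_upwards: "\<lbrakk>l \<in> window n; l \<le> l'; l' < n\<rbrakk> \<Longrightarrow> l' \<in> window n"
    and window_other_good: "l \<in> window n \<Longrightarrow> g l \<noteq> g n"
    and window_disjoint: "\<lbrakk>l \<in> window n; l \<in> window n'; g n = g n'\<rbrakk> \<Longrightarrow> n = n'"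
    and window_duration: "(\<Sum>l\<in>{l \<in> window n. g l = k}. d l) \<le> 2"
    and response: "\<exists>a\<in>insert n (window n). \<exists>b\<in>insert n (window n).
      min (spend (P a) (g n) / P a (g n) - 1) 1 \<le> m n \<and> m n \<le> min (spend (P b) (g n) / P b (g n) - 1) 1"
begin

definition step :: "nat \<Rightarrow> real" where
  "step n = lam * m n * d n"

lemma abs_step: "\<bar>step n\<bar> = lam * \<bar>m n\<bar> * d n"
  using lam_pos d_pos[of n] by (simp add: step_def abs_mult)

lemma abs_m_le: "\<bar>m n\<bar> \<le> 1"
  using m_ge[of n] m_le[of n] by simp

lemma abs_step_le: "\<bar>step n\<bar> \<le> lam * d n" "\<bar>step n\<bar> \<le> 1 / 20"
proof -
  have "(lam * d n) * \<bar>m n\<bar> \<le> lam * d n"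
    using lam_pos d_pos[of n] abs_m_le by (intro mult_left_le) auto
  then show "\<bar>step n\<bar> \<le> lam * d n" unfolding abs_step by (simp add: mult_ac)
  also have "\<dots> \<le> 1 / 20" using mult_mono[OF lam_le d_le, of n] d_pos[of n] by simp
  finally show "\<bar>step n\<bar> \<le> 1 / 20" .
qed

lemma step_ratio_le: "\<bar>step n\<bar> / (1 - \<bar>step n\<bar>) \<le> 20 / 19 * \<bar>step n\<bar>"
proof -
  have "\<bar>step n\<bar> / (1 - \<bar>step n\<bar>) \<le> \<bar>step n\<bar> / (19 / 20)"
    using abs_step_le(2)[of n] by (intro divide_left_mono) auto
  then show ?thesis by simp
qed

lemma finite_window: "finite (window n)"
  by (rule finite_subset[of _ "{..<n}"]) (auto dest: window_less)

lemma interval_subset_window: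
  assumes "a \<in> insert n (window n)"
  shows "{a..<n} \<subseteq> window n" "a \<le> n"
  using assms window_upwards window_less by (auto intro: less_imp_le)

lemma norm_diff_le_sum_window:
  fixes f :: "nat \<Rightarrow> 'x::real_normed_vector"
  assumes a: "a \<in> insert n (window n)"
    and increments: "\<And>l. l \<in> window n \<Longrightarrow> norm (f (Suc l) - f l) \<le> h l"
  shows "norm (f n - f a) \<le> (\<Sum>l\<in>window n. h l)"
proof -
  have "norm (f n - f a) \<le> (\<Sum>l\<in>{a..<n}. h l)"
    using interval_subset_window[OF a] by (intro norm_diff_le_sum_increments increments) auto
  also have "\<dots> \<le> (\<Sum>l\<in>window n. h l)"
    using interval_subset_window(1)[OF a] finite_window
    by (intro sum_mono2) (auto intro: order.trans[OF norm_ge_zero increments])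
  finally show ?thesis .
qed

lemma price_const_on_window:
  assumes "a \<in> insert n (window n)"
  shows "P a (g n) = P n (g n)"
proof -
  have "P (Suc l) (g n) = P l (g n)" if "l \<in> window n" for l
    using window_other_good[OF that] by (simp add: P_Suc)
  then have "norm (P n (g n) - P a (g n)) \<le> (\<Sum>l\<in>window n. 0)"
    using assms by (intro norm_diff_le_sum_window) auto
  then show ?thesis by simp
qed

lemma abs_ln_price_diff_on_window:
  assumes "a \<in> insert n (window n)"
  shows "\<bar>ln (P n k) - ln (P a k)\<bar> \<le> 2 / 19"
proof -
  define h where "h l = (if g l = k then 20 / 19 * lam * d l else 0)" for l
  have "\<bar>ln (P (Suc l) k) - ln (P l k)\<bar> \<le> h l" for l
  proof (cases "g l = k")
    case True
    have "ln (P l k * (1 + step l)) = ln (P l k) + ln (1 + step l)"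
      using P_pos[of l k] abs_step_le(2)[of l] by (intro ln_mult_pos) auto
    then have "\<bar>ln (P (Suc l) k) - ln (P l k)\<bar> = \<bar>ln (1 + step l)\<bar>"
      using True by (simp add: P_Suc step_def)
    also have "\<dots> \<le> \<bar>step l\<bar> / (1 - \<bar>step l\<bar>)"
      using abs_step_le(2)[of l] by (intro abs_ln_one_plus_le) auto
    also have "\<dots> \<le> 20 / 19 * \<bar>step l\<bar>" by (rule step_ratio_le)
    also have "\<dots> \<le> h l" using abs_step_le(1)[of l] True by (simp add: h_def)
    finally show ?thesis .
  qed (auto simp: h_def P_Suc)
  then have "\<bar>ln (P n k) - ln (P a k)\<bar> \<le> (\<Sum>l\<in>window n. h l)"
    using norm_diff_le_sum_window[OF assms, of "\<lambda>l. ln (P l k)" h] by simp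
  also have "\<dots> = 20 / 19 * lam * (\<Sum>l\<in>{l \<in> window n. g l = k}. d l)"
    unfolding h_def sum_distrib_left using finite_window by (rule sum.inter_filter[symmetric])
  also have "\<dots> \<le> 20 / 19 * (1 / 20) * 2"
    using lam_pos lam_le d_pos window_duration
    by (intro mult_mono) (auto intro!: sum_nonneg simp: less_imp_le)
  finally show ?thesis by simp
qed

definition variation :: "nat \<Rightarrow> real" where
  "variation n = (\<Sum>l\<in>window n. cross_spend (P l) (g n) (g l) * (20 / 19 * (lam * \<bar>m l\<bar> * d l)))"

lemma abs_spend_diff_le_variation:
  assumes "a \<in> insert n (window n)"
  shows "\<bar>spend (P a) (g n) - spend (P n) (g n)\<bar> \<le> variation n"
proof -
  have increment: "\<bar>spend (P (Suc l)) (g n) - spend (P l) (g n)\<bar>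
      \<le> cross_spend (P l) (g n) (g l) * (20 / 19 * (lam * \<bar>m l\<bar> * d l))" if "l \<in> window n" for l
  proof -
    have "\<bar>spend (P (Suc l)) (g n) - spend (P l) (g n)\<bar>
        \<le> cross_spend (P l) (g n) (g l) * (\<bar>step l\<bar> / (1 - \<bar>step l\<bar>))"
      unfolding P_Suc[of l] step_def[symmetric]
      using window_other_good[OF that] abs_step_le(2)[of l]
      by (intro abs_spend_scale_price_diff_le P_pos) auto
    also have "\<dots> \<le> cross_spend (P l) (g n) (g l) * (20 / 19 * \<bar>step l\<bar>)"
      by (intro mult_left_mono step_ratio_le cross_spend_nonneg)
    finally show ?thesis by (simp add: abs_step)
  qed
  show ?thesis
    using norm_diff_le_sum_window[OF assms, of "\<lambda>l. spend (P l) (g n)", OF increment[folded real_norm_def]]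
    by (simp add: variation_def abs_minus_commute)
qed

lemma sum_cross_spend_on_window:
  "(\<Sum>l\<in>window n. cross_spend (P l) (g n) (g l) * d l) \<le> 10 / 3 * spend (P n) (g n)"
proof -
  have "(\<Sum>l\<in>window n. cross_spend (P l) (g n) (g l) * d l)
      \<le> (\<Sum>l\<in>window n. (5 / 3 * cross_spend (P n) (g n) (g l)) * d l)"
  proof (intro sum_mono mult_right_mono)
    fix l assume l: "l \<in> window n"
    have "cross_spend (P l) (g n) (g l) \<le> exp (4 * (2 / 19)) * cross_spend (P n) (g n) (g l)"
      using abs_ln_price_diff_on_window[of l n] l
      by (intro cross_spend_le_exp_mult P_pos) (auto simp: abs_minus_commute)
    also have "exp (4 * (2 / 19)) \<le> (5 / 3 :: real)"
      using exp_bound[of "8 / 19"] by (simp add: power2_eq_square)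
    finally show "cross_spend (P l) (g n) (g l) \<le> 5 / 3 * cross_spend (P n) (g n) (g l)"
      using cross_spend_nonneg by (simp add: mult_right_mono)
  qed (simp add: d_pos less_imp_le)
  also have "\<dots> = (\<Sum>k\<in>UNIV. \<Sum>l\<in>{l \<in> window n. g l = k}. (5 / 3 * cross_spend (P n) (g n) (g l)) * d l)"
    using finite_window by (intro sum.group[symmetric]) auto
  also have "\<dots> = (\<Sum>k\<in>UNIV. 5 / 3 * cross_spend (P n) (g n) k * (\<Sum>l\<in>{l \<in> window n. g l = k}. d l))"
    unfolding sum_distrib_left by (intro sum.cong) auto
  also have "\<dots> \<le> (\<Sum>k\<in>UNIV. 5 / 3 * cross_spend (P n) (g n) k * 2)"
    using cross_spend_nonneg window_duration by (intro sum_mono mult_left_mono) auto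
  also have "\<dots> = 10 / 3 * (\<Sum>k\<in>UNIV. cross_spend (P n) (g n) k)" by (simp add: sum_distrib_left)
  also have "(\<Sum>k\<in>UNIV. cross_spend (P n) (g n) k) = spend (P n) (g n)"
    by (rule sum_cross_spend[OF P_pos])
  finally show ?thesis .
qed

lemma variation_nonneg: "0 \<le> variation n"
  unfolding variation_def using cross_spend_nonneg lam_pos d_pos
  by (intro sum_nonneg mult_nonneg_nonneg) (auto simp: less_imp_le)

lemma variation_le: "variation n \<le> spend (P n) (g n) / 5"
proof -
  have "variation n \<le> (\<Sum>l\<in>window n. 1 / 19 * (cross_spend (P l) (g n) (g l) * d l))"
    unfolding variation_def
  proof (intro sum_mono)
    fix l
    have "lam * \<bar>m l\<bar> * d l \<le> 1 / 20 * 1 * d l"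
      using lam_pos lam_le abs_m_le d_pos[of l] by (intro mult_mono) auto
    then have "20 / 19 * (lam * \<bar>m l\<bar> * d l) \<le> 1 / 19 * d l" by linarith
    then have "cross_spend (P l) (g n) (g l) * (20 / 19 * (lam * \<bar>m l\<bar> * d l))
        \<le> cross_spend (P l) (g n) (g l) * (1 / 19 * d l)"
      using cross_spend_nonneg by (intro mult_left_mono)
    then show "cross_spend (P l) (g n) (g l) * (20 / 19 * (lam * \<bar>m l\<bar> * d l))
        \<le> 1 / 19 * (cross_spend (P l) (g n) (g l) * d l)" by (simp only: mult_ac)
  qed
  also have "\<dots> \<le> 1 / 19 * (10 / 3 * spend (P n) (g n))"
    unfolding sum_distrib_left[symmetric] by (intro mult_left_mono sum_cross_spend_on_window) simp
  also have "\<dots> \<le> spend (P n) (g n) / 5" using spend_nonneg[of "P n" "g n"] by simp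
  finally show ?thesis .
qed

lemma response_gain:
  "P n (g n) * (m n)\<^sup>2 / 2 + spend (P n) (g n) * (m n)\<^sup>2 / 4 - \<bar>m n\<bar> * variation n
     \<le> m n * (spend (P n) (g n) - P n (g n))"
proof -
  obtain a b where states: "a \<in> insert n (window n)" "b \<in> insert n (window n)"
    and m: "min (spend (P a) (g n) / P a (g n) - 1) 1 \<le> m n"
      "m n \<le> min (spend (P b) (g n) / P b (g n) - 1) 1"
    using response by blast
  show ?thesis
    using P_pos variation_nonneg variation_le abs_spend_diff_le_variation[OF states(1)]
      abs_spend_diff_le_variation[OF states(2)] m
    unfolding price_const_on_window[OF states(1)] price_const_on_window[OF states(2)]
    by (rule capped_response_gain)
qed

lemma potential_step:
  "potential (P (Suc n)) \<le> potential (P n)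
     - lam * d n * (P n (g n) * (m n)\<^sup>2 / 2 + spend (P n) (g n) * (m n)\<^sup>2 / 4)
     + lam * d n * \<bar>m n\<bar> * variation n
     + 2 * lam\<^sup>2 * (spend (P n) (g n) * (m n)\<^sup>2 * d n)"
proof -
  define p s where "p = P n (g n)" and "s = spend (P n) (g n)"
  have s: "0 \<le> s" using spend_nonneg by (simp add: s_def)
  have "potential (P (Suc n)) \<le> potential (P n) + p * step n - s * ln (1 + step n)"
    unfolding P_Suc[of n] p_def s_def step_def[symmetric] using abs_step_le(2)[of n]
    by (intro potential_scale_price_le P_pos) auto
  moreover have "step n - 2 * (step n)\<^sup>2 \<le> ln (1 + step n)"
    using abs_ln_one_plus_x_minus_x_bound[of "step n"] abs_step_le(2)[of n] by simp
  then have "s * (step n - 2 * (step n)\<^sup>2) \<le> s * ln (1 + step n)"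
    using s by (intro mult_left_mono)
  then have "s * step n - 2 * (s * (step n)\<^sup>2) \<le> s * ln (1 + step n)"
    by (simp add: right_diff_distrib)
  moreover have "s * (step n)\<^sup>2 \<le> lam\<^sup>2 * (s * (m n)\<^sup>2 * d n)"
  proof -
    have "(d n)\<^sup>2 \<le> d n" using d_pos[of n] d_le[of n] by (simp add: power2_eq_square mult_left_le)
    then have "(s * lam\<^sup>2 * (m n)\<^sup>2) * (d n)\<^sup>2 \<le> (s * lam\<^sup>2 * (m n)\<^sup>2) * d n"
      using s by (intro mult_left_mono) auto
    then show ?thesis by (simp add: step_def power_mult_distrib mult_ac)
  qed
  moreover have "lam * d n * (p * (m n)\<^sup>2 / 2 + s * (m n)\<^sup>2 / 4 - \<bar>m n\<bar> * variation n)
      \<le> lam * d n * (m n * (s - p))"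
    using response_gain[of n] lam_pos d_pos[of n] unfolding p_def s_def
    by (intro mult_left_mono) auto
  then have "lam * d n * (p * (m n)\<^sup>2 / 2 + s * (m n)\<^sup>2 / 4) - lam * d n * \<bar>m n\<bar> * variation n
      \<le> s * step n - p * step n"
    by (simp add: step_def algebra_simps)
  ultimately show ?thesis unfolding p_def[symmetric] s_def[symmetric] by linarith
qed

lemma sum_over_windows_le:
  "(\<Sum>n<N. \<Sum>l\<in>window n. d n * cross_spend (P l) (g n) (g l) * (d l * (m l)\<^sup>2))
     \<le> (\<Sum>l<N. spend (P l) (g l) * (m l)\<^sup>2 * d l)"
proof -
  have "(\<Sum>n<N. \<Sum>l\<in>window n. d n * cross_spend (P l) (g n) (g l) * (d l * (m l)\<^sup>2))
      = (\<Sum>n<N. \<Sum>l\<in>{l \<in> {..<N}. l \<in> window n}. d n * cross_spend (P l) (g n) (g l) * (d l * (m l)\<^sup>2))"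
    by (intro sum.cong refl) (auto dest: window_less)
  also have "\<dots> = (\<Sum>l<N. \<Sum>n\<in>{n \<in> {..<N}. l \<in> window n}.
      d n * cross_spend (P l) (g n) (g l) * (d l * (m l)\<^sup>2))"
    by (rule sum.swap_restrict) auto
  also have "\<dots> \<le> (\<Sum>l<N. spend (P l) (g l) * (m l)\<^sup>2 * d l)"
  proof (intro sum_mono)
    fix l
    let ?S = "{n \<in> {..<N}. l \<in> window n}"
    have "(\<Sum>n\<in>?S. d n * cross_spend (P l) (g n) (g l)) \<le> (\<Sum>n\<in>?S. cross_spend (P l) (g n) (g l))"
      using d_le cross_spend_nonneg
      by (intro sum_mono mult_left_le_one_le) (auto simp: d_pos less_imp_le)
    also have "\<dots> = (\<Sum>j\<in>g ` ?S. cross_spend (P l) j (g l))"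
      by (subst sum.reindex) (auto intro: window_disjoint simp: inj_on_def)
    also have "\<dots> \<le> (\<Sum>j\<in>UNIV. cross_spend (P l) j (g l))"
      using cross_spend_nonneg by (intro sum_mono2) auto
    also have "\<dots> = spend (P l) (g l)"
      using sum_cross_spend[of "P l" "g l", OF P_pos]
      by (simp add: cross_spend_commute[of _ _ "g l"])
    finally have "(\<Sum>n\<in>?S. d n * cross_spend (P l) (g n) (g l)) * (d l * (m l)\<^sup>2)
        \<le> spend (P l) (g l) * (d l * (m l)\<^sup>2)"
      using d_pos[of l] by (intro mult_right_mono) auto
    then show "(\<Sum>n\<in>?S. d n * cross_spend (P l) (g n) (g l) * (d l * (m l)\<^sup>2))
        \<le> spend (P l) (g l) * (m l)\<^sup>2 * d l"
      by (simp add: sum_distrib_right mult.assoc mult.commute[of "d l"])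
  qed
  finally show ?thesis .
qed

lemma staleness_loss_le:
  "lam * d n * \<bar>m n\<bar> * variation n
     \<le> 10 / 19 * lam\<^sup>2 * (10 / 3 * (spend (P n) (g n) * (m n)\<^sup>2 * d n)
         + (\<Sum>l\<in>window n. d n * cross_spend (P l) (g n) (g l) * (d l * (m l)\<^sup>2)))"
proof -
  define w where "w l = 20 / 19 * lam\<^sup>2 * (d n * cross_spend (P l) (g n) (g l) * d l)" for l
  have "lam * d n * \<bar>m n\<bar> * variation n = (\<Sum>l\<in>window n. w l * (\<bar>m n\<bar> * \<bar>m l\<bar>))"
    unfolding variation_def w_def sum_distrib_left
    by (intro sum.cong) (auto simp: power2_eq_square mult_ac)
  also have "\<dots> \<le> (\<Sum>l\<in>window n. w l * (((m n)\<^sup>2 + (m l)\<^sup>2) / 2))"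
  proof (intro sum_mono mult_left_mono)
    fix l
    have "0 \<le> (\<bar>m n\<bar> - \<bar>m l\<bar>)\<^sup>2" by simp
    then show "\<bar>m n\<bar> * \<bar>m l\<bar> \<le> ((m n)\<^sup>2 + (m l)\<^sup>2) / 2" by (simp add: power2_diff)
    show "0 \<le> w l" using cross_spend_nonneg[of "P l"] d_pos[of l] d_pos[of n] by (simp add: w_def)
  qed
  also have "\<dots> = 10 / 19 * lam\<^sup>2 * (d n * (m n)\<^sup>2 * (\<Sum>l\<in>window n. cross_spend (P l) (g n) (g l) * d l)
      + (\<Sum>l\<in>window n. d n * cross_spend (P l) (g n) (g l) * (d l * (m l)\<^sup>2)))"
    unfolding w_def sum_distrib_left sum.distrib[symmetric]
    by (intro sum.cong) (auto simp: field_simps)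
  also have "\<dots> \<le> 10 / 19 * lam\<^sup>2 * (d n * (m n)\<^sup>2 * (10 / 3 * spend (P n) (g n))
      + (\<Sum>l\<in>window n. d n * cross_spend (P l) (g n) (g l) * (d l * (m l)\<^sup>2)))"
    using sum_cross_spend_on_window[of n] d_pos[of n] by (intro mult_left_mono add_right_mono) auto
  finally show ?thesis by (simp add: mult_ac)
qed

theorem potential_descent:
  "potential (P N) + lam / 2 * (\<Sum>n<N. P n (g n) * (m n)\<^sup>2 * d n) \<le> potential (P 0)"
proof -
  define A where "A n = P n (g n) * (m n)\<^sup>2 * d n" for n
  define C where "C n = spend (P n) (g n) * (m n)\<^sup>2 * d n" for n
  define F where "F n = (\<Sum>l\<in>window n. d n * cross_spend (P l) (g n) (g l) * (d l * (m l)\<^sup>2))" for n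
  have C_nonneg: "0 \<le> C n" for n unfolding C_def using spend_nonneg d_pos[of n] by simp
  have "potential (P (Suc n)) \<le> potential (P n) - lam / 2 * A n - lam / 4 * C n
      + (2 + 100 / 57) * lam\<^sup>2 * C n + 10 / 19 * lam\<^sup>2 * F n" for n
    using potential_step[of n] staleness_loss_le[of n] unfolding A_def C_def F_def
    by (simp add: algebra_simps)
  then have "potential (P N) \<le> potential (P 0) - lam / 2 * (\<Sum>n<N. A n) - lam / 4 * (\<Sum>n<N. C n)
      + (2 + 100 / 57) * lam\<^sup>2 * (\<Sum>n<N. C n) + 10 / 19 * lam\<^sup>2 * (\<Sum>n<N. F n)"
  proof (induction N)
    case (Suc N)
    show ?case
      using Suc.IH[OF Suc.prems] Suc.prems[of N] unfolding sum.lessThan_Suc distrib_left by linarith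
  qed simp
  moreover have "10 / 19 * lam\<^sup>2 * (\<Sum>n<N. F n) \<le> 10 / 19 * lam\<^sup>2 * (\<Sum>n<N. C n)"
    using sum_over_windows_le[of N] unfolding F_def C_def by (intro mult_left_mono) auto
  moreover have "(2 + 100 / 57 + 10 / 19) * lam\<^sup>2 * (\<Sum>n<N. C n) \<le> lam / 4 * (\<Sum>n<N. C n)"
    using lam_pos mult_left_mono[OF lam_le, of lam] C_nonneg
    by (intro mult_right_mono sum_nonneg) (auto simp: power2_eq_square)
  ultimately show ?thesis unfolding A_def[symmetric] by (simp add: algebra_simps)
qed

end

section \<open>Asynchronous runs\<close>

lemma locally_finite_strict_mono_enumeration:
  fixes A :: "'a::linorder set"
  assumes "infinite A" and locally_finite: "\<And>c. finite (A \<inter> {..c})"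
  obtains \<tau> :: "nat \<Rightarrow> 'a" where "strict_mono \<tau>" "range \<tau> = A"
proof -
  define rank where "rank a = card (A \<inter> {..<a})" for a
  define R where "R = rank ` A"
  define \<tau> where "\<tau> n = inv_into A rank (enumerate R n)" for n
  have rank_less: "rank a < rank b" if "a \<in> A" "a < b" for a b
    unfolding rank_def
  proof (rule psubset_card_mono)
    show "finite (A \<inter> {..<b})" by (rule finite_subset[OF _ locally_finite[of b]]) auto
    show "A \<inter> {..<a} \<subset> A \<inter> {..<b}" using that by auto
  qed
  have inj: "inj_on rank A"
    by (rule linorder_inj_onI) (use rank_less in \<open>auto dest: less_imp_neq\<close>)
  then have "infinite R" unfolding R_def using assms(1) by (simp add: finite_image_iff)
  then have rank_tau: "\<tau> n \<in> A" "rank (\<tau> n) = enumerate R n" for n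
    using enumerate_in_set[of R n]
    by (simp_all add: \<tau>_def inv_into_into f_inv_into_f flip: R_def)
  have "\<tau> m < \<tau> n" if "m < n" for m n
  proof (rule ccontr)
    assume "\<not> \<tau> m < \<tau> n"
    then have "rank (\<tau> n) \<le> rank (\<tau> m)"
      using rank_less[OF rank_tau(1)] by (auto simp: le_less not_less)
    then show False using that \<open>infinite R\<close> by (simp add: rank_tau)
  qed
  then have "strict_mono \<tau>" by (rule strict_monoI)
  moreover have "range \<tau> = A"
  proof
    show "A \<subseteq> range \<tau>"
    proof
      fix a assume a: "a \<in> A"
      then obtain n where "enumerate R n = rank a"
        using enumerate_Ex[of R "rank a"] \<open>infinite R\<close> by (auto simp: R_def)
      then show "a \<in> range \<tau>"
        using inv_into_f_f[OF inj a] by (auto simp: \<tau>_def intro: range_eqI[of _ _ n])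
    qed
  qed (use rank_tau in auto)
  ultimately show ?thesis by (rule that)
qed

locale tatonnement_run = ces_market e \<theta> c
  for e :: "'b::finite \<Rightarrow> real" and \<theta> :: "'b \<Rightarrow> real" and c :: "'b \<Rightarrow> 'g::finite \<Rightarrow> real" +
  fixes lam :: real and z :: "('g \<Rightarrow> real) \<Rightarrow> 'g \<Rightarrow> real"
    and T q :: "'g \<Rightarrow> nat \<Rightarrow> real" and p :: "real \<Rightarrow> 'g \<Rightarrow> real"
  assumes lam_pos: "0 < lam" and lam_le: "lam \<le> 1 / 20"
    and run: "async_tatonnement lam z T q p"
    and z_eq: "(\<And>j. 0 < pr j) \<Longrightarrow> z pr j = spend pr j / pr j - 1"
begin

lemma T_0: "T j 0 = 0"
  and T_less_Suc: "T j k < T j (Suc k)"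
  and T_gap: "T j (Suc k) - T j k \<le> 1"
  and T_lim: "filterlim (T j) at_top sequentially"
  and q_0_pos: "0 < q j 0"
  and p_0: "p 0 j = q j 0"
  using run unfolding async_tatonnement_def by auto

lemma p_eq_q: "\<lbrakk>T j k < t; t \<le> T j (Suc k)\<rbrakk> \<Longrightarrow> p t j = q j k"
  using run unfolding async_tatonnement_def by blast

lemma T_distinct: "T j (Suc k) = T j' (Suc k') \<Longrightarrow> j = j'"
  using run unfolding async_tatonnement_def by (metis le_add1 plus_1_eq_Suc)

lemma T_strict_mono: "strict_mono (T j)"
  by (rule strict_monoI_Suc) (rule T_less_Suc)

lemma T_less_iff: "T j k < T j l \<longleftrightarrow> k < l"
  by (rule strict_mono_less[OF T_strict_mono])

lemma T_le_iff: "T j k \<le> T j l \<longleftrightarrow> k \<le> l"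
  by (rule strict_mono_less_eq[OF T_strict_mono])

lemma T_nonneg: "0 \<le> T j k"
  using T_le_iff[of j 0 k] by (simp add: T_0)

lemma T_Suc_pos: "0 < T j (Suc k)"
  using T_less_Suc[of j k] T_nonneg[of j k] by linarith

lemma T_unbounded: "\<exists>k. t \<le> T j k"
proof -
  have "eventually (\<lambda>k. t \<le> T j k) sequentially"
    using T_lim[of j] by (simp add: filterlim_at_top)
  then show ?thesis by (auto simp: eventually_sequentially)
qed

lemma T_interval_exists:
  assumes "0 < t"
  obtains k where "T j k < t" "t \<le> T j (Suc k)"
proof -
  define K where "K = (LEAST k. t \<le> T j k)"
  have K: "t \<le> T j K" unfolding K_def using T_unbounded by (rule LeastI_ex)
  then have "K \<noteq> 0" using assms T_0[of j] by (cases K) auto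
  then obtain k where k: "K = Suc k" by (cases K) auto
  then have "\<not> t \<le> T j k" using not_less_Least[of k "\<lambda>k. t \<le> T j k"] by (simp add: K_def)
  then show ?thesis using that[of k] K k by simp
qed

lemma T_interval_unique:
  assumes "T j k < t" "t \<le> T j (Suc k)" "T j k' < t" "t \<le> T j (Suc k')"
  shows "k = k'"
proof -
  have "T j k < T j (Suc k')" "T j k' < T j (Suc k)" using assms by linarith+
  then show ?thesis by (simp add: T_less_iff)
qed

lemma price_is_q:
  assumes "0 \<le> t"
  obtains k where "p t j = q j k"
proof (cases "t = 0")
  case False
  then have "0 < t" using assms by simp
  then obtain k where "T j k < t" "t \<le> T j (Suc k)" by (rule T_interval_exists)
  then show ?thesis using p_eq_q that by blast
qed (use p_0 that in auto)

abbreviation dt :: "'g \<Rightarrow> nat \<Rightarrow> real" where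
  "dt j k \<equiv> T j (Suc k) - T j k"

lemma dt_pos: "0 < dt j k"
  using T_less_Suc by simp

lemma sum_dt_le:
  assumes "finite K" "s \<le> t" and K: "\<And>i. i \<in> K \<Longrightarrow> s < T j (Suc i) \<and> T j (Suc i) \<le> t"
  shows "(\<Sum>i\<in>K. dt j i) \<le> t - s + 1"
proof (cases "K = {}")
  case False
  let ?a = "Min K" and ?b = "Max K"
  have bounds: "?a \<in> K" "?b \<in> K" "K \<subseteq> {?a..<Suc ?b}" "?a \<le> ?b"
    using assms(1) False by (auto simp: less_Suc_eq_le)
  have "(\<Sum>i\<in>K. dt j i) \<le> (\<Sum>i\<in>{?a..<Suc ?b}. dt j i)"
    using bounds T_less_Suc by (intro sum_mono2) (auto simp: less_imp_le)
  also have "\<dots> = T j (Suc ?b) - T j ?a"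
    using bounds by (intro sum_Suc_diff') auto
  finally show ?thesis using K[OF bounds(1)] K[OF bounds(2)] T_gap[of j ?a] by linarith
qed (use assms in simp)

subsection \<open>Responses\<close>

definition response_witness :: "'g \<Rightarrow> nat \<Rightarrow> real \<Rightarrow> bool" where
  "response_witness j k zt \<longleftrightarrow>
     (\<exists>t. T j k < t \<and> t \<le> T j (Suc k) \<and> z (p t) j \<le> zt) \<and>
     (\<exists>t. T j k < t \<and> t \<le> T j (Suc k) \<and> zt \<le> z (p t) j) \<and>
     q j (Suc k) = q j k * (1 + lam * min zt 1 * dt j k)"

definition resp :: "'g \<Rightarrow> nat \<Rightarrow> real" where
  "resp j k = min (SOME zt. response_witness j k zt) 1"

lemma response_witness_SOME: "response_witness j k (SOME zt. response_witness j k zt)"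
  by (rule someI_ex) (use run in \<open>unfold async_tatonnement_def response_witness_def, meson\<close>)

lemma q_Suc: "q j (Suc k) = q j k * (1 + lam * resp j k * dt j k)"
  using response_witness_SOME unfolding resp_def response_witness_def by blast

lemma resp_le_1: "resp j k \<le> 1"
  by (simp add: resp_def)

lemma resp_lower: "\<exists>t. T j k < t \<and> t \<le> T j (Suc k) \<and> min (z (p t) j) 1 \<le> resp j k"
  using response_witness_SOME unfolding resp_def response_witness_def by (meson min.mono order.refl)

lemma resp_upper: "\<exists>t. T j k < t \<and> t \<le> T j (Suc k) \<and> resp j k \<le> min (z (p t) j) 1"
  using response_witness_SOME unfolding resp_def response_witness_def by (meson min.mono order.refl)

lemma resp_ge_if:
  assumes "\<epsilon> \<le> 1" "\<And>t. \<lbrakk>T j k < t; t \<le> T j (Suc k)\<rbrakk> \<Longrightarrow> \<epsilon> \<le> z (p t) j"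
  shows "\<epsilon> \<le> resp j k"
  using resp_lower[of j k] assms by fastforce

lemma resp_le_if:
  assumes "\<And>t. \<lbrakk>T j k < t; t \<le> T j (Suc k)\<rbrakk> \<Longrightarrow> z (p t) j \<le> \<epsilon>"
  shows "resp j k \<le> \<epsilon>"
  using resp_upper[of j k] assms by fastforce

lemma resp_ge_if_prices_pos:
  assumes "\<And>t j'. \<lbrakk>T j k < t; t \<le> T j (Suc k)\<rbrakk> \<Longrightarrow> 0 < p t j'"
  shows "-1 \<le> resp j k"
proof (rule resp_ge_if)
  fix t assume "T j k < t" "t \<le> T j (Suc k)"
  then have "0 < p t j'" for j' by (rule assms)
  then show "-1 \<le> z (p t) j" using spend_nonneg[of "p t" j] by (simp add: z_eq less_imp_le)
qed simp

lemma abs_relative_change_le: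
  assumes "-1 \<le> resp j k"
  shows "\<bar>lam * resp j k * dt j k\<bar> \<le> 1 / 20"
proof -
  have "\<bar>resp j k\<bar> \<le> 1" using assms resp_le_1[of j k] by simp
  then have "lam * \<bar>resp j k\<bar> * dt j k \<le> 1 / 20 * 1 * 1"
    using lam_pos lam_le dt_pos[of j k] T_gap[of j k] by (intro mult_mono) auto
  then show ?thesis using lam_pos dt_pos[of j k] by (simp add: abs_mult)
qed

subsection \<open>Chronological order of the updates\<close>

definition update_times :: "real set" where
  "update_times = (\<Union>j. range (\<lambda>k. T j (Suc k)))"

lemma infinite_update_times: "infinite update_times"
proof -
  obtain j :: 'g where True by blast
  have "inj (\<lambda>k. T j (Suc k))"
    using strict_mono_eq[OF T_strict_mono, of j] by (auto intro!: injI)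
  then have "infinite (range (\<lambda>k. T j (Suc k)))" by (rule range_inj_infinite)
  moreover have "range (\<lambda>k. T j (Suc k)) \<subseteq> update_times" by (auto simp: update_times_def)
  ultimately show ?thesis by (metis infinite_super)
qed

lemma finite_update_times_until: "finite (update_times \<inter> {..t})"
proof -
  have "finite {k. T j (Suc k) \<le> t}" for j
  proof -
    obtain K where K: "t \<le> T j K" using T_unbounded by blast
    have "k < K" if "T j (Suc k) \<le> t" for k
    proof -
      have "T j (Suc k) \<le> T j K" using that K by linarith
      then show ?thesis by (simp add: T_le_iff)
    qed
    then show ?thesis by (auto intro: finite_subset[OF _ finite_lessThan[of K]])
  qed
  moreover have "update_times \<inter> {..t} = (\<Union>j. (\<lambda>k. T j (Suc k)) ` {k. T j (Suc k) \<le> t})"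
    by (auto simp: update_times_def)
  ultimately show ?thesis by simp
qed

text \<open>Update \<open>n\<close> in chronological order happens at time \<open>\<tau> n\<close>; it is update number \<open>Suc (index n)\<close> of
  good \<open>good n\<close>, hence takes the price from \<open>q (good n) (index n)\<close> to \<open>q (good n) (Suc (index n))\<close>.\<close>

definition tau :: "nat \<Rightarrow> real" ("\<tau>") where
  "\<tau> = (SOME t. strict_mono t \<and> range t = update_times)"

definition good :: "nat \<Rightarrow> 'g" where
  "good n = (SOME j. \<exists>k. \<tau> n = T j (Suc k))"

definition index :: "nat \<Rightarrow> nat" where
  "index n = (SOME k. \<tau> n = T (good n) (Suc k))"

lemma strict_mono_tau: "strict_mono \<tau>"
  and range_tau: "range \<tau> = update_times"
proof -
  have "\<exists>t. strict_mono (t :: nat \<Rightarrow> real) \<and> range t = update_times"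
    using locally_finite_strict_mono_enumeration[OF infinite_update_times finite_update_times_until]
    by metis
  then have "strict_mono \<tau> \<and> range \<tau> = update_times" unfolding tau_def by (rule someI_ex)
  then show "strict_mono \<tau>" "range \<tau> = update_times" by auto
qed

lemma tau_less_iff: "\<tau> m < \<tau> n \<longleftrightarrow> m < n"
  by (rule strict_mono_less[OF strict_mono_tau])

lemma tau_le_iff: "\<tau> m \<le> \<tau> n \<longleftrightarrow> m \<le> n"
  by (rule strict_mono_less_eq[OF strict_mono_tau])

lemma tau_eq_iff: "\<tau> m = \<tau> n \<longleftrightarrow> m = n"
  by (rule strict_mono_eq[OF strict_mono_tau])

lemma tau_eq_T: "\<tau> n = T (good n) (Suc (index n))"
proof -
  have "\<tau> n \<in> update_times" using range_tau by blast
  then have "\<exists>j k. \<tau> n = T j (Suc k)" by (auto simp: update_times_def)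
  then have "\<exists>k. \<tau> n = T (good n) (Suc k)" unfolding good_def by (rule someI_ex)
  then show ?thesis unfolding index_def by (rule someI_ex)
qed

lemma tau_pos: "0 < \<tau> n"
  by (simp add: tau_eq_T T_Suc_pos)

lemma update_exists:
  obtains n where "good n = j" "index n = k"
proof -
  have "T j (Suc k) \<in> range \<tau>" unfolding range_tau by (auto simp: update_times_def)
  then obtain n where n: "T j (Suc k) = \<tau> n" by blast
  then have "good n = j" using T_distinct[of j k "good n" "index n"] tau_eq_T[of n] by simp
  moreover from this have "index n = k"
    using n tau_eq_T[of n] strict_mono_eq[OF T_strict_mono, of j "Suc k" "Suc (index n)"] by simp
  ultimately show ?thesis by (rule that)
qed

lemma T_Suc_is_tau:
  obtains n where "T j (Suc k) = \<tau> n"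
  using update_exists[of j k] tau_eq_T by metis

lemma tau_unbounded: "\<exists>n. t \<le> \<tau> n"
proof -
  obtain j :: 'g where True by blast
  obtain k where "t \<le> T j k" using T_unbounded by blast
  moreover obtain n where "T j (Suc k) = \<tau> n" by (rule T_Suc_is_tau)
  ultimately show ?thesis using T_less_Suc[of j k] by (intro exI[of _ n]) linarith
qed

lemma price_const_between_updates:
  assumes "0 < t" "t \<le> t'" and no_update: "\<And>n. \<tau> n < t' \<Longrightarrow> \<tau> n < t"
  shows "p t = p t'"
proof
  fix j
  obtain k where k: "T j k < t" "t \<le> T j (Suc k)" using T_interval_exists assms(1) .
  obtain n where "T j (Suc k) = \<tau> n" by (rule T_Suc_is_tau)
  then have "t' \<le> T j (Suc k)" using no_update[of n] k by linarith
  then show "p t j = p t' j" using p_eq_q[of j k t] p_eq_q[of j k t'] k assms by simp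
qed

lemma price_before_first_update: "p (\<tau> 0) = p 0"
proof
  fix j
  obtain n where "T j (Suc 0) = \<tau> n" by (rule T_Suc_is_tau)
  then have "\<tau> 0 \<le> T j (Suc 0)" by (simp add: tau_le_iff)
  then show "p (\<tau> 0) j = p 0 j" using p_eq_q[of j 0] tau_pos by (simp add: T_0 p_0)
qed

lemma next_update:
  assumes "0 \<le> t"
  obtains n where "t \<le> \<tau> n" "p t = p (\<tau> n)" "\<And>n'. t \<le> \<tau> n' \<Longrightarrow> n \<le> n'"
proof (cases "t = 0")
  case True
  then show ?thesis using that[of 0] price_before_first_update tau_pos[of 0] by simp
next
  case False
  define n where "n = (LEAST n. t \<le> \<tau> n)"
  have n: "t \<le> \<tau> n" unfolding n_def using tau_unbounded by (rule LeastI_ex)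
  have least: "n \<le> n'" if "t \<le> \<tau> n'" for n' unfolding n_def using that by (rule Least_le)
  have "\<tau> i < t" if "\<tau> i < \<tau> n" for i
    using that least[of i] by (force simp: tau_less_iff not_less[symmetric])
  then have "p t = p (\<tau> n)" using assms False n by (intro price_const_between_updates) auto
  then show ?thesis using that n least by blast
qed

lemma price_at_own_update: "p (\<tau> n) (good n) = q (good n) (index n)"
  using p_eq_q[of "good n" "index n" "\<tau> n"] T_less_Suc by (simp add: tau_eq_T)

lemma price_after_update: "p (\<tau> (Suc n)) = (p (\<tau> n))(good n := q (good n) (Suc (index n)))"
proof
  fix j
  have less: "\<tau> n < \<tau> (Suc n)" by (simp add: tau_less_iff)
  have next_le: "\<tau> (Suc n) \<le> T j (Suc k)" if "\<tau> n < T j (Suc k)" for k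
    using that by (metis T_Suc_is_tau Suc_leI tau_le_iff tau_less_iff)
  show "p (\<tau> (Suc n)) j = ((p (\<tau> n))(good n := q (good n) (Suc (index n)))) j"
  proof (cases "j = good n")
    case True
    then have "\<tau> (Suc n) \<le> T j (Suc (Suc (index n)))"
      using next_le T_less_Suc by (simp add: tau_eq_T[of n])
    then show ?thesis
      using True less p_eq_q[of j "Suc (index n)" "\<tau> (Suc n)"] by (simp add: tau_eq_T[of n])
  next
    case False
    obtain k where k: "T j k < \<tau> n" "\<tau> n \<le> T j (Suc k)" using T_interval_exists tau_pos .
    moreover have "\<tau> n \<noteq> T j (Suc k)"
      using False T_distinct[of j k "good n" "index n"] tau_eq_T[of n] by auto
    ultimately have "\<tau> (Suc n) \<le> T j (Suc k)" using next_le[of k] by simp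
    then show ?thesis using False less k p_eq_q[of j k] by simp
  qed
qed

lemma price_at_update_pos: "0 < p (\<tau> n) j"
proof (induction n arbitrary: j rule: less_induct)
  case (less n)
  show ?case
  proof (cases n)
    case 0
    then show ?thesis by (simp add: price_before_first_update p_0 q_0_pos)
  next
    case (Suc n')
    let ?j = "good n'" and ?k = "index n'"
    have "-1 \<le> resp ?j ?k"
    proof (rule resp_ge_if_prices_pos)
      fix t j' assume t: "T ?j ?k < t" "t \<le> T ?j (Suc ?k)"
      then have "0 \<le> t" using T_nonneg[of ?j ?k] by linarith
      then obtain l where "p t = p (\<tau> l)" "\<And>i. t \<le> \<tau> i \<Longrightarrow> l \<le> i" using next_update by metis
      then show "0 < p t j'" using less Suc t by (simp add: tau_eq_T[of n'] less_Suc_eq_le)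
    qed
    moreover have "0 < q ?j ?k" using less Suc price_at_own_update[of n'] by (metis lessI)
    ultimately have "0 < q ?j (Suc ?k)"
      unfolding q_Suc using abs_relative_change_le[of ?j ?k] by simp
    then show ?thesis using less Suc price_after_update[of n'] by simp
  qed
qed

lemma p_pos: "0 \<le> t \<Longrightarrow> 0 < p t j"
  by (metis next_update price_at_update_pos)

lemma resp_ge: "-1 \<le> resp j k"
proof (rule resp_ge_if_prices_pos)
  fix t j' assume "T j k < t"
  then show "0 < p t j'" using T_nonneg[of j k] by (intro p_pos) linarith
qed

subsection \<open>The amortized analysis applied to a run\<close>

definition window :: "nat \<Rightarrow> nat set" where
  "window n = {l. l < n \<and> T (good n) (index n) < \<tau> l}"

lemma window_state:
  assumes "T (good n) (index n) < t" "t \<le> T (good n) (Suc (index n))"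
  obtains l where "l \<in> insert n (window n)" "p t = p (\<tau> l)"
proof -
  have "0 \<le> t" using assms(1) T_nonneg[of "good n" "index n"] by linarith
  then obtain l where l: "t \<le> \<tau> l" "p t = p (\<tau> l)" "\<And>n. t \<le> \<tau> n \<Longrightarrow> l \<le> n" using next_update by metis
  moreover have "l \<le> n" using assms(2) by (intro l(3)) (simp add: tau_eq_T)
  ultimately have "l \<in> insert n (window n)" using assms(1) by (auto simp: window_def)
  then show ?thesis using that l by blast
qed

lemma good_in_window_neq:
  assumes "l \<in> window n"
  shows "good l \<noteq> good n"
proof
  assume eq: "good l = good n"
  have "\<tau> l < \<tau> n" using assms by (simp add: window_def tau_less_iff)
  then have "Suc (index l) < Suc (index n)" "index n < Suc (index l)"
    using assms eq by (auto simp: window_def tau_eq_T T_less_iff)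
  then show False by simp
qed

lemma windows_of_same_good_disjoint:
  assumes "l \<in> window n" "l \<in> window n'" "good n = good n'"
  shows "n = n'"
proof -
  have "\<tau> l \<le> \<tau> n" "\<tau> l \<le> \<tau> n'" using assms by (auto simp: window_def tau_le_iff)
  then have "index n = index n'"
    using assms tau_eq_T[of n] tau_eq_T[of n']
    by (intro T_interval_unique[of "good n" _ "\<tau> l"]) (auto simp: window_def)
  then have "\<tau> n = \<tau> n'" using assms by (simp add: tau_eq_T)
  then show ?thesis by (simp add: tau_eq_iff)
qed

lemma sum_dt_in_window_le: "(\<Sum>l\<in>{l \<in> window n. good l = k}. dt (good l) (index l)) \<le> 2"
proof -
  let ?S = "{l \<in> window n. good l = k}"
  have finite: "finite ?S" by (rule finite_subset[of _ "{..<n}"]) (auto simp: window_def)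
  have "inj_on index ?S"
  proof (rule inj_onI)
    fix a b assume "a \<in> ?S" "b \<in> ?S" "index a = index b"
    then have "\<tau> a = \<tau> b" by (simp add: tau_eq_T)
    then show "a = b" by (simp add: tau_eq_iff)
  qed
  then have "(\<Sum>l\<in>?S. dt (good l) (index l)) = (\<Sum>i\<in>index ` ?S. dt k i)"
    by (simp add: sum.reindex)
  also have "\<dots> \<le> \<tau> n - T (good n) (index n) + 1"
  proof (rule sum_dt_le)
    show "T (good n) (index n) \<le> \<tau> n" using T_less_Suc by (simp add: tau_eq_T less_imp_le)
    fix i assume "i \<in> index ` ?S"
    then obtain l where "l < n" "T (good n) (index n) < \<tau> l" "\<tau> l = T k (Suc i)"
      by (auto simp: window_def tau_eq_T[symmetric])
    then show "T (good n) (index n) < T k (Suc i) \<and> T k (Suc i) \<le> \<tau> n"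
      using tau_le_iff[of l n] by simp
  qed (use finite in simp)
  also have "\<dots> \<le> 2" using T_gap[of "good n" "index n"] by (simp add: tau_eq_T)
  finally show ?thesis .
qed

lemma resp_between_window_states:
  "\<exists>a\<in>insert n (window n). \<exists>b\<in>insert n (window n).
      min (spend (p (\<tau> a)) (good n) / p (\<tau> a) (good n) - 1) 1 \<le> resp (good n) (index n) \<and>
      resp (good n) (index n) \<le> min (spend (p (\<tau> b)) (good n) / p (\<tau> b) (good n) - 1) 1"
proof -
  let ?j = "good n" and ?k = "index n"
  obtain t where t: "T ?j ?k < t" "t \<le> T ?j (Suc ?k)" "min (z (p t) ?j) 1 \<le> resp ?j ?k"
    using resp_lower by blast
  obtain a where a: "a \<in> insert n (window n)" "p t = p (\<tau> a)" using window_state t(1,2) .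
  obtain s where s: "T ?j ?k < s" "s \<le> T ?j (Suc ?k)" "resp ?j ?k \<le> min (z (p s) ?j) 1"
    using resp_upper by blast
  obtain b where b: "b \<in> insert n (window n)" "p s = p (\<tau> b)" using window_state s(1,2) .
  have "z (p (\<tau> l)) ?j = spend (p (\<tau> l)) ?j / p (\<tau> l) ?j - 1" for l
    by (intro z_eq price_at_update_pos)
  then show ?thesis using a b t(3) s(3) by (intro bexI[of _ a] bexI[of _ b]) simp_all
qed

sublocale updates: update_sequence e \<theta> c lam good "\<lambda>n. dt (good n) (index n)"
  "\<lambda>n. resp (good n) (index n)" "\<lambda>n. p (\<tau> n)" window
proof
  fix n l l' :: nat
  show "p (\<tau> (Suc n))
      = scale_price (p (\<tau> n)) (good n) (lam * resp (good n) (index n) * dt (good n) (index n))"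
    unfolding price_after_update price_at_own_update q_Suc ..
  show "l' \<in> window n" if "l \<in> window n" "l \<le> l'" "l' < n"
    using that tau_le_iff[of l l'] by (auto simp: window_def)
qed (use lam_pos lam_le T_gap resp_ge resp_le_1 price_at_update_pos good_in_window_neq
    windows_of_same_good_disjoint sum_dt_in_window_le resp_between_window_states
    in \<open>auto simp: T_less_Suc window_def\<close>)

lemma potential_le_initial:
  assumes "0 \<le> t"
  shows "potential (p t) \<le> potential (p 0)"
proof -
  obtain n where n: "p t = p (\<tau> n)" using next_update[OF assms] by metis
  have "0 \<le> lam / 2 * (\<Sum>l<n. p (\<tau> l) (good l) * (resp (good l) (index l))\<^sup>2 * dt (good l) (index l))"
    using lam_pos price_at_update_pos dt_pos
    by (intro mult_nonneg_nonneg sum_nonneg) (auto simp: less_imp_le)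
  then show ?thesis using updates.potential_descent[of n] n by (simp add: price_before_first_update)
qed

lemma q_eq_price: "q j k = p (T j (Suc k)) j"
  using p_eq_q[of j k "T j (Suc k)"] T_less_Suc by simp

lemma q_pos: "0 < q j k"
  unfolding q_eq_price by (intro p_pos T_nonneg)

lemma z_price: "0 \<le> t \<Longrightarrow> z (p t) j = spend (p t) j / p t j - 1"
  by (intro z_eq p_pos)

lemma price_le_if_no_excess_above:
  assumes no_excess: "\<And>t. \<lbrakk>0 \<le> t; E \<le> p t j\<rbrakk> \<Longrightarrow> z (p t) j \<le> 0" and "0 \<le> t"
  shows "p t j \<le> max (q j 0) (2 * E)"
proof -
  have "q j k \<le> max (q j 0) (2 * E)" for k
  proof (induction k)
    case (Suc k)
    have change: "lam * resp j k * dt j k \<le> 1 / 20"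
      using abs_relative_change_le[OF resp_ge, of j k] by simp
    show ?case
    proof (cases "E \<le> q j k")
      case True
      have "resp j k \<le> 0"
      proof (rule resp_le_if)
        fix t assume t: "T j k < t" "t \<le> T j (Suc k)"
        then show "z (p t) j \<le> 0" using True p_eq_q[OF t] T_nonneg[of j k] by (intro no_excess) auto
      qed
      then have "lam * resp j k * dt j k \<le> 0"
        using lam_pos dt_pos[of j k] by (simp add: mult_le_0_iff)
      then have "q j (Suc k) \<le> q j k * 1"
        unfolding q_Suc using q_pos[of j k] by (intro mult_left_mono) auto
      then show ?thesis using Suc by simp
    next
      case False
      have "q j (Suc k) \<le> q j k * 2"
        unfolding q_Suc using change q_pos[of j k] by (intro mult_left_mono) auto
      then show ?thesis using False by simp
    qed
  qed simp
  then show ?thesis using price_is_q[OF assms(2), of j] by metis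
qed

lemma price_ge_if_excess_below:
  assumes excess: "\<And>t. \<lbrakk>0 \<le> t; p t j \<le> b\<rbrakk> \<Longrightarrow> 0 \<le> z (p t) j" and "0 \<le> t"
  shows "min (q j 0) (b / 2) \<le> p t j"
proof -
  have "min (q j 0) (b / 2) \<le> q j k" for k
  proof (induction k)
    case (Suc k)
    have change: "- (1 / 20) \<le> lam * resp j k * dt j k"
      using abs_relative_change_le[OF resp_ge, of j k] by simp
    show ?case
    proof (cases "q j k \<le> b")
      case True
      have "0 \<le> resp j k"
      proof (rule resp_ge_if)
        fix t assume t: "T j k < t" "t \<le> T j (Suc k)"
        then show "0 \<le> z (p t) j" using True p_eq_q[OF t] T_nonneg[of j k] by (intro excess) auto
      qed simp
      then have "0 \<le> lam * resp j k * dt j k" using lam_pos dt_pos[of j k] by simp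
      then have "q j k * 1 \<le> q j (Suc k)"
        unfolding q_Suc using q_pos[of j k] by (intro mult_left_mono) auto
      then show ?thesis using Suc by simp
    next
      case False
      have "q j k * (1 / 2) \<le> q j (Suc k)"
        unfolding q_Suc using change q_pos[of j k] by (intro mult_left_mono) auto
      then show ?thesis using False by simp
    qed
  qed simp
  then show ?thesis using price_is_q[OF assms(2), of j] by metis
qed

lemma prices_bounded:
  obtains B where "0 < B" "\<And>t j. 0 \<le> t \<Longrightarrow> p t j \<le> B"
proof
  define E where "E = (\<Sum>i\<in>UNIV. e i)"
  define B where "B = (\<Sum>j\<in>UNIV. max (q j 0) (2 * E))"
  show "p t j \<le> B" if "0 \<le> t" for t j
  proof -
    have "z (p s) j \<le> 0" if s: "0 \<le> s" "E \<le> p s j" for s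
    proof -
      have "spend (p s) j \<le> E" unfolding E_def using p_pos[OF s(1)] by (intro spend_le_budgets)
      then show ?thesis using s p_pos[OF s(1), of j] by (simp add: z_price)
    qed
    then have "p t j \<le> max (q j 0) (2 * E)" using \<open>0 \<le> t\<close> by (rule price_le_if_no_excess_above)
    also have "\<dots> \<le> B"
      unfolding B_def using q_0_pos by (intro member_le_sum) (auto simp: le_max_iff_disj less_imp_le)
    finally show ?thesis .
  qed
  then show "0 < B" using p_pos[of 0] by (metis order.refl less_le_trans)
qed

lemma summable_squared_response: "summable (\<lambda>k. q j k * (resp j k)\<^sup>2 * dt j k)"
proof -
  obtain B where B: "\<And>t j. 0 \<le> t \<Longrightarrow> p t j \<le> B" using prices_bounded by metis
  define K where "K = - (\<Sum>i\<in>UNIV. e i * price_index i (\<lambda>_. B))"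
  define a where "a n = p (\<tau> n) (good n) * (resp (good n) (index n))\<^sup>2 * dt (good n) (index n)" for n
  have a_nonneg: "0 \<le> a n" for n
    unfolding a_def using price_at_update_pos dt_pos
    by (intro mult_nonneg_nonneg) (auto simp: less_imp_le)
  have "(\<Sum>n<N. a n) \<le> 2 / lam * (potential (p 0) - K)" for N
  proof -
    have "K \<le> potential (p (\<tau> N))"
      unfolding K_def using price_at_update_pos B tau_pos
      by (intro potential_ge_if_prices_le) (auto simp: less_imp_le)
    then have "lam / 2 * (\<Sum>n<N. a n) \<le> potential (p 0) - K"
      using updates.potential_descent[of N] unfolding a_def price_before_first_update by linarith
    then show ?thesis using lam_pos by (simp add: field_simps)
  qed
  then have "summable a" using a_nonneg by (intro summableI_nonneg_bounded)
  have "\<exists>n. good n = j \<and> index n = k" for k using update_exists[of j k] by blast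
  then obtain n where n: "\<And>k. good (n k) = j" "\<And>k. index (n k) = k" by metis
  have "inj n" by (rule injI) (metis n(2))
  then have "summable (a \<circ> n)"
    using \<open>summable a\<close> a_nonneg by (intro summable_reindex) auto
  moreover have "a \<circ> n = (\<lambda>k. q j k * (resp j k)\<^sup>2 * dt j k)"
    using price_at_own_update[of "n _"] by (auto simp: a_def n)
  ultimately show ?thesis by simp
qed

end

section \<open>Limit points of a run\<close>

lemma diff_le_diff_if_increments_le:
  fixes f h :: "nat \<Rightarrow> 'a::ordered_ab_group_add"
  assumes "m \<le> n" "\<And>l. \<lbrakk>m \<le> l; l < n\<rbrakk> \<Longrightarrow> f (Suc l) - f l \<le> h (Suc l) - h l"
  shows "f n - f m \<le> h n - h m"
proof -
  have "(\<Sum>l\<in>{m..<n}. f (Suc l) - f l) \<le> (\<Sum>l\<in>{m..<n}. h (Suc l) - h l)"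
    using assms(2) by (intro sum_mono) auto
  then show ?thesis using assms(1) by (simp add: sum_Suc_diff')
qed

lemma bounded_imp_convergent_subsequence_pointwise:
  fixes f :: "nat \<Rightarrow> 'a::finite \<Rightarrow> real"
  assumes "\<And>n j. \<bar>f n j\<bar> \<le> B"
  obtains h l where "strict_mono h" "\<And>j. (\<lambda>n. f (h n) j) \<longlonglongrightarrow> l j"
proof -
  define v where "v n = (\<chi> j. f n j)" for n
  have "norm (v n) \<le> (\<Sum>j\<in>(UNIV :: 'a set). B)" for n
    by (rule order.trans[OF norm_le_l1_cart sum_mono]) (simp add: v_def assms)
  then have "bounded (range v)" by (auto simp: bounded_iff)
  then obtain l h where h: "strict_mono h" "(v \<circ> h) \<longlonglongrightarrow> l"
    using bounded_imp_convergent_subsequence by blast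
  have "(\<lambda>n. f (h n) j) \<longlonglongrightarrow> l $ j" for j
    using tendsto_vec_nth[OF h(2), of j] by (simp add: v_def comp_def)
  then show ?thesis using that h(1) by blast
qed

context tatonnement_run
begin

subsection \<open>Prices move ever more slowly\<close>

lemma abs_q_increment_le:
  assumes "0 < \<epsilon>" "q j k \<le> B"
  shows "\<bar>q j (Suc k) - q j k\<bar>
    \<le> lam / (2 * \<epsilon>) * (q j k * (resp j k)\<^sup>2 * dt j k) + lam * \<epsilon> / 2 * B * dt j k"
proof -
  define r where "r = resp j k"
  have "0 \<le> (\<bar>r\<bar> - \<epsilon>)\<^sup>2" by simp
  then have "2 * \<epsilon> * \<bar>r\<bar> \<le> r\<^sup>2 + \<epsilon>\<^sup>2" by (simp add: power2_diff mult_ac)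
  then have am_gm: "\<bar>r\<bar> \<le> r\<^sup>2 / (2 * \<epsilon>) + \<epsilon> / 2"
    using assms(1) by (simp add: field_simps power2_eq_square)
  have "q j (Suc k) - q j k = lam * q j k * dt j k * r"
    unfolding q_Suc r_def by (simp add: algebra_simps)
  then have "\<bar>q j (Suc k) - q j k\<bar> = lam * q j k * dt j k * \<bar>r\<bar>"
    using dt_pos[of j k] q_pos[of j k] lam_pos by (simp add: abs_mult)
  also have "\<dots> \<le> lam * q j k * dt j k * (r\<^sup>2 / (2 * \<epsilon>) + \<epsilon> / 2)"
    using am_gm dt_pos[of j k] q_pos[of j k] lam_pos by (intro mult_left_mono) auto
  also have "\<dots> = lam / (2 * \<epsilon>) * (q j k * r\<^sup>2 * dt j k) + lam * \<epsilon> / 2 * dt j k * q j k"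
    by (simp add: distrib_left mult_ac)
  also have "\<dots> \<le> lam / (2 * \<epsilon>) * (q j k * r\<^sup>2 * dt j k) + lam * \<epsilon> / 2 * dt j k * B"
    using assms dt_pos[of j k] lam_pos by (intro add_left_mono mult_left_mono) auto
  finally show ?thesis by (simp add: r_def mult_ac)
qed

lemma abs_q_diff_le:
  assumes "k \<le> k'" "0 < \<epsilon>" "\<And>k. q j k \<le> B"
  shows "\<bar>q j k' - q j k\<bar> \<le> lam / (2 * \<epsilon>) * (\<Sum>i\<in>{k..<k'}. q j i * (resp j i)\<^sup>2 * dt j i)
           + lam * \<epsilon> / 2 * B * (T j k' - T j k)"
proof -
  have "\<bar>q j k' - q j k\<bar>
      \<le> (\<Sum>i\<in>{k..<k'}. lam / (2 * \<epsilon>) * (q j i * (resp j i)\<^sup>2 * dt j i) + lam * \<epsilon> / 2 * B * dt j i)"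
    unfolding real_norm_def[symmetric] using assms(1)
    by (rule norm_diff_le_sum_increments) (unfold real_norm_def, rule abs_q_increment_le[OF assms(2,3)])
  also have "\<dots> = lam / (2 * \<epsilon>) * (\<Sum>i\<in>{k..<k'}. q j i * (resp j i)\<^sup>2 * dt j i)
      + lam * \<epsilon> / 2 * B * (\<Sum>i\<in>{k..<k'}. dt j i)"
    by (simp add: sum.distrib sum_distrib_left)
  also have "(\<Sum>i\<in>{k..<k'}. dt j i) = T j k' - T j k" using assms(1) by (rule sum_Suc_diff')
  finally show ?thesis .
qed

lemma prices_move_slowly:
  assumes "0 < \<eta>" "0 \<le> L"
  shows "eventually (\<lambda>t. \<forall>t'\<in>{t..t + L}. \<bar>p t' j - p t j\<bar> \<le> \<eta>) at_top"
proof -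
  obtain B where "0 < B" and B: "\<And>t j. 0 \<le> t \<Longrightarrow> p t j \<le> B" using prices_bounded by metis
  then have q_le: "q j k \<le> B" for k unfolding q_eq_price by (intro B T_nonneg)
  define \<epsilon> where "\<epsilon> = \<eta> / (lam * B * (L + 1))"
  have \<epsilon>: "0 < \<epsilon>" "\<epsilon> * (lam * B * (L + 1)) = \<eta>"
    unfolding \<epsilon>_def using assms \<open>0 < B\<close> lam_pos by auto
  then have "0 < \<epsilon> * \<eta> / lam" using assms lam_pos by simp
  then obtain K where K: "\<And>m n. K \<le> m \<Longrightarrow>
      norm (\<Sum>i\<in>{m..<n}. q j i * (resp j i)\<^sup>2 * dt j i) < \<epsilon> * \<eta> / lam"
    using summable_squared_response[of j] unfolding summable_Cauchy by meson
  have "\<bar>p t' j - p t j\<bar> \<le> \<eta>" if t: "T j K + 1 \<le> t" "t' \<in> {t..t + L}" for t t'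
  proof -
    have "0 < t" "0 < t'" using t T_nonneg[of j K] by auto
    then obtain k k' where k: "T j k < t" "t \<le> T j (Suc k)" and k': "T j k' < t'" "t' \<le> T j (Suc k')"
      using T_interval_exists by metis
    have "T j K \<le> T j k" "T j k < T j (Suc k')" and dT: "T j k' - T j k \<le> L + 1"
      using k k' t T_gap[of j k] by auto
    then have "K \<le> k" "k \<le> k'" by (simp_all add: T_le_iff T_less_iff)
    have "\<bar>q j k' - q j k\<bar> \<le> lam / (2 * \<epsilon>) * (\<Sum>i\<in>{k..<k'}. q j i * (resp j i)\<^sup>2 * dt j i)
        + lam * \<epsilon> / 2 * B * (T j k' - T j k)"
      by (intro abs_q_diff_le \<open>k \<le> k'\<close> \<epsilon>(1) q_le)
    also have "\<dots> \<le> lam / (2 * \<epsilon>) * (\<epsilon> * \<eta> / lam) + lam * \<epsilon> / 2 * B * (L + 1)"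
      using K[OF \<open>K \<le> k\<close>, of k'] dT \<epsilon>(1) lam_pos \<open>0 < B\<close> by (intro add_mono mult_left_mono) auto
    also have "\<dots> = \<eta> / 2 + \<epsilon> * (lam * B * (L + 1)) / 2" using \<epsilon>(1) lam_pos by simp
    also have "\<dots> = \<eta>" unfolding \<epsilon>(2) by simp
    finally show ?thesis using p_eq_q k k' by simp
  qed
  then show ?thesis unfolding eventually_at_top_linorder by blast
qed

subsection \<open>Sequences of times with convergent prices\<close>

definition limit_along :: "(nat \<Rightarrow> real) \<Rightarrow> ('g \<Rightarrow> real) \<Rightarrow> bool" where
  "limit_along s ps \<longleftrightarrow> filterlim s at_top sequentially \<and> (\<forall>j. (\<lambda>n. p (s n) j) \<longlonglongrightarrow> ps j)"

lemma limit_along_eventually_ge: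
  assumes "limit_along s ps"
  shows "eventually (\<lambda>n. t \<le> s n) sequentially"
  using assms by (auto simp: limit_along_def filterlim_at_top)

lemma limit_along_tendsto: "limit_along s ps \<Longrightarrow> (\<lambda>n. p (s n) j) \<longlonglongrightarrow> ps j"
  by (simp add: limit_along_def)

lemma limit_along_nonneg:
  assumes "limit_along s ps"
  shows "0 \<le> ps j"
proof (rule tendsto_lowerbound[OF limit_along_tendsto[OF assms]])
  show "eventually (\<lambda>n. 0 \<le> p (s n) j) sequentially"
    using limit_along_eventually_ge[OF assms, of 0] by eventually_elim (simp add: p_pos less_imp_le)
qed simp

lemma limit_along_nearby_times:
  assumes lim: "limit_along s ps" and r: "\<And>n. r n \<in> {s n..s n + L}"
  shows "limit_along r ps"
  unfolding limit_along_def
proof (intro conjI allI)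
  show "filterlim r at_top sequentially"
    by (rule filterlim_at_top_mono[of s]) (use lim r in \<open>auto simp: limit_along_def\<close>)
  have "0 \<le> L" using r[of 0] by simp
  fix j
  have "(\<lambda>n. p (r n) j - p (s n) j) \<longlonglongrightarrow> 0"
  proof (rule tendstoI)
    fix \<eta> :: real assume "0 < \<eta>"
    then have "eventually (\<lambda>t. \<forall>t'\<in>{t..t + L}. \<bar>p t' j - p t j\<bar> \<le> \<eta> / 2) at_top"
      using \<open>0 \<le> L\<close> by (intro prices_move_slowly) auto
    then have "eventually (\<lambda>n. \<forall>t'\<in>{s n..s n + L}. \<bar>p t' j - p (s n) j\<bar> \<le> \<eta> / 2) sequentially"
      using lim unfolding limit_along_def filterlim_iff by blast
    then show "eventually (\<lambda>n. dist (p (r n) j - p (s n) j) 0 < \<eta>) sequentially"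
      by eventually_elim (use r \<open>0 < \<eta>\<close> in \<open>force simp: dist_real_def\<close>)
  qed
  from tendsto_add[OF this limit_along_tendsto[OF lim, of j]] show "(\<lambda>n. p (r n) j) \<longlonglongrightarrow> ps j" by simp
qed

lemma eventually_on_interval_if_limit_along:
  assumes lim: "limit_along s ps" and "0 \<le> L"
    and Q: "\<And>r. limit_along r ps \<Longrightarrow> eventually (\<lambda>n. Q (r n)) sequentially"
  shows "eventually (\<lambda>n. \<forall>t\<in>{s n..s n + L}. Q t) sequentially"
proof -
  have "\<exists>t\<in>{s n..s n + L}. (\<forall>t\<in>{s n..s n + L}. Q t) \<or> \<not> Q t" for n
    using \<open>0 \<le> L\<close> by (cases "\<forall>t\<in>{s n..s n + L}. Q t") auto
  then obtain r where r: "\<And>n. r n \<in> {s n..s n + L}" "\<And>n. (\<forall>t\<in>{s n..s n + L}. Q t) \<or> \<not> Q (r n)"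
    by metis
  have "eventually (\<lambda>n. Q (r n)) sequentially" by (intro Q limit_along_nearby_times[OF lim r(1)])
  then show ?thesis by eventually_elim (use r(2) in blast)
qed

lemma convergent_subsequence_of_times:
  assumes s: "filterlim s at_top sequentially"
  obtains h ps where "strict_mono h" "limit_along (s \<circ> h) ps"
proof -
  obtain B where "0 < B" and B: "\<And>t j. 0 \<le> t \<Longrightarrow> p t j \<le> B" using prices_bounded by metis
  have "\<bar>p (max 0 (s n)) j\<bar> \<le> B" for n j
    using B[of "max 0 (s n)" j] p_pos[of "max 0 (s n)" j] by simp
  then obtain h ps where h: "strict_mono h" and lim: "\<And>j. (\<lambda>n. p (max 0 (s (h n))) j) \<longlonglongrightarrow> ps j"
    using bounded_imp_convergent_subsequence_pointwise[of "\<lambda>n j. p (max 0 (s n)) j" B] by metis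
  have sh: "filterlim (\<lambda>n. s (h n)) at_top sequentially"
    using s filterlim_subseq[OF h] by (rule filterlim_compose)
  then have "eventually (\<lambda>n. 0 \<le> s (h n)) sequentially" by (simp add: filterlim_at_top)
  then have "eventually (\<lambda>n. p (max 0 (s (h n))) j = p (s (h n)) j) sequentially" for j
    by eventually_elim (simp add: max_def)
  then have "(\<lambda>n. p (s (h n)) j) \<longlonglongrightarrow> ps j" for j using lim by (blast intro: Lim_transform_eventually)
  then show ?thesis using h sh by (intro that[of h ps]) (simp_all add: limit_along_def comp_def)
qed

lemma eventually_if_limit_along:
  assumes Q: "\<And>s ps. limit_along s ps \<Longrightarrow> eventually (\<lambda>n. Q (s n)) sequentially"
  shows "eventually Q at_top"
proof (rule ccontr)
  assume "\<not> eventually Q at_top"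
  then have "\<exists>t\<ge>real n. \<not> Q t" for n by (auto simp: eventually_at_top_linorder)
  then obtain s where s: "\<And>n. real n \<le> s n" "\<And>n. \<not> Q (s n)" by metis
  have "filterlim s at_top sequentially"
    using filterlim_real_sequentially by (rule filterlim_at_top_mono) (simp add: s)
  then obtain h ps where "limit_along (s \<circ> h) ps" by (rule convergent_subsequence_of_times)
  then have "eventually (\<lambda>n. Q ((s \<circ> h) n)) sequentially" by (rule Q)
  then show False using s(2) by simp
qed

subsection \<open>Excess demand of a fixed sign\<close>

lemma ln_q_Suc: "ln (q j (Suc k)) - ln (q j k) = ln (1 + lam * resp j k * dt j k)"
  unfolding q_Suc using q_pos[of j k] abs_relative_change_le[OF resp_ge, of j k]
  by (simp add: ln_mult)

lemma ln_price_growth: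
  assumes "k \<le> k'" "0 \<le> \<epsilon>" "\<epsilon> \<le> 1" "\<And>t. \<lbrakk>T j k < t; t \<le> T j k'\<rbrakk> \<Longrightarrow> \<epsilon> \<le> z (p t) j"
  shows "lam * \<epsilon> / 2 * (T j k' - T j k) \<le> ln (q j k') - ln (q j k)"
  unfolding right_diff_distrib
proof (rule diff_le_diff_if_increments_le[OF assms(1)])
  fix l assume l: "k \<le> l" "l < k'"
  define h where "h = lam * \<epsilon> * dt j l"
  have "T j k \<le> T j l" "T j (Suc l) \<le> T j k'" using l by (auto simp: T_le_iff)
  then have "\<epsilon> \<le> resp j l" by (intro resp_ge_if assms(3,4)) auto
  then have h_le: "h \<le> lam * resp j l * dt j l"
    unfolding h_def using lam_pos dt_pos[of j l] by (intro mult_right_mono mult_left_mono) auto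
  have h: "0 \<le> h" using lam_pos assms(2) dt_pos[of j l] by (simp add: h_def)
  have h1: "h \<le> 1 / 2" using h_le abs_relative_change_le[OF resp_ge, of j l] by simp
  have "h * h \<le> h * (1 / 2)" using h h1 by (intro mult_left_mono)
  then have "h / 2 \<le> h - h\<^sup>2" by (simp add: power2_eq_square)
  also have "\<dots> \<le> ln (1 + h)" using h h1 by (intro ln_one_plus_pos_lower_bound) auto
  also have "\<dots> \<le> ln (q j (Suc l)) - ln (q j l)"
    unfolding ln_q_Suc using h h_le by (intro ln_mono) auto
  finally show "lam * \<epsilon> / 2 * T j (Suc l) - lam * \<epsilon> / 2 * T j l \<le> ln (q j (Suc l)) - ln (q j l)"
    by (simp add: h_def right_diff_distrib)
qed

lemma ln_price_decline:
  assumes "k \<le> k'" "\<And>t. \<lbrakk>T j k < t; t \<le> T j k'\<rbrakk> \<Longrightarrow> z (p t) j \<le> - \<epsilon>"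
  shows "ln (q j k') - ln (q j k) \<le> - lam * \<epsilon> * (T j k' - T j k)"
  unfolding right_diff_distrib
proof (rule diff_le_diff_if_increments_le[OF assms(1)])
  fix l assume l: "k \<le> l" "l < k'"
  have "T j k \<le> T j l" "T j (Suc l) \<le> T j k'" using l by (auto simp: T_le_iff)
  then have "resp j l \<le> - \<epsilon>" by (intro resp_le_if assms(2)) auto
  then have "lam * resp j l * dt j l \<le> lam * (- \<epsilon>) * dt j l"
    using lam_pos dt_pos[of j l] by (intro mult_right_mono mult_left_mono) auto
  moreover have "ln (q j (Suc l)) - ln (q j l) \<le> lam * resp j l * dt j l"
    unfolding ln_q_Suc using abs_relative_change_le[OF resp_ge, of j l]
    by (intro ln_add_one_self_le_self2) auto
  ultimately show "ln (q j (Suc l)) - ln (q j l) \<le> - lam * \<epsilon> * T j (Suc l) - - lam * \<epsilon> * T j l"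
    by (simp add: right_diff_distrib)
qed

lemma updates_spanning_unit_time:
  assumes "0 < s"
  obtains k k' where "k \<le> k'" "s \<le> T j k" "T j k + 1 \<le> T j k'" "T j (Suc k') \<le> s + 4"
proof -
  have "0 < s + 3" using assms by simp
  then obtain l k' where l: "T j l < s" "s \<le> T j (Suc l)" and k': "T j k' < s + 3" "s + 3 \<le> T j (Suc k')"
    using T_interval_exists[OF assms] T_interval_exists by metis
  have "s \<le> T j (Suc l)" "T j (Suc l) + 1 \<le> T j k'" "T j (Suc k') \<le> s + 4"
    using l k' T_gap[of j l] T_gap[of j k'] by linarith+
  moreover from this have "T j (Suc l) \<le> T j k'" by linarith
  then have "Suc l \<le> k'" by (simp add: T_le_iff)
  ultimately show ?thesis using that by blast
qed

lemma price_change_if_excess_demand_sign: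
  assumes "0 < s" "0 < \<epsilon>" "\<epsilon> \<le> 1"
    and "(\<forall>t\<in>{s..s + 4}. \<epsilon> \<le> z (p t) j) \<or> (\<forall>t\<in>{s..s + 4}. z (p t) j \<le> - \<epsilon>)"
  obtains t t' where "t \<in> {s..s + 4}" "t' \<in> {s..s + 4}" "lam * \<epsilon> / 2 \<le> \<bar>ln (p t' j) - ln (p t j)\<bar>"
proof -
  obtain k k' where k: "k \<le> k'" "s \<le> T j k" "T j k + 1 \<le> T j k'" "T j (Suc k') \<le> s + 4"
    using updates_spanning_unit_time[OF assms(1), of j] by metis
  have mono: "T j k < T j (Suc k)" "T j k' < T j (Suc k')" "T j (Suc k) \<le> T j (Suc k')"
    using k(1) by (auto simp: T_less_iff T_le_iff)
  have "lam * \<epsilon> / 2 \<le> \<bar>ln (q j k') - ln (q j k)\<bar>"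
    using assms(4)
  proof
    assume excess: "\<forall>t\<in>{s..s + 4}. \<epsilon> \<le> z (p t) j"
    have "lam * \<epsilon> / 2 \<le> lam * \<epsilon> / 2 * (T j k' - T j k)" using k lam_pos assms(2) by simp
    also have "\<dots> \<le> ln (q j k') - ln (q j k)"
      using k mono assms(2,3) excess by (intro ln_price_growth) auto
    finally show ?thesis by linarith
  next
    assume deficit: "\<forall>t\<in>{s..s + 4}. z (p t) j \<le> - \<epsilon>"
    have "ln (q j k') - ln (q j k) \<le> - lam * \<epsilon> * (T j k' - T j k)"
      using k mono deficit by (intro ln_price_decline) auto
    also have "\<dots> \<le> - lam * \<epsilon>" using k lam_pos assms(2) by simp
    finally have "lam * \<epsilon> \<le> \<bar>ln (q j k') - ln (q j k)\<bar>" by simp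
    then show ?thesis using mult_pos_pos[OF lam_pos assms(2)] by simp
  qed
  then show ?thesis using that[of "T j (Suc k)" "T j (Suc k')"] k mono by (simp add: q_eq_price)
qed

lemma excess_demand_sign_near_limit:
  assumes lim: "limit_along s ps" and "zl \<noteq> 0"
    and z_lim: "\<And>r. limit_along r ps \<Longrightarrow> (\<lambda>n. z (p (r n)) j) \<longlonglongrightarrow> zl"
  shows "\<exists>\<epsilon>>0. \<epsilon> \<le> 1 \<and> eventually (\<lambda>n. (\<forall>t\<in>{s n..s n + 4}. \<epsilon> \<le> z (p t) j) \<or>
    (\<forall>t\<in>{s n..s n + 4}. z (p t) j \<le> - \<epsilon>)) sequentially"
proof (intro exI conjI)
  define \<epsilon> where "\<epsilon> = min (\<bar>zl\<bar> / 2) 1"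
  show "0 < \<epsilon>" "\<epsilon> \<le> 1" using \<open>zl \<noteq> 0\<close> by (auto simp: \<epsilon>_def)
  have \<epsilon>: "\<epsilon> < \<bar>zl\<bar>" using \<open>zl \<noteq> 0\<close> by (auto simp: \<epsilon>_def)
  show "eventually (\<lambda>n. (\<forall>t\<in>{s n..s n + 4}. \<epsilon> \<le> z (p t) j) \<or>
      (\<forall>t\<in>{s n..s n + 4}. z (p t) j \<le> - \<epsilon>)) sequentially"
  proof (cases "0 < zl")
    case True
    have "eventually (\<lambda>n. \<epsilon> \<le> z (p (r n)) j) sequentially" if "limit_along r ps" for r
      using order_tendstoD(1)[OF z_lim[OF that], of \<epsilon>] True \<epsilon> by (auto elim: eventually_mono)
    then have "eventually (\<lambda>n. \<forall>t\<in>{s n..s n + 4}. \<epsilon> \<le> z (p t) j) sequentially"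
      by (intro eventually_on_interval_if_limit_along[OF lim]) auto
    then show ?thesis by (auto elim: eventually_mono)
  next
    case False
    have "eventually (\<lambda>n. z (p (r n)) j \<le> - \<epsilon>) sequentially" if "limit_along r ps" for r
      using order_tendstoD(2)[OF z_lim[OF that], of "- \<epsilon>"] False \<epsilon> by (auto elim: eventually_mono)
    then have "eventually (\<lambda>n. \<forall>t\<in>{s n..s n + 4}. z (p t) j \<le> - \<epsilon>) sequentially"
      by (intro eventually_on_interval_if_limit_along[OF lim]) auto
    then show ?thesis by (auto elim: eventually_mono)
  qed
qed

text \<open>Over a bounded time span the prices barely move but are updated for at least one unit of time,
  so a good whose limit price is positive cannot keep an excess demand of a fixed sign.\<close>

lemma limit_excess_demand_eq_0:
  assumes lim: "limit_along s ps" and pos: "0 < ps j"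
    and z_lim: "\<And>r. limit_along r ps \<Longrightarrow> (\<lambda>n. z (p (r n)) j) \<longlonglongrightarrow> zl"
  shows "zl = 0"
proof (rule ccontr)
  assume "zl \<noteq> 0"
  then obtain \<epsilon> where \<epsilon>: "0 < \<epsilon>" "\<epsilon> \<le> 1"
    and sign: "eventually (\<lambda>n. (\<forall>t\<in>{s n..s n + 4}. \<epsilon> \<le> z (p t) j) \<or>
      (\<forall>t\<in>{s n..s n + 4}. z (p t) j \<le> - \<epsilon>)) sequentially"
    using excess_demand_sign_near_limit[OF lim _ z_lim] by blast
  have price: "eventually (\<lambda>n. \<forall>t\<in>{s n..s n + 4}. dist (ln (p t j)) (ln (ps j)) < lam * \<epsilon> / 4) sequentially"
    using lim
  proof (rule eventually_on_interval_if_limit_along)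
    fix r assume "limit_along r ps"
    then have "(\<lambda>n. ln (p (r n) j)) \<longlonglongrightarrow> ln (ps j)"
      using pos by (intro tendsto_ln limit_along_tendsto) auto
    then show "eventually (\<lambda>n. dist (ln (p (r n) j)) (ln (ps j)) < lam * \<epsilon> / 4) sequentially"
      using lam_pos \<epsilon>(1) by (intro tendstoD) auto
  qed simp
  from price sign limit_along_eventually_ge[OF lim, of 1] have "eventually (\<lambda>_. False) sequentially"
  proof eventually_elim
    case (elim n)
    then have "0 < s n" by simp
    then obtain t t' where "t \<in> {s n..s n + 4}" "t' \<in> {s n..s n + 4}"
      and "lam * \<epsilon> / 2 \<le> \<bar>ln (p t' j) - ln (p t j)\<bar>"
      using price_change_if_excess_demand_sign[OF _ \<epsilon>(1,2) elim(2)] by metis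
    moreover from this have "dist (ln (p t j)) (ln (ps j)) < lam * \<epsilon> / 4"
      "dist (ln (p t' j)) (ln (ps j)) < lam * \<epsilon> / 4" using elim(1) by blast+
    ultimately show False unfolding dist_real_def by linarith
  qed
  then show False by simp
qed

lemma limit_demand_eq_1:
  assumes lim: "limit_along s ps" and pos: "0 < ps j"
    and z: "\<And>t. 0 \<le> t \<Longrightarrow> z (p t) j = D (p t) - 1"
    and D_lim: "\<And>r. limit_along r ps \<Longrightarrow> (\<lambda>n. D (p (r n))) \<longlonglongrightarrow> D ps"
  shows "D ps = 1"
proof -
  have "D ps - 1 = 0"
    using lim pos
  proof (rule limit_excess_demand_eq_0)
    fix r assume r: "limit_along r ps"
    have "(\<lambda>n. D (p (r n)) - 1) \<longlonglongrightarrow> D ps - 1" by (intro tendsto_intros D_lim r)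
    moreover have "eventually (\<lambda>n. D (p (r n)) - 1 = z (p (r n)) j) sequentially"
      using limit_along_eventually_ge[OF r, of 0] by eventually_elim (simp add: z)
    ultimately show "(\<lambda>n. z (p (r n)) j) \<longlonglongrightarrow> D ps - 1" by (rule Lim_transform_eventually)
  qed
  then show ?thesis by simp
qed

lemma no_permanent_excess_demand:
  assumes "0 < \<epsilon>"
  shows "\<not> eventually (\<lambda>t. \<epsilon> \<le> z (p t) j) at_top"
proof
  assume "eventually (\<lambda>t. \<epsilon> \<le> z (p t) j) at_top"
  then obtain t0 where excess: "\<And>t. t0 \<le> t \<Longrightarrow> \<epsilon> \<le> z (p t) j"
    by (auto simp: eventually_at_top_linorder)
  obtain B where "0 < B" and B: "\<And>t j. 0 \<le> t \<Longrightarrow> p t j \<le> B" using prices_bounded by metis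
  define \<epsilon>' where "\<epsilon>' = min \<epsilon> 1"
  have \<epsilon>': "0 < \<epsilon>'" "\<epsilon>' \<le> 1" "\<epsilon>' \<le> \<epsilon>" using assms by (auto simp: \<epsilon>'_def)
  obtain k where k: "t0 \<le> T j k" using T_unbounded by blast
  have excess': "\<epsilon>' \<le> z (p t) j" if "T j k < t" for t using excess[of t] that k \<epsilon>' by linarith
  have growth: "lam * \<epsilon>' / 2 * (T j k' - T j k) \<le> ln B - ln (q j k)" if "k \<le> k'" for k'
  proof -
    have "lam * \<epsilon>' / 2 * (T j k' - T j k) \<le> ln (q j k') - ln (q j k)"
      using \<epsilon>' that by (intro ln_price_growth excess') auto
    also have "ln (q j k') \<le> ln B"
      unfolding q_eq_price using p_pos T_nonneg by (intro ln_mono B) auto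
    finally show ?thesis by simp
  qed
  define D where "D = (ln B - ln (q j k)) / (lam * \<epsilon>' / 2)"
  obtain k' where k': "max (T j k) (T j k + D + 1) \<le> T j k'" using T_unbounded by blast
  then have "T j k' - T j k \<le> D"
    using growth[of k'] lam_pos \<epsilon>'(1) by (simp add: D_def T_le_iff field_simps)
  then show False using k' by simp
qed

end

section \<open>Convergence for CES utilities\<close>

lemma weighted_mean_pos:
  fixes s t :: "'a \<Rightarrow> real"
  assumes "finite A" and s: "\<And>j. j \<in> A \<Longrightarrow> 0 \<le> s j" "(\<Sum>j\<in>A. s j) = 1"
    and t: "\<And>j. \<lbrakk>j \<in> A; 0 < s j\<rbrakk> \<Longrightarrow> 0 < t j"
  shows "0 < (\<Sum>j\<in>A. s j * t j)"
proof -
  obtain i where i: "i \<in> A" "0 < s i"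
    using s by (metis less_eq_real_def sum.neutral zero_neq_one)
  have "0 \<le> s j * t j" if "j \<in> A" for j using s(1)[OF that] t[OF that] by (cases "0 < s j") auto
  then show ?thesis using assms(1) i t by (intro sum_pos2[of A i]) auto
qed

text \<open>Chebyshev's sum inequality for the oppositely ordered \<open>t\<close> and \<open>t powr (\<theta> - 1)\<close>; it holds termwise
  once \<open>t\<close> is compared with its mean \<open>m\<close>.\<close>

lemma sum_powr_le_mean_mult:
  fixes s t :: "'a \<Rightarrow> real" and \<theta> :: real
  assumes "finite A" and s: "\<And>j. j \<in> A \<Longrightarrow> 0 \<le> s j" "(\<Sum>j\<in>A. s j) = 1"
    and t: "\<And>j. \<lbrakk>j \<in> A; 0 < s j\<rbrakk> \<Longrightarrow> 0 < t j" and \<theta>: "\<theta> \<le> 1" and m: "m = (\<Sum>j\<in>A. s j * t j)"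
  shows "(\<Sum>j\<in>A. s j * t j powr \<theta>) \<le> m * (\<Sum>j\<in>A. s j * t j powr (\<theta> - 1))" (is "?L \<le> ?R")
    and "\<lbrakk>\<theta> < 1; k \<in> A; 0 < s k; t k \<noteq> m\<rbrakk> \<Longrightarrow>
      (\<Sum>j\<in>A. s j * t j powr \<theta>) < m * (\<Sum>j\<in>A. s j * t j powr (\<theta> - 1))"
proof -
  define f where "f j = s j * ((t j - m) * (m powr (\<theta> - 1) - t j powr (\<theta> - 1)))" for j
  have m_pos: "0 < m" unfolding m by (rule weighted_mean_pos[OF assms(1) s t])
  have f_nonneg: "0 \<le> f j" if "j \<in> A" for j
  proof (cases "0 < s j")
    case True
    have "t j powr (\<theta> - 1) \<le> m powr (\<theta> - 1)" if "m \<le> t j"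
      using that m_pos \<theta> by (intro powr_mono2') auto
    moreover have "m powr (\<theta> - 1) \<le> t j powr (\<theta> - 1)" if "t j \<le> m"
      using that t[OF \<open>j \<in> A\<close> True] \<theta> by (intro powr_mono2') auto
    ultimately have "0 \<le> (t j - m) * (m powr (\<theta> - 1) - t j powr (\<theta> - 1))"
      by (cases "m \<le> t j") (simp_all add: mult_nonpos_nonpos)
    then show ?thesis unfolding f_def using True by simp
  qed (use s(1)[OF that] in \<open>simp add: f_def\<close>)
  have f_pos: "0 < f k" if k: "\<theta> < 1" "k \<in> A" "0 < s k" "t k \<noteq> m" for k
  proof (cases "m < t k")
    case True
    then have "t k powr (\<theta> - 1) < m powr (\<theta> - 1)" using m_pos k by (intro powr_less_mono2_neg) auto
    then show ?thesis unfolding f_def using k True by simp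
  next
    case False
    then have "m powr (\<theta> - 1) < t k powr (\<theta> - 1)" using t k by (intro powr_less_mono2_neg) auto
    then show ?thesis unfolding f_def using k False by (simp add: mult_neg_neg)
  qed
  have "s j * (t j * t j powr (\<theta> - 1)) = s j * t j powr \<theta>" if "j \<in> A" for j
    using s(1)[OF that] t[OF that] by (cases "0 < s j") (auto simp: powr_mult_base)
  then have "f j = m powr (\<theta> - 1) * (s j * t j) - s j * t j powr \<theta>
      - m * m powr (\<theta> - 1) * s j + m * (s j * t j powr (\<theta> - 1))" if "j \<in> A" for j
    unfolding f_def using that by (simp only: left_diff_distrib right_diff_distrib mult_ac)
  then have sum_f: "(\<Sum>j\<in>A. f j) = ?R - ?L"
    using s(2) by (simp add: sum.distrib sum_subtractf m flip: sum_distrib_left)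
  have "0 \<le> (\<Sum>j\<in>A. f j)" using f_nonneg by (intro sum_nonneg)
  then show "?L \<le> ?R" unfolding sum_f by simp
  show "?L < ?R" if "\<theta> < 1" "k \<in> A" "0 < s k" "t k \<noteq> m"
  proof -
    have "0 < (\<Sum>j\<in>A. f j)" using f_nonneg assms(1) that f_pos[OF that] by (intro sum_pos2[of A k])
    then show ?thesis unfolding sum_f by simp
  qed
qed

lemma mean_add_powr_quotient_ge_2:
  fixes s t :: "'a \<Rightarrow> real" and \<theta> :: real
  assumes "finite A" and s: "\<And>j. j \<in> A \<Longrightarrow> 0 \<le> s j" "(\<Sum>j\<in>A. s j) = 1"
    and t: "\<And>j. \<lbrakk>j \<in> A; 0 < s j\<rbrakk> \<Longrightarrow> 0 < t j" and \<theta>: "\<theta> \<le> 1"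
  defines "Q \<equiv> (\<Sum>j\<in>A. s j * t j powr (\<theta> - 1)) / (\<Sum>j\<in>A. s j * t j powr \<theta>)"
  shows "2 \<le> (\<Sum>j\<in>A. s j * t j) + Q"
    and "\<lbrakk>\<theta> < 1; k \<in> A; 0 < s k; t k \<noteq> 1\<rbrakk> \<Longrightarrow> 2 < (\<Sum>j\<in>A. s j * t j) + Q"
proof -
  define m where "m = (\<Sum>j\<in>A. s j * t j)"
  have m_pos: "0 < m" unfolding m_def by (rule weighted_mean_pos[OF assms(1) s t])
  have powr_pos: "0 < t j powr \<theta>" if "j \<in> A" "0 < s j" for j using t[OF that] by simp
  have M_pos: "0 < (\<Sum>j\<in>A. s j * t j powr \<theta>)" by (rule weighted_mean_pos[OF assms(1) s powr_pos])
  note chebyshev = sum_powr_le_mean_mult[OF assms(1) s t \<theta> m_def]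
  have Q_ge: "1 / m \<le> Q" using chebyshev(1) m_pos M_pos by (simp add: Q_def field_simps)
  have square: "m + 1 / m - 2 = (m - 1)\<^sup>2 / m"
    using m_pos by (simp add: field_simps power2_eq_square)
  also have "0 \<le> \<dots>" using m_pos by simp
  finally show "2 \<le> m + Q" using Q_ge by simp
  show "2 < m + Q" if k: "\<theta> < 1" "k \<in> A" "0 < s k" "t k \<noteq> 1"
  proof (cases "m = 1")
    case True
    have "1 / m < Q" using chebyshev(2)[of k] k True m_pos M_pos by (simp add: Q_def field_simps)
    then show ?thesis using True by simp
  next
    case False
    then have "0 < (m - 1)\<^sup>2 / m" using m_pos by simp
    then show ?thesis using Q_ge square by linarith
  qed
qed

context ces_market
begin

lemma cost_purchase:
  assumes "\<And>j. 0 < c i j \<Longrightarrow> 0 < p j"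
  shows "(\<Sum>j\<in>UNIV. p j * purchase i p j) = e i"
proof -
  have "p j * purchase i p j = e i * share i p j" for j
    using assms[of j] by (cases "0 < c i j") (auto simp: purchase_def share_eq_0)
  then show ?thesis using sum_share[of i p] assms by (simp flip: sum_distrib_left)
qed

lemma cost_purchase_at_other_prices:
  "(\<Sum>j\<in>UNIV. p' j * purchase i p j) = e i * (\<Sum>j\<in>UNIV. share i p j * (p' j / p j))"
  by (simp add: purchase_def sum_distrib_left mult_ac)

lemma share_at_other_prices:
  assumes p: "\<And>j. 0 < c i j \<Longrightarrow> 0 < p j" and p': "\<And>j. 0 < c i j \<Longrightarrow> 0 < p' j"
  shows "share i p' j = share i p j * (p' j / p j) powr \<theta> i
    / (\<Sum>k\<in>UNIV. share i p k * (p' k / p k) powr \<theta> i)"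
proof -
  have term_eq: "share i p k * (p' k / p k) powr \<theta> i = c i k * p' k powr \<theta> i / aggregate i p" for k
    using p[of k] p'[of k]
    by (cases "0 < c i k") (auto simp: share_def powr_divide share_eq_0 not_less c_nonneg order.antisym)
  have "(\<Sum>k\<in>UNIV. share i p k * (p' k / p k) powr \<theta> i) = aggregate i p' / aggregate i p"
    unfolding term_eq by (simp add: aggregate_def sum_divide_distrib)
  then show ?thesis unfolding term_eq using aggregate_pos[of i p] p by (simp add: share_def)
qed

lemma sum_price_diff_mult_purchase_diff:
  fixes p p' :: "'g \<Rightarrow> real"
  assumes p: "\<And>j. 0 < c i j \<Longrightarrow> 0 < p j" and p': "\<And>j. 0 < c i j \<Longrightarrow> 0 < p' j"
  defines "t \<equiv> \<lambda>j. p' j / p j"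
  shows "(\<Sum>j\<in>UNIV. (p j - p' j) * (purchase i p j - purchase i p' j))
    = e i * (2 - ((\<Sum>j\<in>UNIV. share i p j * t j)
        + (\<Sum>j\<in>UNIV. share i p j * t j powr (\<theta> i - 1)) / (\<Sum>j\<in>UNIV. share i p j * t j powr \<theta> i)))"
proof -
  define M where "M = (\<Sum>j\<in>UNIV. share i p j * t j powr \<theta> i)"
  have "share i p' j * (p j / p' j) = share i p j * t j powr (\<theta> i - 1) / M" for j
    using share_at_other_prices[of i p p' j, OF p p'] p[of j] p'[of j]
    by (cases "0 < c i j") (auto simp: M_def t_def share_eq_0 powr_diff mult_ac)
  then have "(\<Sum>j\<in>UNIV. p j * purchase i p' j) = e i * ((\<Sum>j\<in>UNIV. share i p j * t j powr (\<theta> i - 1)) / M)"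
    unfolding cost_purchase_at_other_prices by (simp flip: sum_divide_distrib)
  then show ?thesis
    using cost_purchase[of i p, OF p] cost_purchase[of i p', OF p']
      cost_purchase_at_other_prices[of p' i p]
    by (simp add: left_diff_distrib right_diff_distrib sum_subtractf distrib_left t_def M_def)
qed

lemma law_of_demand:
  assumes p: "\<And>j. 0 < c i j \<Longrightarrow> 0 < p j" and p': "\<And>j. 0 < c i j \<Longrightarrow> 0 < p' j"
  shows "(\<Sum>j\<in>UNIV. (p j - p' j) * (purchase i p j - purchase i p' j)) \<le> 0"
    and "\<lbrakk>\<theta> i < 1; 0 < c i k; p k \<noteq> p' k\<rbrakk> \<Longrightarrow>
      (\<Sum>j\<in>UNIV. (p j - p' j) * (purchase i p j - purchase i p' j)) < 0"
proof -
  define t where "t j = p' j / p j" for j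
  define A where "A = (\<Sum>j\<in>UNIV. share i p j * t j)
    + (\<Sum>j\<in>UNIV. share i p j * t j powr (\<theta> i - 1)) / (\<Sum>j\<in>UNIV. share i p j * t j powr \<theta> i)"
  have sum_eq: "(\<Sum>j\<in>UNIV. (p j - p' j) * (purchase i p j - purchase i p' j)) = e i * (2 - A)"
    unfolding A_def t_def by (rule sum_price_diff_mult_purchase_diff[OF p p'])
  have t: "0 < t j" if "0 < share i p j" for j
    using p[of j] p'[of j] share_eq_0[of i j p] that by (force simp: t_def)
  have sum_1: "(\<Sum>j\<in>UNIV. share i p j) = 1" by (rule sum_share[OF p])
  have "2 \<le> A"
    unfolding A_def
    by (rule mean_add_powr_quotient_ge_2(1)[OF _ share_nonneg sum_1 t theta_le_1]) simp
  then show "(\<Sum>j\<in>UNIV. (p j - p' j) * (purchase i p j - purchase i p' j)) \<le> 0"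
    unfolding sum_eq using e_nonneg by (intro mult_nonneg_nonpos) auto
  show "(\<Sum>j\<in>UNIV. (p j - p' j) * (purchase i p j - purchase i p' j)) < 0"
    if k: "\<theta> i < 1" "0 < c i k" "p k \<noteq> p' k"
  proof -
    have "0 < share i p k" "t k \<noteq> 1" using share_pos[of i p k, OF p] k p[of k] by (auto simp: t_def)
    then have "2 < A"
      unfolding A_def using k(1)
      by (intro mean_add_powr_quotient_ge_2(2)[OF _ share_nonneg sum_1 t theta_le_1]) auto
    then show ?thesis unfolding sum_eq using e_pos by (intro mult_pos_neg) auto
  qed
qed

definition clearing_prices :: "('g \<Rightarrow> real) \<Rightarrow> bool" where
  "clearing_prices p \<longleftrightarrow> (\<forall>j. (wanted j \<longrightarrow> 0 < p j \<and> spend p j = p j) \<and> (\<not> wanted j \<longrightarrow> p j = 0))"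

lemma clearing_prices_unique:
  assumes \<theta>: "\<And>i. \<theta> i < 1" and "clearing_prices p" "clearing_prices p'"
  shows "p = p'"
proof (rule ccontr)
  assume "p \<noteq> p'"
  then obtain k where k: "p k \<noteq> p' k" by blast
  then obtain i where i: "0 < c i k"
    using assms(2,3) by (metis clearing_prices_def wanted_def)
  have pos: "0 < c i j \<Longrightarrow> 0 < p j" "0 < c i j \<Longrightarrow> 0 < p' j" for i j
    using assms(2,3) by (auto simp: clearing_prices_def wanted_def)
  have "(\<Sum>j\<in>UNIV. (p j - p' j) * (purchase i p j - purchase i p' j)) \<le> 0" for i
    by (rule law_of_demand(1)) (use pos in blast)+
  moreover have "(\<Sum>j\<in>UNIV. (p j - p' j) * (purchase i p j - purchase i p' j)) < 0"
    by (rule law_of_demand(2)[of i p p' k]) (use pos \<theta> i k in blast)+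
  ultimately have "(\<Sum>i\<in>UNIV. \<Sum>j\<in>UNIV. (p j - p' j) * (purchase i p j - purchase i p' j))
      < (\<Sum>i\<in>(UNIV :: 'b set). 0)"
    by (intro sum_strict_mono_ex1) (simp, blast, blast)
  moreover have "(\<Sum>i\<in>UNIV. \<Sum>j\<in>UNIV. (p j - p' j) * (purchase i p j - purchase i p' j))
      = (\<Sum>j\<in>UNIV. (p j - p' j) * (spend p j / p j - spend p' j / p' j))"
    by (subst sum.swap) (simp add: sum_subtractf flip: sum_distrib_left sum_purchase)
  moreover have "(p j - p' j) * (spend p j / p j - spend p' j / p' j) = 0" for j
  proof (cases "wanted j")
    case True
    then have "0 < p j" "spend p j = p j" "0 < p' j" "spend p' j = p' j"
      using assms(2,3) unfolding clearing_prices_def by blast+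
    then show ?thesis by simp
  next
    case False
    then have "p j = 0" "p' j = 0" using assms(2,3) unfolding clearing_prices_def by blast+
    then show ?thesis by simp
  qed
  ultimately show False by simp
qed

lemma spend_tendsto:
  assumes lim: "\<And>k. ((\<lambda>n. P n k) \<longlongrightarrow> ps k) F" and pos: "\<And>k. wanted k \<Longrightarrow> 0 < ps k"
  shows "((\<lambda>n. spend (P n) j) \<longlongrightarrow> spend ps j) F"
proof -
  have weight_lim: "((\<lambda>n. c i k * P n k powr \<theta> i) \<longlongrightarrow> c i k * ps k powr \<theta> i) F" for i k
  proof (cases "0 < c i k")
    case True
    then have "0 < ps k" using pos by (auto simp: wanted_def)
    then show ?thesis by (intro tendsto_intros lim) auto
  next
    case False
    then have "c i k = 0" using c_nonneg[of i k] by simp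
    then show ?thesis by simp
  qed
  have "0 < aggregate i ps" for i by (intro aggregate_pos pos) (auto simp: wanted_def)
  then have "aggregate i ps \<noteq> 0" for i by (metis less_irrefl)
  then show ?thesis unfolding spend_def share_def aggregate_def
    by (intro tendsto_sum tendsto_mult tendsto_const tendsto_divide weight_lim) (simp add: aggregate_def)
qed

lemma price_le_spend_if_price_small:
  assumes "0 < c i j" "\<theta> i < 1" "0 < B"
  shows "\<exists>b>0. \<forall>p. (\<forall>k. 0 < p k \<and> p k \<le> B) \<longrightarrow> p j \<le> b \<longrightarrow> p j \<le> spend p j"
proof (intro exI conjI allI impI)
  define K where "K = e i * c i j / aggregate i (\<lambda>_. B)"
  have aggregate_B: "0 < aggregate i (\<lambda>_. B)" using assms(3) by (intro aggregate_pos)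
  then have "0 < K" unfolding K_def using assms(1) e_pos by simp
  then show "0 < K powr (1 / (1 - \<theta> i))" by simp
  fix p assume p: "\<forall>k. 0 < p k \<and> p k \<le> B" and small: "p j \<le> K powr (1 / (1 - \<theta> i))"
  have "0 < p j" using p by blast
  then have "p j = p j powr \<theta> i * p j powr (1 - \<theta> i)" by (simp flip: powr_add)
  also have "\<dots> \<le> p j powr \<theta> i * (K powr (1 / (1 - \<theta> i))) powr (1 - \<theta> i)"
    using p small assms(2) by (intro mult_left_mono powr_mono2) (auto simp: less_imp_le)
  also have "\<dots> = e i * (c i j * p j powr \<theta> i) / aggregate i (\<lambda>_. B)"
    using assms(2) \<open>0 < K\<close> by (simp add: powr_powr) (simp add: K_def)
  also have "\<dots> \<le> e i * (c i j * p j powr \<theta> i) / aggregate i p"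
    using p aggregate_B aggregate_pos[of i p] e_nonneg c_nonneg
    by (intro divide_left_mono aggregate_mono mult_nonneg_nonneg mult_pos_pos) (auto simp: less_imp_le)
  also have "\<dots> = e i * share i p j" by (simp add: share_def)
  also have "\<dots> \<le> spend p j"
    unfolding spend_def using share_nonneg e_nonneg by (intro member_le_sum) auto
  finally show "p j \<le> spend p j" .
qed

end

context tatonnement_run
begin

lemma wanted_price_bounded_below:
  assumes "\<And>i. \<theta> i < 1" "wanted j"
  shows "\<exists>b>0. \<forall>t\<ge>0. b \<le> p t j"
proof -
  obtain i where i: "0 < c i j" using assms(2) by (auto simp: wanted_def)
  obtain B where "0 < B" and B: "\<And>t j. 0 \<le> t \<Longrightarrow> p t j \<le> B" using prices_bounded by metis
  obtain b where "0 < b" and small: "\<And>p. \<lbrakk>\<forall>k. 0 < p k \<and> p k \<le> B; p j \<le> b\<rbrakk> \<Longrightarrow> p j \<le> spend p j"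
    using price_le_spend_if_price_small[OF i assms(1) \<open>0 < B\<close>] by blast
  have "0 \<le> z (p t) j" if "0 \<le> t" "p t j \<le> b" for t
    using small[of "p t"] B p_pos that by (simp add: z_price)
  then have "min (q j 0) (b / 2) \<le> p t j" if "0 \<le> t" for t
    using that by (rule price_ge_if_excess_below)
  then show ?thesis using \<open>0 < b\<close> q_0_pos[of j] by (intro exI[of _ "min (q j 0) (b / 2)"]) auto
qed

lemma limit_along_clearing_prices:
  assumes \<theta>: "\<And>i. \<theta> i < 1" and lim: "limit_along s ps"
  shows "clearing_prices ps"
proof -
  have pos: "0 < ps j" if wanted: "wanted j" for j
  proof -
    obtain b where b: "0 < b" "\<And>t. 0 \<le> t \<Longrightarrow> b \<le> p t j"
      using wanted_price_bounded_below[OF \<theta> wanted] by blast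
    have "eventually (\<lambda>n. b \<le> p (s n) j) sequentially"
      using limit_along_eventually_ge[OF lim, of 0] by eventually_elim (rule b)
    then have "b \<le> ps j" using limit_along_tendsto[OF lim] by (intro tendsto_lowerbound) auto
    then show ?thesis using b by simp
  qed
  have demand_1: "spend ps j / ps j = 1" if "0 < ps j" for j
  proof (rule limit_demand_eq_1[OF lim that z_price])
    fix r assume "limit_along r ps"
    then show "(\<lambda>n. spend (p (r n)) j / p (r n) j) \<longlonglongrightarrow> spend ps j / ps j"
      using that pos by (intro tendsto_divide spend_tendsto limit_along_tendsto) auto
  qed
  have "spend ps j = ps j" if "wanted j" for j using demand_1 pos[OF that] by fastforce
  moreover have "ps j = 0" if "\<not> wanted j" for j
    using demand_1[of j] limit_along_nonneg[OF lim, of j] spend_unwanted[OF that] by fastforce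
  ultimately show ?thesis using pos by (simp add: clearing_prices_def)
qed

theorem prices_tendsto_clearing_prices:
  assumes \<theta>: "\<And>i. \<theta> i < 1"
  shows "\<exists>ps. clearing_prices ps \<and> (\<forall>j. ((\<lambda>t. p t j) \<longlongrightarrow> ps j) at_top)"
proof -
  obtain h ps where "limit_along (real \<circ> h) ps"
    using filterlim_real_sequentially by (rule convergent_subsequence_of_times)
  then have clearing: "clearing_prices ps" by (rule limit_along_clearing_prices[OF \<theta>])
  have "((\<lambda>t. p t j) \<longlongrightarrow> ps j) at_top" for j
  proof (rule tendstoI)
    fix \<eta> :: real assume "0 < \<eta>"
    show "eventually (\<lambda>t. dist (p t j) (ps j) < \<eta>) at_top"
    proof (rule eventually_if_limit_along)
      fix s ps' assume s: "limit_along s ps'"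
      then have "ps' = ps"
        by (intro clearing_prices_unique[OF \<theta>] limit_along_clearing_prices[OF \<theta>] clearing)
      then show "eventually (\<lambda>n. dist (p (s n) j) (ps j) < \<eta>) sequentially"
        using limit_along_tendsto[OF s] \<open>0 < \<eta>\<close> by (intro tendstoD) auto
    qed
  qed
  then show ?thesis using clearing by blast
qed

end

section \<open>Limit points for Leontief utilities\<close>

lemma unit_step_induct [consumes 1, case_names base step]:
  fixes t0 :: real
  assumes "t0 \<le> t" and base: "P t0"
    and step: "\<And>t t'. \<lbrakk>t0 \<le> t; P t; t' \<in> {t..t + 1}\<rbrakk> \<Longrightarrow> P t'"
  shows "P t"
proof -
  have steps: "P t" if "t0 \<le> t" "t \<le> t0 + real m" for m t
    using that
  proof (induction m arbitrary: t)
    case (Suc m)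
    have "P (max t0 (t - 1))" by (rule Suc.IH) (use Suc.prems in auto)
    then show ?case using Suc.prems by (intro step[of "max t0 (t - 1)" t]) auto
  qed (use base in auto)
  obtain m where "t - t0 \<le> real m" using real_arch_simple by blast
  then show ?thesis using assms(1) by (intro steps[of t m]) auto
qed

lemma slowly_varying_tendsto_finite_set_member:
  fixes f :: "real \<Rightarrow> 'a::metric_space"
  assumes "finite V"
    and near: "\<And>\<eta>. 0 < \<eta> \<Longrightarrow> eventually (\<lambda>t. \<exists>v\<in>V. dist (f t) v < \<eta>) at_top"
    and slow: "\<And>\<eta>. 0 < \<eta> \<Longrightarrow> eventually (\<lambda>t. \<forall>t'\<in>{t..t + 1}. dist (f t') (f t) < \<eta>) at_top"
  shows "\<exists>v\<in>V. (f \<longlongrightarrow> v) at_top"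
proof -
  have "uniform_discrete V"
    using assms(1) by (induction rule: finite_induct) (simp_all add: uniform_discrete_insert)
  then obtain d where "0 < d" and uniform: "\<And>v w. \<lbrakk>v \<in> V; w \<in> V; dist v w < d\<rbrakk> \<Longrightarrow> v = w"
    unfolding uniform_discrete_def by blast
  define \<delta> where "\<delta> = d / 3"
  have "0 < \<delta>" and separated: "\<And>v w. \<lbrakk>v \<in> V; w \<in> V; dist v w < 3 * \<delta>\<rbrakk> \<Longrightarrow> v = w"
    using \<open>0 < d\<close> uniform by (auto simp: \<delta>_def)
  from eventually_conj[OF near slow, OF \<open>0 < \<delta>\<close> \<open>0 < \<delta>\<close>] obtain t0
    where t0: "\<And>t. t0 \<le> t \<Longrightarrow> \<exists>v\<in>V. dist (f t) v < \<delta>"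
      "\<And>t t'. \<lbrakk>t0 \<le> t; t' \<in> {t..t + 1}\<rbrakk> \<Longrightarrow> dist (f t') (f t) < \<delta>"
    unfolding eventually_at_top_linorder by blast
  obtain v where v: "v \<in> V" "dist (f t0) v < \<delta>" using t0(1)[of t0] by blast
  have stay: "dist (f t) v < \<delta>" if "t0 \<le> t" for t
    using that
  proof (induction t rule: unit_step_induct)
    case (step t t')
    then obtain w where w: "w \<in> V" "dist (f t') w < \<delta>" using t0(1)[of t'] by auto
    have "dist (f t') (f t) < \<delta>" using step by (intro t0(2)) auto
    then have "dist v w < 3 * \<delta>"
      using step.IH w(2) dist_triangle[of v w "f t"] dist_triangle[of "f t" w "f t'"]
      by (simp add: dist_commute)
    then show ?case using separated[OF v(1) w(1)] w(2) by simp
  qed (rule v(2))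
  have "(f \<longlongrightarrow> v) at_top"
  proof (rule tendstoI)
    fix \<eta> :: real assume "0 < \<eta>"
    then have "eventually (\<lambda>t. \<exists>w\<in>V. dist (f t) w < min \<eta> \<delta>) at_top"
      using \<open>0 < \<delta>\<close> by (intro near) auto
    then show "eventually (\<lambda>t. dist (f t) v < \<eta>) at_top"
      using eventually_ge_at_top[of t0]
    proof eventually_elim
      case (elim t)
      then obtain w where w: "w \<in> V" "dist (f t) w < min \<eta> \<delta>" by blast
      have "dist v w < 3 * \<delta>"
        using stay[OF elim(2)] w(2) dist_triangle[of v w "f t"] \<open>0 < \<delta>\<close> by (simp add: dist_commute)
      then show ?case using separated[OF v(1) w(1)] w(2) by simp
    qed
  qed
  then show ?thesis using v(1) by blast
qed

lemma (in tatonnement_run) price_index_bounded_below: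
  "\<exists>M. \<forall>t\<ge>0. M \<le> price_index i (p t)"
proof -
  obtain B where "0 < B" and B: "\<And>t j. 0 \<le> t \<Longrightarrow> p t j \<le> B" using prices_bounded by metis
  define K where "K = (\<Sum>k\<in>UNIV - {i}. e k * price_index k (\<lambda>_. B))"
  have "(- potential (p 0) - K) / e i \<le> price_index i (p t)" if t: "0 \<le> t" for t
  proof -
    have "(\<Sum>k\<in>UNIV - {i}. e k * price_index k (p t)) \<le> K"
      unfolding K_def using p_pos[OF t] B[OF t]
      by (intro sum_mono mult_left_mono price_index_mono e_nonneg)
    moreover have "0 \<le> (\<Sum>j\<in>UNIV. p t j)"
      using p_pos[OF t] by (intro sum_nonneg) (simp add: less_imp_le)
    moreover have "(\<Sum>k\<in>UNIV. e k * price_index k (p t)) =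
        e i * price_index i (p t) + (\<Sum>k\<in>UNIV - {i}. e k * price_index k (p t))"
      by (rule sum.remove) auto
    ultimately have "- potential (p 0) - K \<le> e i * price_index i (p t)"
      using potential_le_initial[OF t] unfolding potential_def[of "p t"] by linarith
    then show ?thesis using e_pos[of i] by (simp add: pos_divide_le_eq mult.commute)
  qed
  then show ?thesis by blast
qed

locale leontief_market =
  fixes e :: "'b::finite \<Rightarrow> real" and c :: "'b \<Rightarrow> 'g::finite \<Rightarrow> real"
  assumes budget_pos: "0 < e i" and coeff_nonneg: "0 \<le> c i j" and coeff_ex_pos: "\<exists>j. 0 < c i j"
begin

sublocale ces_market e "\<lambda>_. 1" c
  using budget_pos coeff_nonneg coeff_ex_pos by unfold_locales auto

text \<open>Unlike \<open>purchase\<close> and \<open>spend p j / p j\<close>, these expressions remain meaningful at zero prices.\<close>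

definition leontief_bundle :: "'b \<Rightarrow> ('g \<Rightarrow> real) \<Rightarrow> 'g \<Rightarrow> real" where
  "leontief_bundle i p j = e i * c i j / aggregate i p"

definition leontief_demand :: "('g \<Rightarrow> real) \<Rightarrow> 'g \<Rightarrow> real" where
  "leontief_demand p j = (\<Sum>i\<in>UNIV. leontief_bundle i p j)"

lemma aggregate_linear: "(\<And>j. 0 \<le> p j) \<Longrightarrow> aggregate i p = (\<Sum>j\<in>UNIV. c i j * p j)"
  by (simp add: aggregate_def)

lemma leontief_demand_eq_spend:
  assumes "\<And>j. 0 < p j"
  shows "leontief_demand p j = spend p j / p j"
  unfolding leontief_demand_def leontief_bundle_def spend_def share_def sum_divide_distrib
  using assms[of j] by (intro sum.cong) auto

lemma aggregate_tendsto:
  assumes lim: "\<And>k. ((\<lambda>n. P n k) \<longlongrightarrow> ps k) F" and "eventually (\<lambda>n. \<forall>k. 0 \<le> P n k) F" and "\<And>k. 0 \<le> ps k"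
  shows "((\<lambda>n. aggregate i (P n)) \<longlongrightarrow> aggregate i ps) F"
proof -
  have "((\<lambda>n. \<Sum>k\<in>UNIV. c i k * P n k) \<longlongrightarrow> (\<Sum>k\<in>UNIV. c i k * ps k)) F"
    by (intro tendsto_intros lim)
  moreover have "eventually (\<lambda>n. (\<Sum>k\<in>UNIV. c i k * P n k) = aggregate i (P n)) F"
    using assms(2) by eventually_elim (simp add: aggregate_linear)
  ultimately show ?thesis
    unfolding aggregate_linear[of ps, OF assms(3)] by (rule Lim_transform_eventually)
qed

lemma sum_price_diff_mult_leontief_demand_diff:
  assumes p: "\<And>j. 0 \<le> p j" "\<And>i. 0 < aggregate i p" and p': "\<And>j. 0 \<le> p' j" "\<And>i. 0 < aggregate i p'"
  shows "(\<Sum>j\<in>UNIV. (p j - p' j) * (leontief_demand p j - leontief_demand p' j))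
    = - (\<Sum>i\<in>UNIV. e i * ((aggregate i p - aggregate i p')\<^sup>2 / (aggregate i p * aggregate i p')))"
proof -
  define w where "w i = e i * (1 / aggregate i p - 1 / aggregate i p')" for i
  have "(\<Sum>j\<in>UNIV. (p j - p' j) * (leontief_demand p j - leontief_demand p' j))
      = (\<Sum>j\<in>UNIV. \<Sum>i\<in>UNIV. w i * (c i j * p j - c i j * p' j))"
    unfolding leontief_demand_def leontief_bundle_def w_def sum_subtractf[symmetric] sum_distrib_left
    by (intro sum.cong refl) (simp add: divide_inverse algebra_simps)
  also have "\<dots> = (\<Sum>i\<in>UNIV. w i * (aggregate i p - aggregate i p'))"
    unfolding aggregate_linear[of p, OF p(1)] aggregate_linear[of p', OF p'(1)] sum_subtractf[symmetric]
    by (subst sum.swap) (simp add: sum_distrib_left)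
  also have "\<dots>
      = (\<Sum>i\<in>UNIV. - (e i * ((aggregate i p - aggregate i p')\<^sup>2 / (aggregate i p * aggregate i p'))))"
  proof (intro sum.cong refl)
    fix i
    show "w i * (aggregate i p - aggregate i p')
        = - (e i * ((aggregate i p - aggregate i p')\<^sup>2 / (aggregate i p * aggregate i p')))"
      using p(2)[of i] p'(2)[of i] by (simp add: w_def field_simps power2_eq_square)
  qed
  finally show ?thesis by (simp add: sum_negf)
qed

lemma leontief_demand_eq_if_same_support:
  assumes p: "\<And>j. 0 \<le> p j" "\<And>i. 0 < aggregate i p" "\<And>j. 0 < p j \<Longrightarrow> leontief_demand p j = 1"
    and p': "\<And>j. 0 \<le> p' j" "\<And>i. 0 < aggregate i p'" "\<And>j. 0 < p' j \<Longrightarrow> leontief_demand p' j = 1"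
    and support: "\<And>j. 0 < p j \<longleftrightarrow> 0 < p' j"
  shows "leontief_demand p = leontief_demand p'"
proof -
  define D where "D i = e i * ((aggregate i p - aggregate i p')\<^sup>2 / (aggregate i p * aggregate i p'))" for i
  have D_nonneg: "0 \<le> D i" for i
    unfolding D_def using p(2)[of i] p'(2)[of i] e_nonneg[of i] by simp
  have "(p j - p' j) * (leontief_demand p j - leontief_demand p' j) = 0" for j
  proof (cases "0 < p j")
    case True
    then show ?thesis using p(3) p'(3) support[of j] by simp
  next
    case False
    then have "p j = 0" "p' j = 0" using p(1)[of j] p'(1)[of j] support[of j] by auto
    then show ?thesis by simp
  qed
  then have "(\<Sum>j\<in>UNIV. (p j - p' j) * (leontief_demand p j - leontief_demand p' j)) = 0"
    by (intro sum.neutral) blast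
  then have "(\<Sum>i\<in>UNIV. D i) = 0"
    using sum_price_diff_mult_leontief_demand_diff[OF p(1,2) p'(1,2)] by (simp add: D_def)
  then have "D i = 0" for i using D_nonneg sum_nonneg_eq_0_iff[of UNIV D] by simp
  then have "aggregate i p = aggregate i p'" for i
    using p(2)[of i] p'(2)[of i] e_pos[of i] unfolding D_def by (metis less_irrefl divide_eq_0_iff
      eq_iff_diff_eq_0 mult_eq_0_iff power_eq_0_iff)
  then show ?thesis by (simp add: leontief_demand_def leontief_bundle_def fun_eq_iff)
qed

end

locale leontief_run = leontief_market e c + tatonnement_run e "\<lambda>_. 1" c lam z T q p
  for e :: "'b::finite \<Rightarrow> real" and c :: "'b \<Rightarrow> 'g::finite \<Rightarrow> real" and lam z T q p
begin

lemma aggregate_bounded_below: "\<exists>y>0. \<forall>t\<ge>0. y \<le> aggregate i (p t)"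
proof -
  obtain M where M: "\<And>t. 0 \<le> t \<Longrightarrow> M \<le> price_index i (p t)"
    using price_index_bounded_below[of i] by blast
  have "exp M \<le> aggregate i (p t)" if "0 \<le> t" for t
  proof -
    have "0 < aggregate i (p t)" using p_pos[OF that] by (intro aggregate_pos)
    then show ?thesis using M[OF that] by (simp add: price_index_def ln_ge_iff)
  qed
  then show ?thesis by (intro exI[of _ "exp M"]) simp
qed

lemma limit_aggregate:
  assumes lim: "limit_along s ps"
  shows "(\<lambda>n. aggregate i (p (s n))) \<longlonglongrightarrow> aggregate i ps" "0 < aggregate i ps"
proof -
  show aggregate_lim: "(\<lambda>n. aggregate i (p (s n))) \<longlonglongrightarrow> aggregate i ps"
  proof (rule aggregate_tendsto)
    show "eventually (\<lambda>n. \<forall>k. 0 \<le> p (s n) k) sequentially"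
      using limit_along_eventually_ge[OF lim, of 0] by eventually_elim (simp add: p_pos less_imp_le)
  qed (rule limit_along_tendsto[OF lim] limit_along_nonneg[OF lim])+
  obtain y where y: "0 < y" "\<And>t. 0 \<le> t \<Longrightarrow> y \<le> aggregate i (p t)"
    using aggregate_bounded_below[of i] by blast
  have "eventually (\<lambda>n. y \<le> aggregate i (p (s n))) sequentially"
    using limit_along_eventually_ge[OF lim, of 0] by eventually_elim (rule y)
  then have "y \<le> aggregate i ps" using aggregate_lim by (intro tendsto_lowerbound) auto
  then show "0 < aggregate i ps" using y by simp
qed

lemma limit_leontief_demand:
  assumes lim: "limit_along s ps"
  shows "(\<lambda>n. leontief_demand (p (s n)) j) \<longlonglongrightarrow> leontief_demand ps j"
  unfolding leontief_demand_def leontief_bundle_def using limit_aggregate[OF lim]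
  by (intro tendsto_intros) (auto simp: less_imp_neq[symmetric])

lemma z_eq_leontief_demand: "0 \<le> t \<Longrightarrow> z (p t) j = leontief_demand (p t) j - 1"
  by (simp add: z_price leontief_demand_eq_spend p_pos)

lemma limit_leontief_demand_eq_1:
  assumes "limit_along s ps" "0 < ps j"
  shows "leontief_demand ps j = 1"
  using assms z_eq_leontief_demand limit_leontief_demand by (rule limit_demand_eq_1)

lemma finite_limit_demands: "finite {leontief_demand ps j |ps s. limit_along s ps}"
proof -
  define supp where "supp ps = {j. 0 < ps j}" for ps :: "'g \<Rightarrow> real"
  define limits where "limits = {ps. \<exists>s. limit_along s ps}"
  have demand_eq: "leontief_demand ps = leontief_demand ps'"
    if limits: "ps \<in> limits" "ps' \<in> limits" and supp: "supp ps = supp ps'" for ps ps'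
  proof -
    obtain s s' where s: "limit_along s ps" and s': "limit_along s' ps'"
      using limits by (auto simp: limits_def)
    have "0 < ps j \<longleftrightarrow> 0 < ps' j" for j using supp by (auto simp: supp_def)
    then show ?thesis
      using limit_along_nonneg limit_aggregate(2) limit_leontief_demand_eq_1 s s'
      by (intro leontief_demand_eq_if_same_support) blast+
  qed
  have "{leontief_demand ps j |ps s. limit_along s ps}
      \<subseteq> (\<lambda>S. leontief_demand (inv_into limits supp S) j) ` UNIV"
  proof clarify
    fix ps s assume "limit_along s ps"
    then have ps: "ps \<in> limits" by (auto simp: limits_def)
    then have "leontief_demand ps = leontief_demand (inv_into limits supp (supp ps))"
      by (intro demand_eq) (auto simp: inv_into_into f_inv_into_f)
    then show "leontief_demand ps j \<in> (\<lambda>S. leontief_demand (inv_into limits supp S) j) ` UNIV"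
      by simp
  qed
  then show ?thesis by (rule finite_subset) simp
qed

lemma leontief_demand_slowly_varying:
  assumes "0 < \<eta>"
  shows "eventually (\<lambda>t. \<forall>t'\<in>{t..t + 1}.
    dist (leontief_demand (p t') j) (leontief_demand (p t) j) < \<eta>) at_top"
proof (rule eventually_if_limit_along)
  fix s ps assume s: "limit_along s ps"
  have "eventually (\<lambda>n. dist (leontief_demand (p (r n)) j) (leontief_demand ps j) < \<eta> / 2) sequentially"
    if "limit_along r ps" for r
    using limit_leontief_demand[OF that] assms by (intro tendstoD) auto
  then have "eventually (\<lambda>n. \<forall>t\<in>{s n..s n + 1}.
      dist (leontief_demand (p t) j) (leontief_demand ps j) < \<eta> / 2) sequentially"
    by (intro eventually_on_interval_if_limit_along[OF s]) auto
  then show "eventually (\<lambda>n. \<forall>t'\<in>{s n..s n + 1}.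
      dist (leontief_demand (p t') j) (leontief_demand (p (s n)) j) < \<eta>) sequentially"
  proof eventually_elim
    case (elim n)
    show ?case
    proof
      fix t' assume "t' \<in> {s n..s n + 1}"
      with elim have "dist (leontief_demand (p t') j) (leontief_demand ps j) < \<eta> / 2"
        "dist (leontief_demand (p (s n)) j) (leontief_demand ps j) < \<eta> / 2" by auto
      then show "dist (leontief_demand (p t') j) (leontief_demand (p (s n)) j) < \<eta>"
        by (rule dist_triangle_half_l)
    qed
  qed
qed

lemma leontief_demand_tendsto:
  "\<exists>v. ((\<lambda>t. leontief_demand (p t) j) \<longlongrightarrow> v) at_top"
proof -
  have "eventually (\<lambda>t. \<exists>v\<in>{leontief_demand ps j |ps s. limit_along s ps}.
      dist (leontief_demand (p t) j) v < \<eta>) at_top" if "0 < \<eta>" for \<eta>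
  proof (rule eventually_if_limit_along)
    fix s ps assume s: "limit_along s ps"
    have "eventually (\<lambda>n. dist (leontief_demand (p (s n)) j) (leontief_demand ps j) < \<eta>) sequentially"
      using limit_leontief_demand[OF s] \<open>0 < \<eta>\<close> by (rule tendstoD)
    then show "eventually (\<lambda>n. \<exists>v\<in>{leontief_demand ps j |ps s. limit_along s ps}.
        dist (leontief_demand (p (s n)) j) v < \<eta>) sequentially"
      by eventually_elim (use s in blast)
  qed
  from slowly_varying_tendsto_finite_set_member[OF finite_limit_demands this leontief_demand_slowly_varying]
  show ?thesis by blast
qed

lemma limit_leontief_demand_le_1:
  assumes lim: "limit_along s ps"
  shows "leontief_demand ps j \<le> 1"
proof (rule ccontr)
  define \<epsilon> where "\<epsilon> = (leontief_demand ps j - 1) / 2"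
  assume "\<not> leontief_demand ps j \<le> 1"
  then have \<epsilon>: "0 < \<epsilon>" "1 + \<epsilon> < leontief_demand ps j" by (simp_all add: \<epsilon>_def field_simps)
  obtain v where v: "((\<lambda>t. leontief_demand (p t) j) \<longlongrightarrow> v) at_top"
    using leontief_demand_tendsto by blast
  then have "(\<lambda>n. leontief_demand (p (s n)) j) \<longlonglongrightarrow> v"
    by (rule filterlim_compose) (use lim in \<open>simp add: limit_along_def\<close>)
  then have "v = leontief_demand ps j" using limit_leontief_demand[OF lim] by (rule LIMSEQ_unique)
  then have "eventually (\<lambda>t. 1 + \<epsilon> < leontief_demand (p t) j) at_top"
    using v \<epsilon>(2) by (intro order_tendstoD(1)) auto
  then have "eventually (\<lambda>t. \<epsilon> \<le> z (p t) j) at_top"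
    using eventually_ge_at_top[of 0] by eventually_elim (simp add: z_eq_leontief_demand)
  then show False using no_permanent_excess_demand[OF \<epsilon>(1)] by blast
qed

end

section \<open>Utility maximization\<close>

lemma bundle_eq_if_ge_and_cost_le:
  fixes p x y :: "'g::finite \<Rightarrow> real"
  assumes p: "\<And>j. 0 < p j" and ge: "\<And>j. x j \<le> y j"
    and cost: "(\<Sum>j\<in>UNIV. p j * y j) \<le> (\<Sum>j\<in>UNIV. p j * x j)"
  shows "y = x"
proof
  fix j
  have nonneg: "0 \<le> p j * (y j - x j)" for j using p ge by (simp add: less_imp_le)
  have "(\<Sum>j\<in>UNIV. p j * (y j - x j)) \<le> 0" using cost by (simp add: right_diff_distrib sum_subtractf)
  then have "(\<Sum>j\<in>UNIV. p j * (y j - x j)) = 0" using nonneg by (intro order.antisym sum_nonneg) auto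
  then have "p j * (y j - x j) = 0"
    using nonneg sum_nonneg_eq_0_iff[of UNIV "\<lambda>j. p j * (y j - x j)"] by simp
  then show "y j = x j" using p[of j] by simp
qed

lemma market_equilibriumI:
  assumes "\<And>j. 0 \<le> p j" "\<And>i. X i \<in> demand_set (u i) (e i) p"
    and "\<And>j. 0 < p j \<Longrightarrow> (\<Sum>i\<in>UNIV. X i j) = 1" "\<And>j. p j = 0 \<Longrightarrow> (\<Sum>i\<in>UNIV. X i j) \<le> 1"
  shows "market_equilibrium u e p"
  unfolding market_equilibrium_def using assms by (intro conjI allI exI[of _ X]) simp_all

subsection \<open>CES utilities\<close>

lemma ces_utility_cong:
  assumes "\<And>j. 0 < a j \<Longrightarrow> x j = y j"
  shows "ces_utility a \<rho> x = ces_utility a \<rho> y"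
proof -
  have "(\<exists>j. 0 < a j \<and> x j = 0) \<longleftrightarrow> (\<exists>j. 0 < a j \<and> y j = 0)" using assms by metis
  moreover have "(\<Prod>j\<in>{j. 0 < a j}. x j powr (a j / (\<Sum>k\<in>UNIV. a k)))
      = (\<Prod>j\<in>{j. 0 < a j}. y j powr (a j / (\<Sum>k\<in>UNIV. a k)))"
    using assms by (intro prod.cong) auto
  moreover have "(\<Sum>j\<in>{j. 0 < a j}. a j * x j powr \<rho>) = (\<Sum>j\<in>{j. 0 < a j}. a j * y j powr \<rho>)"
    using assms by (intro sum.cong) auto
  ultimately show ?thesis unfolding ces_utility_def by (simp only:)
qed

lemma ces_utility_eq_0:
  assumes "0 < a j" "x j = 0"
  shows "ces_utility a \<rho> x = 0"
  using assms by (auto simp: ces_utility_def intro!: prod_zero)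

lemma ces_utility_0_eq_exp:
  assumes a: "\<And>j. 0 \<le> a j" and x: "\<And>j. 0 < a j \<Longrightarrow> 0 < x j"
  shows "ces_utility a 0 x = exp (\<Sum>j\<in>UNIV. a j / (\<Sum>k\<in>UNIV. a k) * ln (x j))"
proof -
  have "ces_utility a 0 x = (\<Prod>j\<in>{j. 0 < a j}. exp (a j / (\<Sum>k\<in>UNIV. a k) * ln (x j)))"
    unfolding ces_utility_def using x by (force intro!: prod.cong simp: powr_def)
  also have "\<dots> = exp (\<Sum>j\<in>{j. 0 < a j}. a j / (\<Sum>k\<in>UNIV. a k) * ln (x j))" by (simp add: exp_sum)
  also have "(\<Sum>j\<in>{j. 0 < a j}. a j / (\<Sum>k\<in>UNIV. a k) * ln (x j))
      = (\<Sum>j\<in>UNIV. a j / (\<Sum>k\<in>UNIV. a k) * ln (x j))"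
    using a by (intro sum.mono_neutral_left) (auto simp: not_less order.antisym)
  finally show ?thesis .
qed

lemma ces_utility_eq_powr_sum:
  assumes a: "\<And>j. 0 \<le> a j" and x: "\<And>j. 0 < a j \<Longrightarrow> 0 < x j" and "\<rho> \<noteq> 0"
  shows "ces_utility a \<rho> x = (\<Sum>j\<in>UNIV. a j * x j powr \<rho>) powr (1 / \<rho>)"
proof -
  have "(\<Sum>j\<in>{j. 0 < a j}. a j * x j powr \<rho>) = (\<Sum>j\<in>UNIV. a j * x j powr \<rho>)"
    using a by (intro sum.mono_neutral_left) (auto simp: not_less order.antisym)
  moreover have "\<not> (\<exists>j. 0 < a j \<and> x j = 0)" using x by force
  ultimately show ?thesis using assms(3) unfolding ces_utility_def by (simp only: if_False)
qed

definition ces_weight :: "('g::finite \<Rightarrow> real) \<Rightarrow> real \<Rightarrow> ('g \<Rightarrow> real) \<Rightarrow> 'g \<Rightarrow> real" where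
  "ces_weight a \<rho> x j = a j * x j powr \<rho> / (\<Sum>k\<in>UNIV. a k * x k powr \<rho>)"

lemma ces_weight_denominator_pos:
  fixes a x :: "'g::finite \<Rightarrow> real"
  assumes "\<And>j. 0 \<le> a j" "\<exists>j. 0 < a j" "\<And>j. 0 < a j \<Longrightarrow> 0 < x j"
  shows "0 < (\<Sum>k\<in>UNIV. a k * x k powr \<rho>)"
proof -
  obtain k where "0 < a k" using assms(2) by blast
  then show ?thesis using assms(1) assms(3)[of k] by (intro sum_pos2[of _ k]) auto
qed

lemma ces_utility_pos:
  assumes "\<And>j. 0 \<le> a j" "\<exists>j. 0 < a j" "\<And>j. 0 < a j \<Longrightarrow> 0 < x j"
  shows "0 < ces_utility a \<rho> x"
proof (cases "\<rho> = 0")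
  case True
  then show ?thesis using assms(1,3) by (simp add: ces_utility_0_eq_exp)
next
  case False
  then show ?thesis
    using ces_weight_denominator_pos[of a x \<rho>, OF assms] assms(1,3)
    by (simp add: ces_utility_eq_powr_sum less_imp_neq[symmetric])
qed

lemma ces_weight_nonneg: "(\<And>j. 0 \<le> a j) \<Longrightarrow> 0 \<le> ces_weight a \<rho> x j"
  unfolding ces_weight_def by (intro divide_nonneg_nonneg sum_nonneg mult_nonneg_nonneg) auto

lemma ces_weight_pos_iff:
  assumes "\<And>j. 0 \<le> a j" "\<exists>j. 0 < a j" "\<And>j. 0 < a j \<Longrightarrow> 0 < x j"
  shows "0 < ces_weight a \<rho> x j \<longleftrightarrow> 0 < a j"
  using ces_weight_denominator_pos[of a x \<rho>, OF assms] assms(1,3)[of j]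
  by (cases "a j = 0") (auto simp: ces_weight_def)

lemma ces_utility_mult_pos:
  assumes a: "\<And>j. 0 \<le> a j" "\<exists>j. 0 < a j" and x: "\<And>j. 0 < a j \<Longrightarrow> 0 < x j"
    and t_pos: "\<And>j. 0 < a j \<Longrightarrow> 0 < t j"
  shows "ces_utility a \<rho> (\<lambda>j. x j * t j) = ces_utility a \<rho> x * ces_utility (ces_weight a \<rho> x) \<rho> t"
proof -
  define A w where "A = (\<Sum>k\<in>UNIV. a k * x k powr \<rho>)" and "w = ces_weight a \<rho> x"
  have A_pos: "0 < A" unfolding A_def by (rule ces_weight_denominator_pos[OF a x])
  have w_eq: "w j = a j * x j powr \<rho> / A" for j by (simp add: w_def ces_weight_def A_def)
  have w: "0 \<le> w j" "0 < w j \<longleftrightarrow> 0 < a j" for j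
    unfolding w_def by (rule ces_weight_nonneg[OF a(1)] ces_weight_pos_iff[OF a x])+
  have "ces_utility a \<rho> (\<lambda>j. x j * t j) = ces_utility a \<rho> x * ces_utility w \<rho> t"
  proof (cases "\<rho> = 0")
    case True
    have weight_eq: "a j * x j powr \<rho> = a j" for j
      using x[of j] a(1)[of j] True by (cases "a j = 0") auto
    have sum_a: "(\<Sum>k\<in>UNIV. a k) = A" and w_eq_a: "w j = a j / A" for j
      unfolding A_def w_eq weight_eq by (rule refl)+
    have sum_w: "(\<Sum>k\<in>UNIV. w k) = 1"
      unfolding w_eq_a sum_divide_distrib[symmetric] sum_a using A_pos by simp
    have "a j / A * ln (x j * t j) = a j / A * ln (x j) + w j * ln (t j)" for j
      using x[of j] t_pos[of j] a(1)[of j]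
      by (cases "a j = 0") (auto simp: w_eq_a ln_mult distrib_left)
    moreover have "ces_utility w 0 t = exp (\<Sum>j\<in>UNIV. w j * ln (t j))"
      using ces_utility_0_eq_exp[of w t] w t_pos by (simp add: sum_w)
    ultimately show ?thesis
      using True a(1) x t_pos by (simp add: ces_utility_0_eq_exp sum_a sum.distrib exp_add)
  next
    case False
    have term_eq: "a j * (x j * t j) powr \<rho> = A * (w j * t j powr \<rho>)" for j
      using A_pos by (simp add: w_eq powr_mult)
    have "ces_utility a \<rho> (\<lambda>j. x j * t j) = (A * (\<Sum>j\<in>UNIV. w j * t j powr \<rho>)) powr (1 / \<rho>)"
      unfolding sum_distrib_left term_eq[symmetric]
      by (rule ces_utility_eq_powr_sum) (use False a(1) x t_pos in auto)
    also have "\<dots> = A powr (1 / \<rho>) * (\<Sum>j\<in>UNIV. w j * t j powr \<rho>) powr (1 / \<rho>)"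
      by (rule powr_mult)
    also have "\<dots> = ces_utility a \<rho> x * ces_utility w \<rho> t"
      using ces_utility_eq_powr_sum[of a x \<rho>] ces_utility_eq_powr_sum[of w t \<rho>] False a(1) x t_pos w
      by (simp add: A_def)
    finally show ?thesis .
  qed
  then show ?thesis by (simp add: w_def)
qed

lemma ces_utility_mult:
  assumes a: "\<And>j. 0 \<le> a j" "\<exists>j. 0 < a j" and x: "\<And>j. 0 < a j \<Longrightarrow> 0 < x j" and t: "\<And>j. 0 \<le> t j"
  shows "ces_utility a \<rho> (\<lambda>j. x j * t j) = ces_utility a \<rho> x * ces_utility (ces_weight a \<rho> x) \<rho> t"
proof (cases "\<exists>j. 0 < a j \<and> t j = 0")
  case True
  then obtain j where j: "0 < a j" "t j = 0" by blast
  then have "0 < ces_weight a \<rho> x j" by (simp add: ces_weight_pos_iff a x)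
  then show ?thesis
    using j ces_utility_eq_0[of a j "\<lambda>j. x j * t j"] ces_utility_eq_0[of "ces_weight a \<rho> x" j t]
    by simp
next
  case False
  then have "0 < t j" if "0 < a j" for j using t[of j] that by (auto simp: less_le)
  then show ?thesis by (intro ces_utility_mult_pos a x)
qed

lemma ces_utility_le_1_if_ln_mean_le_0:
  assumes w: "\<And>j. 0 \<le> w j" "(\<Sum>j\<in>UNIV. w j) = 1" and t: "\<And>j. 0 < w j \<Longrightarrow> 0 < t j" and \<rho>: "\<rho> \<le> 0"
  defines "H \<equiv> (\<Sum>j\<in>UNIV. w j * ln (t j))"
  shows "H \<le> 0 \<Longrightarrow> ces_utility w \<rho> t \<le> 1" and "H < 0 \<Longrightarrow> ces_utility w \<rho> t < 1"
proof -
  have "(H \<le> 0 \<longrightarrow> ces_utility w \<rho> t \<le> 1) \<and> (H < 0 \<longrightarrow> ces_utility w \<rho> t < 1)"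
  proof (cases "\<rho> = 0")
    case True
    then have "ces_utility w \<rho> t = exp H" using w t by (simp add: ces_utility_0_eq_exp H_def)
    then show ?thesis by simp
  next
    case False
    define M where "M = (\<Sum>j\<in>UNIV. w j * t j powr \<rho>)"
    have "w j * (1 + \<rho> * ln (t j)) \<le> w j * t j powr \<rho>" for j
      using w(1)[of j] t[of j] exp_ge_add_one_self[of "\<rho> * ln (t j)"]
      by (cases "w j = 0") (auto simp: powr_def intro!: mult_left_mono)
    then have "(\<Sum>j\<in>UNIV. w j * (1 + \<rho> * ln (t j))) \<le> M" unfolding M_def by (intro sum_mono)
    moreover have "(\<Sum>j\<in>UNIV. w j * (1 + \<rho> * ln (t j))) = 1 + \<rho> * H"
      unfolding H_def by (simp add: distrib_left sum.distrib w(2) sum_distrib_left mult_ac)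
    ultimately have M: "1 + \<rho> * H \<le> M" by simp
    have u: "ces_utility w \<rho> t = M powr (1 / \<rho>)"
      unfolding M_def using w(1) t False by (rule ces_utility_eq_powr_sum)
    show ?thesis
    proof (intro conjI impI)
      assume "H \<le> 0"
      then have "1 \<le> M" using M \<rho> mult_nonpos_nonpos[of \<rho> H] by linarith
      then show "ces_utility w \<rho> t \<le> 1" unfolding u using powr_mono2'[of "1 / \<rho>" 1 M] \<rho> by simp
    next
      assume "H < 0"
      then have "1 < M" using M \<rho> False mult_neg_neg[of \<rho> H] by linarith
      then show "ces_utility w \<rho> t < 1"
        unfolding u using powr_less_mono2_neg[of "1 / \<rho>" 1 M] \<rho> False by simp
    qed
  qed
  then show "H \<le> 0 \<Longrightarrow> ces_utility w \<rho> t \<le> 1" "H < 0 \<Longrightarrow> ces_utility w \<rho> t < 1" by auto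
qed

text \<open>For weights of sum \<open>1\<close>, \<open>ces_utility w \<rho> t\<close> is a power mean of order \<open>\<rho> \<le> 0\<close>, which does not exceed
  the geometric and hence the arithmetic mean.\<close>

lemma ces_utility_le_1_if_mean_le_1:
  assumes w: "\<And>j. 0 \<le> w j" "(\<Sum>j\<in>UNIV. w j) = 1" and t: "\<And>j. 0 \<le> t j"
    and mean: "(\<Sum>j\<in>UNIV. w j * t j) \<le> 1" and \<rho>: "\<rho> \<le> 0"
  shows "ces_utility w \<rho> t \<le> 1" and "\<lbrakk>0 < w k; t k \<noteq> 1\<rbrakk> \<Longrightarrow> ces_utility w \<rho> t < 1"
proof -
  have "ces_utility w \<rho> t \<le> 1 \<and> (\<forall>k. 0 < w k \<longrightarrow> t k \<noteq> 1 \<longrightarrow> ces_utility w \<rho> t < 1)"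
  proof (cases "\<exists>j. 0 < w j \<and> t j = 0")
    case True
    then show ?thesis using ces_utility_eq_0[of w _ t \<rho>] by force
  next
    case False
    then have t_pos: "0 < t j" if "0 < w j" for j using t[of j] that by (auto simp: less_le)
    have weak: "w j * ln (t j) \<le> w j * (t j - 1)" for j
      using w(1)[of j] t_pos[of j]
      by (cases "w j = 0") (auto intro!: mult_left_mono ln_le_minus_one)
    have strict: "w k * ln (t k) < w k * (t k - 1)" if "0 < w k" "t k \<noteq> 1" for k
      using t_pos[OF that(1)] that ln_le_minus_one[of "t k"] ln_eq_minus_one[of "t k"] by force
    have sum_le: "(\<Sum>j\<in>UNIV. w j * (t j - 1)) \<le> 0"
      using mean w(2) by (simp add: right_diff_distrib sum_subtractf)
    note ln_mean = ces_utility_le_1_if_ln_mean_le_0[of w t \<rho>, OF w t_pos \<rho>]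
    have "(\<Sum>j\<in>UNIV. w j * ln (t j)) \<le> 0"
      by (rule order.trans[OF sum_mono sum_le]) (rule weak)
    moreover have "(\<Sum>j\<in>UNIV. w j * ln (t j)) < 0" if "0 < w k" "t k \<noteq> 1" for k
      by (rule less_le_trans[OF sum_strict_mono_ex1 sum_le]) (use weak strict[OF that] in auto)
    ultimately show ?thesis using ln_mean by blast
  qed
  then show "ces_utility w \<rho> t \<le> 1" "\<lbrakk>0 < w k; t k \<noteq> 1\<rbrakk> \<Longrightarrow> ces_utility w \<rho> t < 1" by auto
qed

locale ces_buyers =
  fixes e :: "'b::finite \<Rightarrow> real" and a :: "'b \<Rightarrow> 'g::finite \<Rightarrow> real" and \<rho> :: "'b \<Rightarrow> real"
  assumes budget_pos: "0 < e i" and rho_nonpos: "\<rho> i \<le> 0"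
    and a_nonneg: "0 \<le> a i j" and a_ex_pos: "\<exists>j. 0 < a i j"
begin

definition \<sigma> :: "'b \<Rightarrow> real" where
  "\<sigma> i = 1 / (1 - \<rho> i)"

lemma sigma_bounds: "0 < \<sigma> i" "\<sigma> i \<le> 1"
  using rho_nonpos[of i] by (auto simp: \<sigma>_def)

definition weight :: "'b \<Rightarrow> 'g \<Rightarrow> real" where
  "weight i j = a i j powr \<sigma> i"

lemma weight_pos_iff: "0 < weight i j \<longleftrightarrow> 0 < a i j"
  using a_nonneg[of i j] by (auto simp: weight_def)

sublocale ces_market e "\<lambda>i. 1 - \<sigma> i" weight
proof
  show "0 \<le> weight i j" for i j by (simp add: weight_def)
qed (use budget_pos a_ex_pos sigma_bounds in \<open>auto simp: weight_pos_iff less_imp_le\<close>)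

lemma purchase_pos:
  assumes "\<And>j. 0 < a i j \<Longrightarrow> 0 < p j" "0 < a i j"
  shows "0 < purchase i p j"
  using share_pos[of i p j] assms e_pos[of i] by (simp add: purchase_def weight_pos_iff)

lemma purchase_eq_0: "\<not> 0 < a i j \<Longrightarrow> purchase i p j = 0"
  by (simp add: purchase_def share_eq_0 weight_pos_iff)

lemma ces_weight_purchase:
  assumes p: "\<And>j. 0 < a i j \<Longrightarrow> 0 < p j"
  shows "ces_weight (a i) (\<rho> i) (purchase i p) = share i p"
proof -
  define K where "K = (e i / aggregate i p) powr \<rho> i"
  have "0 < aggregate i p" using p by (intro aggregate_pos) (simp add: weight_pos_iff)
  then have K_pos: "0 < K" using e_pos[of i] by (simp add: K_def)
  have first_order: "a i j * purchase i p j powr \<rho> i = K * (weight i j * p j powr (1 - \<sigma> i))" for j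
  proof (cases "0 < a i j")
    case True
    have \<sigma>\<rho>: "1 + \<sigma> i * \<rho> i = \<sigma> i" using rho_nonpos[of i] by (simp add: \<sigma>_def field_simps)
    have "purchase i p j = (e i / aggregate i p) * (a i j / p j) powr \<sigma> i"
      using True p[OF True] by (simp add: purchase_def share_def weight_def powr_diff powr_divide)
    then have "purchase i p j powr \<rho> i = K * (a i j / p j) powr (\<sigma> i * \<rho> i)"
      by (simp only: K_def powr_mult powr_powr)
    then have "a i j * purchase i p j powr \<rho> i
        = K * (a i j powr (1 + \<sigma> i * \<rho> i) * p j powr (- (\<sigma> i * \<rho> i)))"
      using True p[OF True] by (simp add: powr_divide powr_add powr_minus_divide)
    also have "- (\<sigma> i * \<rho> i) = 1 - \<sigma> i" using \<sigma>\<rho> by linarith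
    finally show ?thesis unfolding \<sigma>\<rho> weight_def .
  qed (use a_nonneg[of i j] in \<open>simp add: weight_def\<close>)
  show ?thesis
    using K_pos
    by (simp add: fun_eq_iff ces_weight_def first_order share_def aggregate_def flip: sum_distrib_left)
qed

lemma sum_share_mult_bundle_ratio:
  assumes p: "\<And>j. 0 < a i j \<Longrightarrow> 0 < p j"
  shows "(\<Sum>j\<in>UNIV. share i p j * (y j / purchase i p j)) = (\<Sum>j\<in>{j. 0 < a i j}. p j * y j) / e i"
proof -
  have "share i p j * (y j / purchase i p j) = p j * y j / e i" if "0 < a i j" for j
  proof -
    have "share i p j = p j * purchase i p j / e i"
      using p[OF that] e_pos[of i] by (simp add: purchase_def)
    then show ?thesis using purchase_pos[of i p j] p that by simp
  qed
  moreover have "share i p j * (y j / purchase i p j) = 0" if "\<not> 0 < a i j" for j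
    using that by (simp add: share_eq_0 weight_pos_iff)
  ultimately show ?thesis
    unfolding sum_divide_distrib by (intro sum.mono_neutral_cong_right) auto
qed

lemma utility_le_utility_purchase:
  assumes p: "\<And>j. 0 < a i j \<Longrightarrow> 0 < p j" and y: "\<And>j. 0 \<le> y j"
    and cost: "(\<Sum>j\<in>{j. 0 < a i j}. p j * y j) \<le> e i"
  shows "ces_utility (a i) (\<rho> i) y \<le> ces_utility (a i) (\<rho> i) (purchase i p)"
    and "\<lbrakk>ces_utility (a i) (\<rho> i) (purchase i p) \<le> ces_utility (a i) (\<rho> i) y; 0 < a i k\<rbrakk>
      \<Longrightarrow> y k = purchase i p k"
proof -
  define t where "t j = y j / purchase i p j" for j
  have x_pos: "0 < purchase i p j" if "0 < a i j" for j using p that by (rule purchase_pos)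
  have t_nonneg: "0 \<le> t j" for j
    using y[of j] x_pos[of j] purchase_eq_0[of i j p] by (cases "0 < a i j") (auto simp: t_def)
  have mean: "(\<Sum>j\<in>UNIV. share i p j * t j) \<le> 1"
    using sum_share_mult_bundle_ratio[of i p y, OF p] cost e_pos[of i] by (simp add: t_def)
  have sum_share_1: "(\<Sum>j\<in>UNIV. share i p j) = 1" by (rule sum_share) (simp add: p weight_pos_iff)
  have weight_eq_share: "ces_weight (a i) (\<rho> i) (purchase i p) = share i p"
    by (rule ces_weight_purchase[OF p])
  have "ces_utility (a i) (\<rho> i) y = ces_utility (a i) (\<rho> i) (\<lambda>j. purchase i p j * t j)"
    by (rule ces_utility_cong) (use x_pos in \<open>force simp: t_def\<close>)
  also have "\<dots> = ces_utility (a i) (\<rho> i) (purchase i p) * ces_utility (share i p) (\<rho> i) t"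
    unfolding weight_eq_share[symmetric]
    by (intro ces_utility_mult a_nonneg a_ex_pos x_pos t_nonneg)
  finally have factor: "ces_utility (a i) (\<rho> i) y
      = ces_utility (a i) (\<rho> i) (purchase i p) * ces_utility (share i p) (\<rho> i) t" .
  have u_pos: "0 < ces_utility (a i) (\<rho> i) (purchase i p)"
    using a_nonneg a_ex_pos x_pos by (rule ces_utility_pos)
  note power_mean = ces_utility_le_1_if_mean_le_1[OF share_nonneg sum_share_1 t_nonneg mean rho_nonpos]
  show "ces_utility (a i) (\<rho> i) y \<le> ces_utility (a i) (\<rho> i) (purchase i p)"
    unfolding factor using u_pos power_mean(1) by (intro mult_left_le) auto
  show "y k = purchase i p k"
    if opt: "ces_utility (a i) (\<rho> i) (purchase i p) \<le> ces_utility (a i) (\<rho> i) y" and k: "0 < a i k"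
  proof (rule ccontr)
    assume "y k \<noteq> purchase i p k"
    then have "ces_utility (share i p) (\<rho> i) t < 1"
      using x_pos[OF k] share_pos[of i p k] k p
      by (intro power_mean(2)) (auto simp: t_def weight_pos_iff)
    then show False using opt u_pos unfolding factor by simp
  qed
qed

lemma purchase_in_demand_set:
  assumes p: "\<And>j. 0 < a i j \<Longrightarrow> 0 < p j" and p_nonneg: "\<And>j. 0 \<le> p j"
  shows "purchase i p \<in> demand_set (ces_utility (a i) (\<rho> i)) (e i) p"
proof -
  have "0 \<le> purchase i p j" for j
    using p_nonneg share_nonneg e_nonneg by (simp add: purchase_def)
  moreover have "(\<Sum>j\<in>UNIV. p j * purchase i p j) \<le> e i"
    using cost_purchase[of i p] p by (simp add: weight_pos_iff)
  moreover have "ces_utility (a i) (\<rho> i) y \<le> ces_utility (a i) (\<rho> i) (purchase i p)"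
    if y: "\<And>j. 0 \<le> y j" "(\<Sum>j\<in>UNIV. p j * y j) \<le> e i" for y
  proof (rule utility_le_utility_purchase(1)[OF p y(1)])
    have "(\<Sum>j\<in>{j. 0 < a i j}. p j * y j) \<le> (\<Sum>j\<in>UNIV. p j * y j)"
      using y p_nonneg by (intro sum_mono2) auto
    then show "(\<Sum>j\<in>{j. 0 < a i j}. p j * y j) \<le> e i" using y(2) by simp
  qed
  ultimately show ?thesis by (simp add: demand_set_def)
qed

lemma demand_set_imp_eq_purchase:
  assumes y: "y \<in> demand_set (ces_utility (a i) (\<rho> i)) (e i) p" and p: "\<And>j. 0 < p j"
  shows "y = purchase i p"
proof (rule bundle_eq_if_ge_and_cost_le[OF p])
  have x: "purchase i p \<in> demand_set (ces_utility (a i) (\<rho> i)) (e i) p"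
    using p by (intro purchase_in_demand_set) (auto simp: less_imp_le)
  have y_nonneg: "0 \<le> y j" and y_cost: "(\<Sum>j\<in>UNIV. p j * y j) \<le> e i" for j
    using y by (auto simp: demand_set_def)
  have "(\<Sum>j\<in>{j. 0 < a i j}. p j * y j) \<le> (\<Sum>j\<in>UNIV. p j * y j)"
    using y_nonneg p by (intro sum_mono2) (auto simp: less_imp_le)
  then have "y j = purchase i p j" if "0 < a i j" for j
    using x y that y_cost p y_nonneg
    by (intro utility_le_utility_purchase(2)) (auto simp: demand_set_def)
  then show "purchase i p j \<le> y j" for j
    using y_nonneg[of j] purchase_eq_0[of i j p] by (cases "0 < a i j") auto
  show "(\<Sum>j\<in>UNIV. p j * y j) \<le> (\<Sum>j\<in>UNIV. p j * purchase i p j)"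
    using y_cost cost_purchase[of i p] p by simp
qed

lemma clearing_prices_imp_market_equilibrium:
  assumes "clearing_prices ps"
  shows "market_equilibrium (\<lambda>i. ces_utility (a i) (\<rho> i)) e ps"
proof (rule market_equilibriumI)
  have wanted: "0 < ps j" "spend ps j = ps j" if "wanted j" for j
    using assms that by (auto simp: clearing_prices_def)
  have unwanted: "ps j = 0" if "\<not> wanted j" for j
    using assms that by (auto simp: clearing_prices_def)
  show nonneg: "0 \<le> ps j" for j
    using wanted(1) unwanted by (cases "wanted j") (auto simp: less_imp_le)
  show "purchase i ps \<in> demand_set (ces_utility (a i) (\<rho> i)) (e i) ps" for i
    by (rule purchase_in_demand_set) (use nonneg wanted(1) in \<open>auto simp: wanted_def weight_pos_iff\<close>)
  show "(\<Sum>i\<in>UNIV. purchase i ps j) = 1" if "0 < ps j" for j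
    unfolding sum_purchase using that wanted(2)[of j] unwanted[of j] by (cases "wanted j") auto
  show "(\<Sum>i\<in>UNIV. purchase i ps j) \<le> 1" if "ps j = 0" for j
    unfolding sum_purchase using that by simp
qed

theorem tatonnement_tendsto_equilibrium:
  assumes "0 < lam" "lam \<le> 1 / 20"
    and demand: "\<And>i pr. (\<And>j. 0 < pr j) \<Longrightarrow> x i pr \<in> demand_set (ces_utility (a i) (\<rho> i)) (e i) pr"
    and run: "async_tatonnement lam (excess_demand x) T q p"
  shows "\<exists>ps. market_equilibrium (\<lambda>i. ces_utility (a i) (\<rho> i)) e ps \<and> (\<forall>j. ((\<lambda>t. p t j) \<longlongrightarrow> ps j) at_top)"
proof -
  have "excess_demand x pr j = spend pr j / pr j - 1" if "\<And>j. 0 < pr j" for pr j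
    using demand_set_imp_eq_purchase[OF demand] that by (simp add: excess_demand_def sum_purchase)
  then interpret tatonnement_run e "\<lambda>i. 1 - \<sigma> i" weight lam "excess_demand x" T q p
    using assms by unfold_locales auto
  show ?thesis
    using prices_tendsto_clearing_prices clearing_prices_imp_market_equilibrium sigma_bounds(1)
    by auto
qed

end

subsection \<open>Leontief utilities\<close>

locale leontief_buyers =
  fixes e :: "'b::finite \<Rightarrow> real" and S :: "'b \<Rightarrow> 'g::finite set" and b :: "'b \<Rightarrow> 'g \<Rightarrow> real"
  assumes budget_pos: "0 < e i" and S_nonempty: "S i \<noteq> {}" and b_pos: "j \<in> S i \<Longrightarrow> 0 < b i j"
begin

definition coeff :: "'b \<Rightarrow> 'g \<Rightarrow> real" where
  "coeff i j = (if j \<in> S i then 1 / b i j else 0)"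

sublocale leontief_market e coeff
proof
  show "\<exists>j. 0 < coeff i j" for i using S_nonempty[of i] b_pos[of _ i] by (fastforce simp: coeff_def)
qed (use budget_pos b_pos in \<open>auto simp: coeff_def less_imp_le\<close>)

lemma leontief_utility_leontief_bundle:
  "leontief_utility (S i) (b i) (leontief_bundle i p) = e i / aggregate i p"
proof -
  have "b i j * leontief_bundle i p j = e i / aggregate i p" if "j \<in> S i" for j
    using b_pos[OF that] that by (simp add: leontief_bundle_def coeff_def)
  then have "(\<lambda>j. b i j * leontief_bundle i p j) ` S i = {e i / aggregate i p}"
    using S_nonempty[of i] by auto
  then show ?thesis by (simp add: leontief_utility_def)
qed

lemma coeff_mult_le_if_le_leontief_utility:
  assumes "m \<le> leontief_utility (S i) (b i) y" "0 \<le> y j"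
  shows "m * coeff i j \<le> y j"
proof (cases "j \<in> S i")
  case True
  then have "m \<le> b i j * y j" using assms(1) S_nonempty by (simp add: leontief_utility_def)
  then show ?thesis using b_pos[OF True] True by (simp add: coeff_def field_simps)
qed (use assms in \<open>simp add: coeff_def\<close>)

lemma cost_leontief_bundle:
  assumes "\<And>j. 0 \<le> p j" "0 < aggregate i p"
  shows "(\<Sum>j\<in>UNIV. p j * leontief_bundle i p j) = e i"
proof -
  have "(\<Sum>j\<in>UNIV. p j * leontief_bundle i p j) = e i * (\<Sum>j\<in>UNIV. coeff i j * p j) / aggregate i p"
    unfolding leontief_bundle_def sum_distrib_left sum_divide_distrib by (simp add: mult_ac)
  then show ?thesis using assms(2) by (simp flip: aggregate_linear[OF assms(1)])
qed

lemma leontief_bundle_in_demand_set: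
  assumes p: "\<And>j. 0 \<le> p j" and agg: "0 < aggregate i p"
  shows "leontief_bundle i p \<in> demand_set (leontief_utility (S i) (b i)) (e i) p"
proof -
  have "leontief_utility (S i) (b i) y \<le> e i / aggregate i p"
    if y: "\<And>j. 0 \<le> y j" "(\<Sum>j\<in>UNIV. p j * y j) \<le> e i" for y
  proof -
    have "leontief_utility (S i) (b i) y * aggregate i p
        = (\<Sum>j\<in>UNIV. p j * (leontief_utility (S i) (b i) y * coeff i j))"
      unfolding aggregate_linear[OF p] sum_distrib_left by (simp add: mult_ac)
    also have "\<dots> \<le> (\<Sum>j\<in>UNIV. p j * y j)"
      using p y(1) by (intro sum_mono mult_left_mono coeff_mult_le_if_le_leontief_utility) auto
    finally show ?thesis using y(2) agg by (simp add: pos_le_divide_eq)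
  qed
  moreover have "0 \<le> leontief_bundle i p j" for j
    using e_nonneg c_nonneg aggregate_nonneg by (simp add: leontief_bundle_def)
  ultimately show ?thesis
    using cost_leontief_bundle[OF assms]
    by (simp add: demand_set_def leontief_utility_leontief_bundle)
qed

lemma demand_set_imp_eq_leontief_bundle:
  assumes y: "y \<in> demand_set (leontief_utility (S i) (b i)) (e i) p" and p: "\<And>j. 0 < p j"
  shows "y = leontief_bundle i p"
proof (rule bundle_eq_if_ge_and_cost_le[OF p])
  have agg: "0 < aggregate i p" using p by (intro aggregate_pos)
  have p_nonneg: "0 \<le> p j" for j using p by (simp add: less_imp_le)
  have "e i / aggregate i p \<le> leontief_utility (S i) (b i) y"
    using y leontief_bundle_in_demand_set[OF p_nonneg agg]
    by (auto simp: demand_set_def simp flip: leontief_utility_leontief_bundle)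
  then have "e i / aggregate i p * coeff i j \<le> y j" for j
    by (rule coeff_mult_le_if_le_leontief_utility) (use y in \<open>simp add: demand_set_def\<close>)
  then show "leontief_bundle i p j \<le> y j" for j by (simp add: leontief_bundle_def)
  show "(\<Sum>j\<in>UNIV. p j * y j) \<le> (\<Sum>j\<in>UNIV. p j * leontief_bundle i p j)"
    using y cost_leontief_bundle[OF p_nonneg agg] by (simp add: demand_set_def)
qed

theorem tatonnement_limit_point_is_equilibrium:
  assumes "0 < lam" "lam \<le> 1 / 20"
    and demand: "\<And>i pr. (\<And>j. 0 < pr j) \<Longrightarrow> x i pr \<in> demand_set (leontief_utility (S i) (b i)) (e i) pr"
    and run: "async_tatonnement lam (excess_demand x) T q p"
    and s: "filterlim s at_top sequentially" "\<And>j. (\<lambda>n. p (s n) j) \<longlonglongrightarrow> ps j"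
  shows "market_equilibrium (\<lambda>i. leontief_utility (S i) (b i)) e ps"
proof -
  have "excess_demand x pr j = spend pr j / pr j - 1" if pr: "\<And>j. 0 < pr j" for pr j
    using demand_set_imp_eq_leontief_bundle[OF demand] leontief_demand_eq_spend[of pr j] pr
    by (simp add: excess_demand_def leontief_demand_def)
  then interpret tatonnement_run e "\<lambda>_. 1" coeff lam "excess_demand x" T q p
    using assms by unfold_locales auto
  interpret leontief_run e coeff lam "excess_demand x" T q p ..
  have lim: "limit_along s ps" using s by (simp add: limit_along_def)
  show ?thesis
  proof (rule market_equilibriumI)
    show "0 \<le> ps j" for j by (rule limit_along_nonneg[OF lim])
    then show "leontief_bundle i ps \<in> demand_set (leontief_utility (S i) (b i)) (e i) ps" for i
      by (rule leontief_bundle_in_demand_set[OF _ limit_aggregate(2)[OF lim]])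
  qed (use limit_leontief_demand_eq_1[OF lim] limit_leontief_demand_le_1[OF lim]
      in \<open>simp_all add: leontief_demand_def\<close>)
qed

end

theorem mainTheorem6:
  fixes lam :: real
    and u :: "'b::finite \<Rightarrow> ('g::finite \<Rightarrow> real) \<Rightarrow> real"
    and e :: "'b \<Rightarrow> real"
    and x :: "'b \<Rightarrow> ('g \<Rightarrow> real) \<Rightarrow> 'g \<Rightarrow> real"
    and T :: "'g \<Rightarrow> nat \<Rightarrow> real"
    and q :: "'g \<Rightarrow> nat \<Rightarrow> real"
    and p :: "real \<Rightarrow> 'g \<Rightarrow> real"
  assumes lam_pos: "0 < lam" and lam_le: "lam \<le> 1 / 23.46"
    and budgets: "\<forall>i. e i > 0"
    and demand: "\<forall>i pr. (\<forall>j. pr j > 0) \<longrightarrow> x i pr \<in> demand_set (u i) (e i) pr"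
    and run: "async_tatonnement lam (excess_demand x) T q p"
  shows
    "((\<exists>a \<rho>. \<forall>i. \<rho> i \<le> 0 \<and> (\<forall>j. a i j \<ge> 0) \<and> (\<exists>j. a i j > 0) \<and>
                u i = ces_utility (a i) (\<rho> i)) \<longrightarrow>
        (\<exists>ps. market_equilibrium u e ps \<and> (\<forall>j. ((\<lambda>t. p t j) \<longlongrightarrow> ps j) at_top)))
     \<and>
     ((\<exists>S b. \<forall>i. S i \<noteq> {} \<and> (\<forall>j\<in>S i. b i j > 0) \<and>
                u i = leontief_utility (S i) (b i)) \<longrightarrow>
        (\<forall>ps s. filterlim s at_top sequentially \<longrightarrow>
               (\<forall>j. (\<lambda>n. p (s n) j) \<longlonglongrightarrow> ps j) \<longrightarrow> market_equilibrium u e ps))"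
proof (intro conjI impI allI)
  assume "\<exists>a \<rho>. \<forall>i. \<rho> i \<le> 0 \<and> (\<forall>j. a i j \<ge> 0) \<and> (\<exists>j. a i j > 0) \<and> u i = ces_utility (a i) (\<rho> i)"
  then obtain a \<rho> where ces: "\<And>i. \<rho> i \<le> 0" "\<And>i j. 0 \<le> a i j" "\<And>i. \<exists>j. 0 < a i j"
    and u: "u = (\<lambda>i. ces_utility (a i) (\<rho> i))" by metis
  interpret ces_buyers e a \<rho> using budgets ces by unfold_locales auto
  show "\<exists>ps. market_equilibrium u e ps \<and> (\<forall>j. ((\<lambda>t. p t j) \<longlongrightarrow> ps j) at_top)"
    unfolding u using lam_pos lam_le demand run u
    by (intro tatonnement_tendsto_equilibrium) auto
next
  fix ps :: "'g \<Rightarrow> real" and s :: "nat \<Rightarrow> real"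
  assume "\<exists>S b. \<forall>i. S i \<noteq> {} \<and> (\<forall>j\<in>S i. b i j > 0) \<and> u i = leontief_utility (S i) (b i)"
    and s: "filterlim s at_top sequentially" "\<forall>j. (\<lambda>n. p (s n) j) \<longlonglongrightarrow> ps j"
  then obtain S b where leontief: "\<And>i. S i \<noteq> {}" "\<And>i j. j \<in> S i \<Longrightarrow> 0 < b i j"
    and u: "u = (\<lambda>i. leontief_utility (S i) (b i))" by metis
  interpret leontief_buyers e S b using budgets leontief by unfold_locales auto
  show "market_equilibrium u e ps"
    unfolding u using lam_pos lam_le demand run s u
    by (intro tatonnement_limit_point_is_equilibrium) auto
qed

end
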